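(* Let $0<\gamma<2$, $\lambda>0$ and $\mu<1/4$. For every $\varepsilon>0$ let $u_j=u_j^\varepsilon\in\mathcal A_\varepsilon$ be such that $(u_j^\varepsilon)_\varepsilon$ satisfies (H) with constants $\bar R,\bar c$, and let $u_{j+1}=u_{j+1}^\varepsilon$ be a minimizer of $\mathcal F^{\tau,\gamma}_\varepsilon(\cdot,u_j)$. Suppose that $\varepsilon C_\varepsilon\to\lambda$ as $\varepsilon\to0$, that $\#\partial^+I_j-8\varepsilon^{\mu-1}>C_\varepsilon$, and that $I_j$ is a discrete octagon such that $$\sum_{i=1}^4\Bigl(\frac{D_{j,i}}{\sqrt2\,\varepsilon}-2c_\alpha\Bigr)\ge C_\varepsilon+2 .$$ Then there exists $\bar\varepsilon>0$ such that for every $\varepsilon\le\bar\varepsilon$ the set $I_{j+1}$ is a (possibly degenerate) discrete octagon, and: (i) $\#\mathbb O_{j+1}\ge C_\varepsilon+2$, and $\mathscr D_{j+1,i}\subset\mathscr D_{j,i}$ for every $i$ such that $D_{j+1,i}>0$. (ii) $D_{j+1,i}=0$ for every $i$ such that $D_{j,i}=0$. (iii) There exists a constant $c$ depending only on $\bar c$ such that the displacements of the axis-parallel sides satisfy $$\alpha_{j,i}\begin{cases}=\Bigl\lfloor\frac{4\zeta}{P_{j,i}}\Bigr\rfloor&\text{if }\operatorname{dist}\bigl(\frac{4\zeta}{P_{j,i}},\mathbb N\bigr)\ge c\varepsilon,\\[0.5em]\in\Bigl\{\Bigl[\frac{4\zeta}{P_{j,i}}\Bigr]-1,\Bigl[\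frac{4\zeta}{P_{j,i}}\Bigr]\Bigr\}&\text{otherwise.}\end{cases}$$
   Context: **Model.** Fix $k\in(1/3,1)$, $\zeta>0$; for $\varepsilon>0$ set $\tau=\zeta\varepsilon$. $\mathbb N=\{1,2,\dots\}$; $[x]$ is the closest integer to $x$. $\mathcal A_\varepsilon$ is the set of $u:\varepsilon\mathbb Z^2\to\{1,-1,0\}$ with $\#\{u=0\}<\infty$. The energy is $$\mathcal E_\varepsilon(u)=\sum_{n.n.}\varepsilon\bigl(1-u(p)u(q)-k(1-(u(p)u(q))^2)\bigr),$$ the sum being over unordered pairs $\{p,q\}\subset\varepsilon\mathbb Z^2$ with $|p-q|=\varepsilon$. Put $I_u=\{u=1\}$, $Z_u=\{u=0\}$. For $I\subset\varepsilon\mathbb Z^2$, $p\in\varepsilon\mathbb Z^2$, let $d^\varepsilon_1(p,\partial I)=\inf\{\|p-q\|_1:q\in I\}$ if $p\notin I$ and $=\inf\{\|p-q\|_1:q\in\varepsilon\mathbb Z^2\setminus I\}$ if $p\in I$. For $\gamma>0$, $$\mathcal F^{\tau,\gamma}_\varepsilon(u,w)=\mathcal E_\varepsilon(u)+\frac1\tau\Bigl(\sum_{p\in I_u\triangle I_w}\varepsilon^2d^\varepsilon_1(p,\partial I_w)+\varepsilon^\gamma|\#Z_u-\#Z_w|\Bigr).$$ Minimizers of $\mathcal F^{\tau,\gamma}_\varepsilon(\cdot,w)$ are over $\mathcal A_\varepsilon$. Write $I_j,Z_j$ for $I_{u_j},Z_{u_j}$, $A_I=\bigcup_{p\in I}(p+\varepsilon[-\frac12,\frac12]^2)$;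 dependence on $\varepsilon$ is omitted. $C_\varepsilon:=\#Z_j$ (the number of surfactant particles; constant along the scheme when $\gamma<2$ and $\varepsilon$ is small). **Discrete sets.** $\mathcal N(p)=\{p\pm\varepsilon e_1,p\pm\varepsilon e_2\}$. $\partial^+I=\{p\in\varepsilon\mathbb Z^2\setminus I:\mathcal N(p)\cap I\neq\emptyset\}$. $\mathbb O_j=\{p\in\partial^+I_j:\#(\mathcal N(p)\cap I_j)=2\}$. If $q=p+n\varepsilon v$ with $n\in\mathbb N\cup\{0\}$, $v\in\{e_1,e_2,e_1+e_2,e_1-e_2\}$, then $[\![p,q]\!]=\{p+s\varepsilon v:s=0,\dots,n\}$. A staircase set is a set $I\subset\varepsilon\mathbb Z^2$ that is connected (through nearest-neighbour paths) and horizontally and vertically convex (contains $[\![p,q]\!]$ whenever it contains two points $p,q$ on a common row or column). Its external slices are $\mathscr P_1$ (lowest row), $\mathscr P_2$ (leftmost column), $\mathscr P_3$ (highest row), $\mathscr P_4$ (rightmost column), $\mathscr P_i=[\![p^i,q^i]\!]$, where $p^i$ is the left (resp. lower) endpoint. **(H).** A family $(I^\varepsilon)_\varepsilon$ satisfies (H) if there are positive constants $\bar R,\bar c$ such that all $I^\varepsilon$ are staircase sets contained in a ball of radius $\bar R$ and $\min_i\#\mathscr P^\varepsilon_i\ge\bar c/\varepsilon$; $(u_j^\varepsilon)_\varepsilon$ satisfies (H) if $(I_j^\varepsilon)_\varepsilon$ does. **Octagons.** $\mathcal W$ is the set of (possibly degenerate) convex octagons in $\mathbb R^2$ with sides parallel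 to $e_1,e_2,e_1+e_2,e_1-e_2$. The lengths of the sides parallel to the axes are $P_1$ (lowest), $P_2,P_3,P_4$ clockwise; those of the diagonal sides are $D_1$ (lower left), $D_2,D_3,D_4$ clockwise; sides may have zero length. A discrete octagon is a set $I=A\cap\varepsilon\mathbb Z^2$, $A\in\mathcal W$ (degenerate if $A$ is); its side lengths $P_i,D_i$ are those of the smallest element of $\mathcal W$ containing $A_I$. Its diagonal sides are the discrete segments $\mathscr D_1=[\![p^2,p^1]\!]$ (lower left) and, analogously and clockwise, $\mathscr D_2,\mathscr D_3,\mathscr D_4$, each joining the neighbouring endpoints of two consecutive external slices. For a discrete octagon $I_j$ one writes $I_j=\tilde I_j\cup(\bigcup_{i=1}^4\mathscr P_{j,i})$, with $\tilde I_j$ a discrete octagon and $\mathscr P_{j,i}$ the external slices of $I_j$; $\tilde P_{j,i}$ are the lengths of the axis-parallel sides of $\tilde I_j$. Set $$c_\alpha:=\Bigl\lfloor\frac{4\zeta}{\min_i\tilde P_{j,i}}\Bigr\rfloor+2 .$$ **Displacements.** For discrete octagons $I_{j+1}\subset I_j$, let $P_{s,i},D_{s,i}$ ($s=j,j+1$) be the side lengths of the smallest element of $\mathcal W$ containing $A_{I_s}$. Let $a_{j,i}$ be the Euclidean distance between the parallel lines containing the $i$-th axis-parallel sides of these two octagons, and set $\alpha_{j,i}=a_{j,i}/\varepsilon\in\mathbb N\cup\{0\}$. *)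

theory Defs
  imports "HOL-Analysis.Analysis"
begin

type_synonym point = "real \<times> real"

definition grid :: "real \<Rightarrow> point set" where
  "grid \<epsilon> = {(\<epsilon> * of_int m, \<epsilon> * of_int n) | m n :: int. True}"

definition norm1 :: "point \<Rightarrow> real" where
  "norm1 p = \<bar>fst p\<bar> + \<bar>snd p\<bar>"

text \<open>Spin fields are extensional, so they are exactly the functions on the grid.\<close>

definition admissible :: "real \<Rightarrow> (point \<Rightarrow> real) set" where
  "admissible \<epsilon> = {u \<in> grid \<epsilon> \<rightarrow>\<^sub>E {1, -1, 0}. finite {p \<in> grid \<epsilon>. u p = 0}}"

definition phase :: "real \<Rightarrow> (point \<Rightarrow> real) \<Rightarrow> point set" where
  "phase \<epsilon> u = {p \<in> grid \<epsilon>. u p = 1}"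

definition surf :: "real \<Rightarrow> (point \<Rightarrow> real) \<Rightarrow> point set" where
  "surf \<epsilon> u = {p \<in> grid \<epsilon>. u p = 0}"

text \<open>Unordered nearest-neighbour pairs; for such a pair \<open>e = {p, q}\<close> one has
  \<open>prod u e = u p * u q\<close>.\<close>

definition bonds :: "real \<Rightarrow> point set set" where
  "bonds \<epsilon> = {{p, q} | p q. p \<in> grid \<epsilon> \<and> q \<in> grid \<epsilon> \<and> dist p q = \<epsilon>}"

text \<open>For \<open>\<epsilon> > 0\<close>, \<open>k < 1\<close> and admissible \<open>u\<close> every summand is nonnegative, and the sum
  may be infinite; hence values in \<^typ>\<open>ennreal\<close>.\<close>

definition energy :: "real \<Rightarrow> real \<Rightarrow> (point \<Rightarrow> real) \<Rightarrow> ennreal" where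
  "energy k \<epsilon> u = (\<Sum>\<^sub>\<infinity>e\<in>bonds \<epsilon>. ennreal (\<epsilon> * (1 - prod u e - k * (1 - (prod u e)\<^sup>2))))"

text \<open>The distance to the boundary is infinite if \<open>I\<close> is empty or the whole grid.\<close>

definition bdist :: "real \<Rightarrow> point set \<Rightarrow> point \<Rightarrow> ennreal" where
  "bdist \<epsilon> I p =
     (if p \<in> I then (INF q\<in>grid \<epsilon> - I. ennreal (norm1 (p - q)))
      else (INF q\<in>I. ennreal (norm1 (p - q))))"

definition functional ::
  "real \<Rightarrow> real \<Rightarrow> real \<Rightarrow> real \<Rightarrow> (point \<Rightarrow> real) \<Rightarrow> (point \<Rightarrow> real) \<Rightarrow> ennreal" where
  "functional k \<tau> \<gamma> \<epsilon> u w =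
     energy k \<epsilon> u + ennreal (1 / \<tau>) *
       ((\<Sum>\<^sub>\<infinity>p\<in>(phase \<epsilon> u - phase \<epsilon> w) \<union> (phase \<epsilon> w - phase \<epsilon> u).
           ennreal (\<epsilon>\<^sup>2) * bdist \<epsilon> (phase \<epsilon> w) p)
        + ennreal (\<epsilon> powr \<gamma> * \<bar>real (card (surf \<epsilon> u)) - real (card (surf \<epsilon> w))\<bar>))"

definition minimizer ::
  "real \<Rightarrow> real \<Rightarrow> real \<Rightarrow> real \<Rightarrow> (point \<Rightarrow> real) \<Rightarrow> (point \<Rightarrow> real) \<Rightarrow> bool" where
  "minimizer k \<tau> \<gamma> \<epsilon> w u \<longleftrightarrow>
     is_arg_min (\<lambda>v. functional k \<tau> \<gamma> \<epsilon> v w) (\<lambda>v. v \<in> admissible \<epsilon>) u"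

definition cells :: "real \<Rightarrow> point set \<Rightarrow> point set" where
  "cells \<epsilon> I = (\<Union>p\<in>I. (\<lambda>x. p + \<epsilon> *\<^sub>R x) ` cbox (-1/2, -1/2) (1/2, 1/2))"

definition nbrs :: "real \<Rightarrow> point \<Rightarrow> point set" where
  "nbrs \<epsilon> p = {p + (\<epsilon>, 0), p - (\<epsilon>, 0), p + (0, \<epsilon>), p - (0, \<epsilon>)}"

definition outer_bd :: "real \<Rightarrow> point set \<Rightarrow> point set" where
  "outer_bd \<epsilon> I = {p \<in> grid \<epsilon> - I. nbrs \<epsilon> p \<inter> I \<noteq> {}}"

definition corner_sites :: "real \<Rightarrow> point set \<Rightarrow> point set" where
  "corner_sites \<epsilon> I = {p \<in> outer_bd \<epsilon> I. card (nbrs \<epsilon> p \<inter> I) = 2}"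

text \<open>The discrete segment from \<open>p\<close> to \<open>q\<close>; it is empty unless \<open>q - p\<close> is a nonnegative integer
  multiple of \<open>\<epsilon> v\<close> for one of the four directions \<open>v\<close>.\<close>

definition dseg :: "real \<Rightarrow> point \<Rightarrow> point \<Rightarrow> point set" where
  "dseg \<epsilon> p q = {p + (real s * \<epsilon>) *\<^sub>R v | s n v.
     v \<in> {(1, 0), (0, 1), (1, 1), (1, -1)} \<and> q = p + (real n * \<epsilon>) *\<^sub>R v \<and> s \<le> n}"

definition staircase :: "real \<Rightarrow> point set \<Rightarrow> bool" where
  "staircase \<epsilon> I \<longleftrightarrow> I \<subseteq> grid \<epsilon> \<and>
     (\<forall>p\<in>I. \<forall>q\<in>I. (p, q) \<in> {(a, b). a \<in> I \<and> b \<in> I \<and> dist a b = \<epsilon>}\<^sup>*) \<and>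
     (\<forall>p\<in>I. \<forall>q\<in>I. fst p = fst q \<or> snd p = snd q \<longrightarrow> dseg \<epsilon> p q \<subseteq> I)"

text \<open>The points of \<open>A\<close> that are extremal in direction \<open>\<nu>\<close>. This serves for the sides of an
  octagon (with outer normal \<open>\<nu>\<close>), for the external slices of a discrete set, and for the
  endpoints of such a slice.\<close>

definition extremal :: "point set \<Rightarrow> point \<Rightarrow> point set" where
  "extremal A \<nu> = {p \<in> A. \<forall>q\<in>A. \<nu> \<bullet> q \<le> \<nu> \<bullet> p}"

text \<open>Outer normals for the indices \<open>1, \<dots>, 4\<close>. Axis-parallel sides: lowest, leftmost, highest,
  rightmost. Diagonal sides: lower left, upper left, upper right, lower right.\<close>

definition axis_nu :: "nat \<Rightarrow> point" where
  "axis_nu i = [(0, -1), (-1, 0), (0, 1), (1, 0)] ! (i - 1)"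

definition diag_nu :: "nat \<Rightarrow> point" where
  "diag_nu i = [(-1, -1), (-1, 1), (1, 1), (1, -1)] ! (i - 1)"

definition slice :: "point set \<Rightarrow> nat \<Rightarrow> point set" where
  "slice I i = extremal I (axis_nu i)"

definition slice_p :: "point set \<Rightarrow> nat \<Rightarrow> point" where
  "slice_p I i = the_elem (extremal (slice I i) (if odd i then (-1, 0) else (0, -1)))"

definition slice_q :: "point set \<Rightarrow> nat \<Rightarrow> point" where
  "slice_q I i = the_elem (extremal (slice I i) (if odd i then (1, 0) else (0, 1)))"

definition diag_seg :: "real \<Rightarrow> point set \<Rightarrow> nat \<Rightarrow> point set" where
  "diag_seg \<epsilon> I i =
     [dseg \<epsilon> (slice_p I 2) (slice_p I 1),
      dseg \<epsilon> (slice_q I 2) (slice_p I 3),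
      dseg \<epsilon> (slice_q I 3) (slice_q I 4),
      dseg \<epsilon> (slice_q I 1) (slice_p I 4)] ! (i - 1)"

text \<open>Condition (H) at scale \<open>\<epsilon>\<close>, with constants \<open>R\<close> and \<open>c\<close> that do not depend on \<open>\<epsilon>\<close>.\<close>

definition cond_H :: "real \<Rightarrow> real \<Rightarrow> real \<Rightarrow> point set \<Rightarrow> bool" where
  "cond_H R c \<epsilon> I \<longleftrightarrow> staircase \<epsilon> I \<and> (\<exists>x. I \<subseteq> ball x R) \<and>
     real (MIN i\<in>{1..4}. card (slice I i)) \<ge> c / \<epsilon>"

text \<open>Convex octagons, as nonempty intersections of eight half-planes; some of the constraints
  may be redundant or leave only a vertex, so sides of length zero are allowed.\<close>

definition octagons :: "point set set" where
  "octagons = {A. A \<noteq> {} \<and> (\<exists>a1 b1 a2 b2 c1 d1 c2 d2.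
     A = {(x, y). a1 \<le> x \<and> x \<le> b1 \<and> a2 \<le> y \<and> y \<le> b2 \<and>
                  c1 \<le> x + y \<and> x + y \<le> d1 \<and> c2 \<le> x - y \<and> x - y \<le> d2})}"

definition discrete_octagon :: "real \<Rightarrow> point set \<Rightarrow> bool" where
  "discrete_octagon \<epsilon> I \<longleftrightarrow> (\<exists>A\<in>octagons. I = A \<inter> grid \<epsilon>)"

definition oct_hull :: "real \<Rightarrow> point set \<Rightarrow> point set" where
  "oct_hull \<epsilon> I = (LEAST A. A \<in> octagons \<and> cells \<epsilon> I \<subseteq> A)"

definition axis_len :: "real \<Rightarrow> point set \<Rightarrow> nat \<Rightarrow> real" where
  "axis_len \<epsilon> I i = diameter (extremal (oct_hull \<epsilon> I) (axis_nu i))"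

definition diag_len :: "real \<Rightarrow> point set \<Rightarrow> nat \<Rightarrow> real" where
  "diag_len \<epsilon> I i = diameter (extremal (oct_hull \<epsilon> I) (diag_nu i))"

text \<open>The set that remains of \<open>I\<close> when its four external slices are removed; for a discrete octagon
  it is again a discrete octagon.\<close>

definition inner_oct :: "point set \<Rightarrow> point set" where
  "inner_oct I = I - (\<Union>i\<in>{1..4}. slice I i)"

definition c_alpha :: "real \<Rightarrow> real \<Rightarrow> point set \<Rightarrow> int" where
  "c_alpha \<zeta> \<epsilon> I = \<lfloor>4 * \<zeta> / (MIN i\<in>{1..4}. axis_len \<epsilon> (inner_oct I) i)\<rfloor> + 2"

definition axis_line :: "real \<Rightarrow> point set \<Rightarrow> nat \<Rightarrow> point set" where
  "axis_line \<epsilon> I i = {x. axis_nu i \<bullet> x = (SUP y\<in>oct_hull \<epsilon> I. axis_nu i \<bullet> y)}"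

text \<open>Displacement of the \<open>i\<close>-th axis-parallel side between \<open>I\<close> and a subset \<open>J\<close> of \<open>I\<close>, in
  units of \<open>\<epsilon>\<close>.\<close>

definition displacement :: "real \<Rightarrow> point set \<Rightarrow> point set \<Rightarrow> nat \<Rightarrow> real" where
  "displacement \<epsilon> I J i = setdist (axis_line \<epsilon> I i) (axis_line \<epsilon> J i) / \<epsilon>"

end

theory Submission
  imports Defs
begin

text \<open>
In lattice coordinates the old phase is an octagon \<open>X\<close> of integer points, and the new phase is
found by deciding which rows and columns of \<open>X\<close> to give up.

\<^emph>\<open>Energy.\<close> For spins \<open>s\<close> and \<open>t\<close> the cost \<open>1 - s t - k (1 - (s t)\<^sup>2)\<close> of a bond is at least \<open>\<bar>t - s\<bar>\<close> minus
\<open>k\<close> for each end that carries a particle. A site has four bonds, and a row or column that meets the phase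
has variation at least \<open>4\<close>. So, in units of \<open>\<epsilon>\<close>, the energy is at least four times the number of rows and
columns that meet the phase, minus \<open>4 k\<close> per particle (\<open>lattice_energy_ge\<close>). Equality holds for line-convex phases
if the particles sit on corner sites, no two of them adjacent (\<open>lattice_energy_corners\<close>).

\<^emph>\<open>Reduction to lines.\<close> Only the set \<open>T\<close> of rows and columns of \<open>X\<close> that the new phase misses matters for
this bound. Each of them saves \<open>4\<close>, but all its points are lost, at the price \<open>\<epsilon> / \<zeta>\<close> times their depth in
\<open>X\<close>. Removing exactly the lines of an optimal \<open>T\<close> and putting the particles on corner sites of the
resulting set attains the lower bound, because these corner sites lie outside \<open>X\<close> and cost no dissipation.
The penalty on the number of particles is of order \<open>\<epsilon> powr (\<gamma> - 2)\<close>, which tends to infinity, so this number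
does not change. Consequently the phase of a minimizer is \<open>X\<close> without the lines of an optimal \<open>T\<close>, and nothing else
is changed (\<open>minimizer_removes_optimal_lines\<close>).

\<^emph>\<open>Optimal lines.\<close> A line at position \<open>t\<close> next to a side of length \<open>P\<close> costs \<open>t P / \<zeta>\<close> up to an error of order \<open>\<epsilon>\<close>.
Lines far inside are too expensive, and the cost increases with \<open>t\<close>, so the outermost lines are removed as long as
\<open>t P < 4 \<zeta>\<close>, up to the error. This gives \<open>\<alpha> = \<lfloor>4 \<zeta> / P\<rfloor>\<close> unless \<open>4 \<zeta> / P\<close> is within order \<open>\<epsilon>\<close> of a positive integer
(\<open>optimal_removal\<close>, \<open>optimal_shape\<close>, \<open>almost_floor\<close>).

\<^emph>\<open>Shape.\<close> Without its \<open>\<alpha> i\<close> outermost lines at each side, an octagon is an octagon whose diagonal sides lie on the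
same lines and are shorter by the displacements of their two neighbours, or absent (\<open>shrink\<close>, \<open>shrink_pts\<close>).
Since the displacements are at most \<^const>\<open>c_alpha\<close>, the hypothesis on the diagonal sides leaves
enough corner sites for all particles.
\<close>

section \<open>Spin energy along lattice lines\<close>

definition bond_energy :: "real \<Rightarrow> real \<Rightarrow> real \<Rightarrow> real" where
  "bond_energy k s t = 1 - s * t - k * (1 - (s * t)\<^sup>2)"

text \<open>The energy splits into a total variation and a reward \<open>k\<close> for each end of a bond that carries a
  particle. The loss in this estimate is \<open>1 + k\<close> on a bond between two particles and zero on all
  other bonds, so it is sharp as long as no two particles are neighbours.\<close>

lemma bond_energy_ge:
  assumes "0 < k" "s \<in> {1, -1, 0}" "t \<in> {1, -1, 0}"
  shows "\<bar>t - s\<bar> - k * (of_bool (s = 0) + of_bool (t = 0)) \<le> bond_energy k s t"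
  using assms by (auto simp: bond_energy_def)

lemma bond_energy_eq:
  assumes "s \<in> {1, -1, 0}" "t \<in> {1, -1, 0}" "s \<noteq> 0 \<or> t \<noteq> 0"
  shows "bond_energy k s t = \<bar>t - s\<bar> - k * (of_bool (s = 0) + of_bool (t = 0))"
  using assms by (auto simp: bond_energy_def)

lemma bond_energy_nonneg:
  assumes "k < 1" "s \<in> {1, -1, 0}" "t \<in> {1, -1, 0}"
  shows "0 \<le> bond_energy k s t"
  using assms by (auto simp: bond_energy_def)

lemma int_interval_split:
  assumes "(a::int) \<le> m" "m \<le> b"
  shows "sum f {a..<b} = sum f {a..<m} + (sum f {m..<b} :: 'a::comm_monoid_add)"
proof -
  have "{a..<b} = {a..<m} \<union> {m..<b}" using assms by auto
  then show ?thesis by (simp add: sum.union_disjoint ivl_disj_int)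
qed

lemma variation_ge:
  fixes f :: "int \<Rightarrow> real"
  assumes "a \<le> b"
  shows "\<bar>f b - f a\<bar> \<le> (\<Sum>x\<in>{a..<b}. \<bar>f (x + 1) - f x\<bar>)"
  using assms
proof (induction b rule: int_ge_induct)
  case (step b)
  have "sum (\<lambda>x. \<bar>f (x + 1) - f x\<bar>) {a..<b+1} = sum (\<lambda>x. \<bar>f (x + 1) - f x\<bar>) {a..<b} + \<bar>f (b+1) - f b\<bar>"
    using step.hyps by (subst int_interval_split[of a b]) (auto simp: atLeastLessThanPlusOne_atLeastAtMost_int)
  then show ?case using step.IH by linarith
qed simp

lemma variation_mono:
  fixes f :: "int \<Rightarrow> real"
  assumes "a \<le> b" "\<And>x. a \<le> x \<Longrightarrow> x < b \<Longrightarrow> f x \<le> f (x + 1)"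
  shows "(\<Sum>x\<in>{a..<b}. \<bar>f (x + 1) - f x\<bar>) = f b - f a"
  using assms
proof (induction b rule: int_ge_induct)
  case (step b)
  have "sum (\<lambda>x. \<bar>f (x + 1) - f x\<bar>) {a..<b+1} = sum (\<lambda>x. \<bar>f (x + 1) - f x\<bar>) {a..<b} + \<bar>f (b+1) - f b\<bar>"
    using step.hyps by (subst int_interval_split[of a b]) (auto simp: atLeastLessThanPlusOne_atLeastAtMost_int)
  moreover have "sum (\<lambda>x. \<bar>f (x + 1) - f x\<bar>) {a..<b} = f b - f a"
    using step.prems by (intro step.IH) auto
  ultimately show ?case using step.prems(1)[of b] step.hyps by simp
qed simp

definition line_energy :: "real \<Rightarrow> (int \<Rightarrow> real) \<Rightarrow> int \<Rightarrow> real" where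
  "line_energy k f M = (\<Sum>x\<in>{-M..<M}. bond_energy k (f x) (f (x + 1)))"

lemma zeros_along_line:
  fixes f :: "int \<Rightarrow> real"
  assumes out: "\<And>x. \<bar>x\<bar> \<ge> M \<Longrightarrow> f x = -1"
  shows "(\<Sum>x\<in>{-M..<M}. of_bool (f x = 0) + of_bool (f (x + 1) = 0)) = 2 * real (card {x. f x = 0})"
proof -
  have Z: "{x. f x = 0} \<subseteq> {-M<..<M}"
  proof
    fix x assume "x \<in> {x. f x = 0}"
    then have "\<bar>x\<bar> < M" using out[of x] by force
    then show "x \<in> {-M<..<M}" by auto
  qed
  have 1: "(\<Sum>x\<in>{-M..<M}. of_bool (f x = 0)) = real (card {x. f x = 0})"
  proof -
    have "{-M..<M} \<inter> {x. f x = 0} = {x. f x = 0}" using Z by auto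
    then show ?thesis by (simp)
  qed
  have 2: "(\<Sum>x\<in>{-M..<M}. of_bool (f (x + 1) = 0)) = real (card {x. f x = 0})"
  proof -
    have "{x. f x = 0} = (\<lambda>x. x + 1) ` ({-M..<M} \<inter> {x. f (x + 1) = 0})"
      using Z by (auto intro!: image_eqI[of _ _ "_ - 1"])
    then have "card {x. f x = 0} = card ({-M..<M} \<inter> {x. f (x + 1) = 0})"
      by (simp add: card_image)
    then show ?thesis by simp
  qed
  show ?thesis using 1 2 by (simp add: sum.distrib)
qed

text \<open>A line that meets the phase \<open>1\<close> rises from \<open>-1\<close> to \<open>1\<close> and falls back, which gives variation at least
  \<open>4\<close>; each particle on the line is an end of two of its bonds.\<close>

lemma line_energy_ge:
  assumes k: "0 < k" and val: "\<And>x. f x \<in> {1, -1, 0}"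
    and out: "\<And>x. \<bar>x\<bar> \<ge> M \<Longrightarrow> f x = -1"
  shows "(if \<exists>x. f x = 1 then 4 else 0) - 2 * k * real (card {x. f x = 0}) \<le> line_energy k f M"
proof -
  have var: "(if \<exists>x. f x = 1 then 4 else 0) \<le> (\<Sum>x\<in>{-M..<M}. \<bar>f (x + 1) - f x\<bar>)"
  proof (cases "\<exists>x. f x = 1")
    case True
    then obtain m where m: "f m = 1" by blast
    then have M: "-M \<le> m" "m \<le> M" using out[of m] by force+
    have "4 = \<bar>f m - f (-M)\<bar> + \<bar>f M - f m\<bar>" using m M out[of M] out[of "-M"] by simp
    also have "\<dots> \<le> (\<Sum>x\<in>{-M..<M}. \<bar>f (x + 1) - f x\<bar>)"
      using variation_ge[OF M(1), of f] variation_ge[OF M(2), of f] M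
      by (subst int_interval_split[OF M]) linarith
    finally show ?thesis using True by simp
  qed (simp add: sum_nonneg)
  have "(\<Sum>x\<in>{-M..<M}. \<bar>f (x + 1) - f x\<bar> - k * (of_bool (f x = 0) + of_bool (f (x + 1) = 0))) \<le> line_energy k f M"
    unfolding line_energy_def by (intro sum_mono bond_energy_ge k val)
  also have "(\<Sum>x\<in>{-M..<M}. \<bar>f (x + 1) - f x\<bar> - k * (of_bool (f x = 0) + of_bool (f (x + 1) = 0)))
     = (\<Sum>x\<in>{-M..<M}. \<bar>f (x + 1) - f x\<bar>) - 2 * k * real (card {x. f x = 0})"
    using zeros_along_line[of M f, OF out] by (simp add: sum_subtractf sum_distrib_left[symmetric])
  finally show ?thesis using var by linarith
qed

lemma line_energy_unimodal:
  assumes val: "\<And>x. f x \<in> {1, -1, 0}"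
    and out: "\<And>x. \<bar>x\<bar> \<ge> M \<Longrightarrow> f x = -1"
    and nz: "\<And>x. f x \<noteq> 0 \<or> f (x + 1) \<noteq> 0"
    and top: "f m = 1"
    and up: "\<And>x. x < m \<Longrightarrow> f x \<le> f (x + 1)"
    and down: "\<And>x. m \<le> x \<Longrightarrow> f (x + 1) \<le> f x"
  shows "line_energy k f M = 4 - 2 * k * real (card {x. f x = 0})"
proof -
  have M: "-M \<le> m" "m \<le> M" using top out[of m] by force+
  have "line_energy k f M =
    (\<Sum>x\<in>{-M..<M}. \<bar>f (x + 1) - f x\<bar> - k * (of_bool (f x = 0) + of_bool (f (x + 1) = 0)))"
    unfolding line_energy_def by (intro sum.cong bond_energy_eq refl val nz)
  also have "\<dots> = (\<Sum>x\<in>{-M..<M}. \<bar>f (x + 1) - f x\<bar>) - 2 * k * real (card {x. f x = 0})"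
    using zeros_along_line[of M f, OF out] by (simp add: sum_subtractf sum_distrib_left[symmetric])
  also have "(\<Sum>x\<in>{-M..<M}. \<bar>f (x + 1) - f x\<bar>) = 4"
  proof -
    have "(\<Sum>x\<in>{-M..<m}. \<bar>f (x + 1) - f x\<bar>) = f m - f (-M)"
      by (rule variation_mono) (use M up in auto)
    moreover have "(\<Sum>x\<in>{m..<M}. \<bar>(- f (x + 1)) - (- f x)\<bar>) = (- f M) - (- f m)"
      by (rule variation_mono) (use M down in auto)
    moreover have "\<bar>(- f (x + 1)) - (- f x)\<bar> = \<bar>f (x + 1) - f x\<bar>" for x by simp
    ultimately show ?thesis using out[of M] out[of "-M"] M top
      by (subst int_interval_split[OF M]) simp
  qed
  finally show ?thesis .
qed

definition lattice_energy :: "real \<Rightarrow> (int \<times> int \<Rightarrow> real) \<Rightarrow> int \<Rightarrow> real" where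
  "lattice_energy k v M = (\<Sum>y\<in>{-M..M}. line_energy k (\<lambda>x. v (x, y)) M)
     + (\<Sum>x\<in>{-M..M}. line_energy k (\<lambda>y. v (x, y)) M)"

lemma zeros_by_rows:
  fixes v :: "int \<times> int \<Rightarrow> real"
  assumes out: "\<And>x y. \<bar>x\<bar> \<ge> M \<or> \<bar>y\<bar> \<ge> M \<Longrightarrow> v (x, y) = -1"
  shows "(\<Sum>y\<in>{-M..M}. real (card {x. v (x, y) = 0})) = real (card {p. v p = 0})"
    and "(\<Sum>x\<in>{-M..M}. real (card {y. v (x, y) = 0})) = real (card {p. v p = 0})"
proof -
  have in_box: "v (x, y) = 0 \<Longrightarrow> x \<in> {-M..M} \<and> y \<in> {-M..M}" for x y
    using out[of x y] by force
  have fin: "finite {x. v (x, y) = 0}" "finite {y. v (x, y) = 0}" for x y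
    using in_box by (auto intro!: finite_subset[of _ "{-M..M}"])
  have "{p. v p = 0} = (SIGMA x:{-M..M}. {y. v (x, y) = 0})" using in_box by auto
  then show "(\<Sum>x\<in>{-M..M}. real (card {y. v (x, y) = 0})) = real (card {p. v p = 0})"
    using fin by simp
  have "{p. v p = 0} = prod.swap ` (SIGMA y:{-M..M}. {x. v (x, y) = 0})" using in_box by force
  then have "card {p. v p = 0} = card (SIGMA y:{-M..M}. {x. v (x, y) = 0})"
    by (simp add: card_image)
  then show "(\<Sum>y\<in>{-M..M}. real (card {x. v (x, y) = 0})) = real (card {p. v p = 0})"
    using fin by simp
qed

lemma lines_hit:
  fixes v :: "int \<times> int \<Rightarrow> real"
  assumes out: "\<And>x y. \<bar>x\<bar> \<ge> M \<or> \<bar>y\<bar> \<ge> M \<Longrightarrow> v (x, y) = -1"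
  shows "(\<Sum>y\<in>{-M..M}. if \<exists>x. v (x, y) = 1 then 4 else 0) = 4 * real (card (snd ` {p. v p = 1}))"
    and "(\<Sum>x\<in>{-M..M}. if \<exists>y. v (x, y) = 1 then 4 else 0) = 4 * real (card (fst ` {p. v p = 1}))"
proof -
  have in_box: "v (x, y) = 1 \<Longrightarrow> x \<in> {-M..M} \<and> y \<in> {-M..M}" for x y
    using out[of x y] by force
  have "{-M..M} \<inter> {y. \<exists>x. v (x, y) = 1} = snd ` {p. v p = 1}"
    and "{-M..M} \<inter> {x. \<exists>y. v (x, y) = 1} = fst ` {p. v p = 1}"
    using in_box by (force simp: image_iff)+
  then show "(\<Sum>y\<in>{-M..M}. if \<exists>x. v (x, y) = 1 then 4 else 0) = 4 * real (card (snd ` {p. v p = 1}))"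
    and "(\<Sum>x\<in>{-M..M}. if \<exists>y. v (x, y) = 1 then 4 else 0) = 4 * real (card (fst ` {p. v p = 1}))"
    by (simp_all add: sum.If_cases)
qed

text \<open>The length of the phase boundary enters only through the number of rows and columns that the phase
  meets, so the bound is the same for all shapes that miss the same lines.\<close>

lemma lattice_energy_ge:
  assumes k: "0 < k" and val: "\<And>p. v p \<in> {1, -1, 0}"
    and out: "\<And>x y. \<bar>x\<bar> \<ge> M \<or> \<bar>y\<bar> \<ge> M \<Longrightarrow> v (x, y) = -1"
  shows "4 * real (card (fst ` {p. v p = 1}) + card (snd ` {p. v p = 1}))
           - 4 * k * real (card {p. v p = 0}) \<le> lattice_energy k v M"
proof -
  have "(\<Sum>y\<in>{-M..M}. (if \<exists>x. v (x, y) = 1 then 4 else 0) - 2 * k * real (card {x. v (x, y) = 0}))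
      + (\<Sum>x\<in>{-M..M}. (if \<exists>y. v (x, y) = 1 then 4 else 0) - 2 * k * real (card {y. v (x, y) = 0}))
      \<le> lattice_energy k v M"
    unfolding lattice_energy_def
    by (intro add_mono sum_mono line_energy_ge k val) (auto simp: out)
  then show ?thesis
    by (simp add: sum_subtractf sum_distrib_left[symmetric] zeros_by_rows[of M v, OF out] lines_hit[of M v, OF out] algebra_simps)
qed

definition line_convex :: "(int \<times> int) set \<Rightarrow> bool" where
  "line_convex J \<longleftrightarrow> (\<forall>x x' x'' y. (x, y) \<in> J \<and> (x'', y) \<in> J \<and> x \<le> x' \<and> x' \<le> x'' \<longrightarrow> (x', y) \<in> J) \<and>
     (\<forall>x y y' y''. (x, y) \<in> J \<and> (x, y'') \<in> J \<and> y \<le> y' \<and> y' \<le> y'' \<longrightarrow> (x, y') \<in> J)"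

lemma line_energy_const: "line_energy k (\<lambda>x. -1) M = 0"
  by (simp add: line_energy_def bond_energy_def)

text \<open>Convexity along the line and the requirement that a particle has the phase on exactly one side force
  the profile to be unimodal, so that it varies by exactly \<open>4\<close>.\<close>

lemma corner_profile:
  fixes f :: "int \<Rightarrow> real"
  assumes val: "\<And>x. f x \<in> {1, -1, 0}"
    and out: "\<And>x. \<bar>x\<bar> \<ge> M \<Longrightarrow> f x = -1"
    and conv: "\<And>x x' x''. f x = 1 \<Longrightarrow> f x'' = 1 \<Longrightarrow> x \<le> x' \<Longrightarrow> x' \<le> x'' \<Longrightarrow> f x' = 1"
    and corner: "\<And>x. f x = 0 \<Longrightarrow> (f (x - 1) = 1) \<noteq> (f (x + 1) = 1)"
    and nz: "\<And>x. f x \<noteq> 0 \<or> f (x + 1) \<noteq> 0"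
  shows "line_energy k f M = (if \<exists>x. f x = 1 then 4 else 0) - 2 * k * real (card {x. f x = 0})"
proof (cases "\<exists>x. f x = 1")
  case True
  then obtain m where m: "f m = 1" by blast
  have "line_energy k f M = 4 - 2 * k * real (card {x. f x = 0})"
  proof (rule line_energy_unimodal[OF val out nz m])
    fix x
    show "f x \<le> f (x + 1)" if "x < m"
    proof -
      have "f (x + 1) = 1" if "f x = 0 \<or> f x = 1"
      proof -
        have "\<exists>l\<le>x + 1. f l = 1"
        proof (cases "f x = 1")
          case True
          then show ?thesis by (intro exI[of _ x]) simp
        next
          case False
          with that have "f x = 0" by simp
          from corner[OF this] have "f (x - 1) = 1 \<or> f (x + 1) = 1" by blast
          then show ?thesis by (elim disjE) (rule exI[of _ "x - 1"], simp, rule exI[of _ "x + 1"], simp)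
        qed
        then obtain l where "l \<le> x + 1" "f l = 1" by blast
        then show ?thesis using conv[of l m "x+1"] m \<open>x < m\<close> by auto
      qed
      then show ?thesis using val[of x] val[of "x+1"] by auto
    qed
    show "f (x + 1) \<le> f x" if "m \<le> x"
    proof -
      have "f x = 1" if "f (x + 1) = 0 \<or> f (x + 1) = 1"
      proof -
        have "\<exists>l\<ge>x. f l = 1"
        proof (cases "f (x + 1) = 1")
          case True
          then show ?thesis by (intro exI[of _ "x + 1"]) simp
        next
          case False
          with that have "f (x + 1) = 0" by simp
          from corner[OF this] have "f x = 1 \<or> f (x + 2) = 1" by (auto simp: add.commute)
          then show ?thesis by (elim disjE) (rule exI[of _ x], simp, rule exI[of _ "x + 2"], simp)
        qed
        then obtain l where "x \<le> l" "f l = 1" by blast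
        then show ?thesis using conv[of m l x] m \<open>m \<le> x\<close> by auto
      qed
      then show ?thesis using val[of x] val[of "x+1"] by auto
    qed
  qed
  then show ?thesis using True by simp
next
  case False
  then have "f = (\<lambda>x. -1)" using val corner by (intro ext) (metis insertE singletonD)
  then show ?thesis using False by (simp add: line_energy_const)
qed

text \<open>Particles on corner sites are optimal: each of them is worth the full \<open>4 * k\<close> and none of them
  lengthens the phase boundary.\<close>

lemma lattice_energy_corners:
  assumes val: "\<And>p. v p \<in> {1, -1, 0}"
    and out: "\<And>x y. \<bar>x\<bar> \<ge> M \<or> \<bar>y\<bar> \<ge> M \<Longrightarrow> v (x, y) = -1"
    and conv: "line_convex {p. v p = 1}"
    and corner: "\<And>x y. v (x, y) = 0 \<Longrightarrow> (v (x - 1, y) = 1) \<noteq> (v (x + 1, y) = 1)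
        \<and> (v (x, y - 1) = 1) \<noteq> (v (x, y + 1) = 1)"
    and nz: "\<And>x y. v (x, y) = 0 \<Longrightarrow> v (x + 1, y) \<noteq> 0 \<and> v (x, y + 1) \<noteq> 0"
  shows "lattice_energy k v M = 4 * real (card (fst ` {p. v p = 1}) + card (snd ` {p. v p = 1}))
           - 4 * k * real (card {p. v p = 0})"
proof -
  have row: "line_energy k (\<lambda>x. v (x, y)) M
      = (if \<exists>x. v (x, y) = 1 then 4 else 0) - 2 * k * real (card {x. v (x, y) = 0})" for y
  proof (rule corner_profile)
    show "v (x', y) = 1" if "v (x, y) = 1" "v (x'', y) = 1" "x \<le> x'" "x' \<le> x''" for x x' x''
      using conv that unfolding line_convex_def by blast
  qed (use val out corner nz in blast)+
  have column: "line_energy k (\<lambda>y. v (x, y)) M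
      = (if \<exists>y. v (x, y) = 1 then 4 else 0) - 2 * k * real (card {y. v (x, y) = 0})" for x
  proof (rule corner_profile)
    show "v (x, y') = 1" if "v (x, y) = 1" "v (x, y'') = 1" "y \<le> y'" "y' \<le> y''" for y y' y''
      using conv that unfolding line_convex_def by blast
  qed (use val out corner nz in blast)+
  have "lattice_energy k v M =
    (\<Sum>y\<in>{-M..M}. (if \<exists>x. v (x, y) = 1 then 4 else 0) - 2 * k * real (card {x. v (x, y) = 0}))
      + (\<Sum>x\<in>{-M..M}. (if \<exists>y. v (x, y) = 1 then 4 else 0) - 2 * k * real (card {y. v (x, y) = 0}))"
    unfolding lattice_energy_def row column ..
  then show ?thesis
    by (simp add: sum_subtractf sum_distrib_left[symmetric] zeros_by_rows[of M v, OF out] lines_hit[of M v, OF out] algebra_simps)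
qed

section \<open>Optimal removal of lines\<close>

text \<open>The change of the functional, up to a factor, when the points of the lines in \<open>T\<close> leave the phase:
  they pay their weight, and each line that the phase no longer meets saves \<open>4\<close>.\<close>

definition removal_cost :: "real \<Rightarrow> ('p \<Rightarrow> real) \<Rightarrow> ('l \<Rightarrow> 'p set) \<Rightarrow> 'l set \<Rightarrow> real" where
  "removal_cost \<kappa> D pts T = \<kappa> * (\<Sum>p\<in>\<Union>(pts ` T). D p) - 4 * real (card T)"

text \<open>The rows and columns of a finite set of lattice points, reduced to the two incidence properties that
  the optimization uses.\<close>

locale weighted_lines =
  fixes L :: "'l set" and pts :: "'l \<Rightarrow> 'p set" and D :: "'p \<Rightarrow> real" and \<kappa> :: real
  assumes finite_lines: "finite L" and finite_pts: "\<And>l. finite (pts l)"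
    and weight_nonneg: "\<And>p. 0 \<le> D p" and kappa_pos: "0 < \<kappa>"
    and meet_once: "\<And>l l'. l \<noteq> l' \<Longrightarrow> card (pts l \<inter> pts l') \<le> 1"
    and at_most_two: "\<And>p. card {l \<in> L. p \<in> pts l} \<le> 2"
begin

definition optimal :: "'l set \<Rightarrow> bool" where
  "optimal T \<longleftrightarrow> T \<subseteq> L \<and> (\<forall>T'\<subseteq>L. removal_cost \<kappa> D pts T \<le> removal_cost \<kappa> D pts T')"

lemma optimal_exists: "\<exists>T. optimal T"
proof -
  have "\<exists>T. is_arg_min (removal_cost \<kappa> D pts) (\<lambda>T. T \<in> Pow L) T"
    by (rule ex_is_arg_min_if_finite) (use finite_lines in auto)
  then show ?thesis unfolding optimal_def is_arg_min_linorder by auto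
qed

lemma removal_cost_union:
  assumes "S \<subseteq> L" "T \<subseteq> L" "S \<inter> T = {}"
  shows "removal_cost \<kappa> D pts (T \<union> S)
    = removal_cost \<kappa> D pts T + \<kappa> * (\<Sum>p\<in>\<Union>(pts ` S) - \<Union>(pts ` T). D p) - 4 * real (card S)"
proof -
  have fin: "finite S" "finite T" using assms finite_lines by (auto intro: finite_subset)
  have "\<Union>(pts ` (T \<union> S)) = \<Union>(pts ` T) \<union> (\<Union>(pts ` S) - \<Union>(pts ` T))" by auto
  then have "sum D (\<Union>(pts ` (T \<union> S))) = sum D (\<Union>(pts ` T)) + sum D (\<Union>(pts ` S) - \<Union>(pts ` T))"
    using fin finite_pts by (simp only:) (intro sum.union_disjoint, auto)
  moreover have "card (T \<union> S) = card T + card S" using fin assms by (intro card_Un_disjoint) auto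
  ultimately show ?thesis by (simp add: removal_cost_def algebra_simps)
qed

text \<open>A line shares at most one point with each other line, so at most \<open>card T\<close> of the points in \<open>Q\<close> are
  already removed with \<open>T\<close>.\<close>

lemma uncovered_weight_ge:
  assumes T: "T \<subseteq> L" "l \<notin> T" and Q: "Q \<subseteq> pts l" "\<And>p. p \<in> Q \<Longrightarrow> t \<le> D p" and t: "0 \<le> t"
  shows "t * (real (card Q) - real (card T)) \<le> (\<Sum>p\<in>pts l - \<Union>(pts ` T). D p)"
proof -
  have fin: "finite T" "finite Q" using T(1) Q(1) finite_lines finite_pts finite_subset by metis+
  let ?Q = "Q - \<Union>(pts ` T)"
  \<comment> \<open>each line of T accounts for at most one point of Q\<close>
  have "card (Q \<inter> \<Union>(pts ` T)) \<le> card (\<Union>m\<in>T. pts l \<inter> pts m)"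
    by (rule card_mono) (use fin finite_pts Q in auto)
  also have "\<dots> \<le> (\<Sum>m\<in>T. card (pts l \<inter> pts m))" by (rule card_UN_le[OF fin(1)])
  also have "\<dots> \<le> (\<Sum>m\<in>T. 1)" using T(2) by (intro sum_mono meet_once) auto
  finally have "card (Q \<inter> \<Union>(pts ` T)) \<le> card T" by simp
  moreover have "card Q = card ?Q + card (Q \<inter> \<Union>(pts ` T))"
    using fin(2) by (metis Int_Diff_Un Int_Diff_disjoint add.commute card_Un_disjoint finite_Diff finite_Int)
  ultimately have "real (card Q) - real (card T) \<le> real (card ?Q)" by linarith
  then have "t * (real (card Q) - real (card T)) \<le> t * real (card ?Q)" using t by (rule mult_left_mono)
  also have "\<dots> = (\<Sum>p\<in>?Q. t)" by simp
  also have "\<dots> \<le> (\<Sum>p\<in>?Q. D p)" using Q by (intro sum_mono) auto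
  also have "\<dots> \<le> (\<Sum>p\<in>pts l - \<Union>(pts ` T). D p)"
    using Q weight_nonneg finite_pts by (intro sum_mono2) auto
  finally show ?thesis .
qed

text \<open>Putting one removed line back does not improve an optimal removal; its points outside the other
  removed lines are therefore not worth more than the \<open>4\<close> that the line saves.\<close>

lemma optimal_removed:
  assumes T: "optimal T" "l \<in> T" and Q: "Q \<subseteq> pts l" "\<And>p. p \<in> Q \<Longrightarrow> t \<le> D p" and t: "0 \<le> t"
  shows "\<kappa> * t * (real (card Q) - real (card T)) \<le> 4"
proof -
  have TL: "T \<subseteq> L" using T by (simp add: optimal_def)
  have "(T - {l}) \<union> {l} = T" using T by auto
  then have "removal_cost \<kappa> D pts T = removal_cost \<kappa> D pts (T - {l})
      + \<kappa> * (\<Sum>p\<in>pts l - \<Union>(pts ` (T - {l})). D p) - 4"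
    using removal_cost_union[of "{l}" "T - {l}"] TL T(2) by auto
  moreover have "removal_cost \<kappa> D pts T \<le> removal_cost \<kappa> D pts (T - {l})"
    using T(1) unfolding optimal_def by (meson Diff_subset order_trans)
  ultimately have "\<kappa> * (\<Sum>p\<in>pts l - \<Union>(pts ` (T - {l})). D p) \<le> 4" by simp
  moreover have "t * (real (card Q) - real (card (T - {l}))) \<le> (\<Sum>p\<in>pts l - \<Union>(pts ` (T - {l})). D p)"
    by (rule uncovered_weight_ge[OF _ _ Q t]) (use TL in auto)
  moreover have "t * (real (card Q) - real (card T)) \<le> t * (real (card Q) - real (card (T - {l})))"
    using t by (intro mult_left_mono) (simp_all add: card_Diff1_le)
  ultimately show ?thesis using kappa_pos
    by (smt (verit, best) mult.assoc mult_le_cancel_left_pos)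
qed

lemma optimal_kept:
  assumes T: "optimal T" "l \<in> L" "l \<notin> T"
  shows "4 \<le> \<kappa> * (\<Sum>p\<in>pts l. D p)"
proof -
  have TL: "T \<subseteq> L" using T by (simp add: optimal_def)
  have "removal_cost \<kappa> D pts T \<le> removal_cost \<kappa> D pts (T \<union> {l})"
    using T by (auto simp: optimal_def)
  also have "\<dots> = removal_cost \<kappa> D pts T + \<kappa> * (\<Sum>p\<in>pts l - \<Union>(pts ` T). D p) - 4"
    using removal_cost_union[of "{l}" T] TL T by auto
  finally have "4 \<le> \<kappa> * (\<Sum>p\<in>pts l - \<Union>(pts ` T). D p)" by simp
  also have "\<dots> \<le> \<kappa> * (\<Sum>p\<in>pts l. D p)"
    using kappa_pos finite_pts weight_nonneg by (intro mult_left_mono sum_mono2) auto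
  finally show ?thesis .
qed

text \<open>Putting all lines of \<open>S\<close> back at once avoids any a priori bound on their number. Each point lies on at
  most two lines, so the weight regained is at least half of the sum of the weights regained line by
  line; this is why the threshold is \<open>8\<close> and not \<open>4\<close>.\<close>

lemma optimal_no_expensive:
  assumes T: "optimal T" and S: "S \<subseteq> T"
    and Q: "\<And>l. l \<in> S \<Longrightarrow> Q l \<subseteq> pts l" "\<And>l p. l \<in> S \<Longrightarrow> p \<in> Q l \<Longrightarrow> t \<le> D p"
           "\<And>l. l \<in> S \<Longrightarrow> q \<le> real (card (Q l))"
    and t: "0 \<le> t" and big: "8 < \<kappa> * (t * (q - real (card (T - S))))"
  shows "S = {}"
proof (rule ccontr)
  assume "S \<noteq> {}"
  have TL: "T \<subseteq> L" using T by (simp add: optimal_def)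
  then have fin: "finite T" "finite S" using S finite_lines finite_subset by metis+
  let ?U = "\<Union>(pts ` (T - S))" and ?V = "\<Union>(pts ` S)"
  have "(\<Sum>l\<in>S. t * (q - real (card (T - S)))) \<le> (\<Sum>l\<in>S. \<Sum>p\<in>pts l - ?U. D p)"
  proof (rule sum_mono)
    fix l assume l: "l \<in> S"
    have "t * (q - real (card (T - S))) \<le> t * (real (card (Q l)) - real (card (T - S)))"
      using Q(3)[OF l] t by (intro mult_left_mono) auto
    also have "\<dots> \<le> (\<Sum>p\<in>pts l - ?U. D p)"
      by (rule uncovered_weight_ge) (use l TL Q t in auto)
    finally show "t * (q - real (card (T - S))) \<le> (\<Sum>p\<in>pts l - ?U. D p)" .
  qed
  also have "\<dots> = (\<Sum>l\<in>S. \<Sum>p\<in>{p\<in>?V - ?U. p \<in> pts l}. D p)"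
    by (intro sum.cong refl arg_cong2[where f=sum]) auto
  \<comment> \<open>double counting of incidences between uncovered points and lines of S\<close>
  also have "\<dots> = (\<Sum>p\<in>?V - ?U. \<Sum>l\<in>{l\<in>S. p \<in> pts l}. D p)"
    by (rule sum.swap_restrict) (use fin finite_pts in auto)
  also have "\<dots> \<le> (\<Sum>p\<in>?V - ?U. 2 * D p)"
  proof (rule sum_mono)
    fix p
    have "card {l\<in>S. p \<in> pts l} \<le> card {l\<in>L. p \<in> pts l}"
      using S TL finite_lines by (intro card_mono) auto
    then have "real (card {l\<in>S. p \<in> pts l}) \<le> 2" using at_most_two[of p] by linarith
    then show "(\<Sum>l\<in>{l\<in>S. p \<in> pts l}. D p) \<le> 2 * D p"
      using weight_nonneg[of p] by (simp add: mult_right_mono)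
  qed
  finally have "real (card S) * (t * (q - real (card (T - S)))) \<le> 2 * (\<Sum>p\<in>?V - ?U. D p)"
    by (simp add: sum_distrib_left)
  then have "\<kappa> * (real (card S) * (t * (q - real (card (T - S))))) \<le> \<kappa> * (2 * (\<Sum>p\<in>?V - ?U. D p))"
    using kappa_pos by (intro mult_left_mono) auto
  moreover have "\<kappa> * (\<Sum>p\<in>?V - ?U. D p) \<le> 4 * real (card S)"
  proof -
    have "(T - S) \<union> S = T" using S by auto
    then have "removal_cost \<kappa> D pts T = removal_cost \<kappa> D pts (T - S) + \<kappa> * (\<Sum>p\<in>?V - ?U. D p) - 4 * real (card S)"
      using removal_cost_union[of S "T - S"] S TL by auto
    moreover have "removal_cost \<kappa> D pts T \<le> removal_cost \<kappa> D pts (T - S)"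
      using T unfolding optimal_def by (meson Diff_subset order_trans)
    ultimately show ?thesis by linarith
  qed
  ultimately have "real (card S) * (\<kappa> * (t * (q - real (card (T - S))))) \<le> real (card S) * 8"
    by (simp add: algebra_simps)
  then have "\<kappa> * (t * (q - real (card (T - S)))) \<le> 8"
    using \<open>S \<noteq> {}\<close> fin by (subst (asm) mult_le_cancel_left_pos) (auto simp: card_gt_0_iff)
  with big show False by linarith
qed

end

section \<open>Depth in a lattice octagon\<close>

text \<open>The distance to the boundary in units of \<open>\<epsilon>\<close>.\<close>

definition depth :: "(int \<times> int) set \<Rightarrow> int \<times> int \<Rightarrow> nat" where
  "depth X p = (LEAST n. \<exists>q. (q \<in> X) \<noteq> (p \<in> X) \<and> n = nat (\<bar>fst p - fst q\<bar> + \<bar>snd p - snd q\<bar>))"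

lemma depth_le:
  assumes "(q \<in> X) \<noteq> (p \<in> X)" "\<bar>fst p - fst q\<bar> + \<bar>snd p - snd q\<bar> \<le> t"
  shows "int (depth X p) \<le> t"
proof -
  have "depth X p \<le> nat (\<bar>fst p - fst q\<bar> + \<bar>snd p - snd q\<bar>)"
    unfolding depth_def by (rule Least_le) (use assms in blast)
  then show ?thesis using assms(2) by linarith
qed

lemma depth_attained:
  assumes "(q0 \<in> X) \<noteq> (p \<in> X)"
  obtains q where "(q \<in> X) \<noteq> (p \<in> X)" "int (depth X p) = \<bar>fst p - fst q\<bar> + \<bar>snd p - snd q\<bar>"
proof -
  have "\<exists>q. (q \<in> X) \<noteq> (p \<in> X) \<and> depth X p = nat (\<bar>fst p - fst q\<bar> + \<bar>snd p - snd q\<bar>)"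
    unfolding depth_def by (rule LeastI_ex) (use assms in blast)
  then obtain q where "(q \<in> X) \<noteq> (p \<in> X)" "depth X p = nat (\<bar>fst p - fst q\<bar> + \<bar>snd p - snd q\<bar>)" by blast
  then show thesis using that[of q] by simp
qed

lemma depth_ge:
  assumes "(q0 \<in> X) \<noteq> (p \<in> X)"
    and "\<And>x y. ((x, y) \<in> X) \<noteq> (p \<in> X) \<Longrightarrow> t \<le> \<bar>fst p - x\<bar> + \<bar>snd p - y\<bar>"
  shows "t \<le> int (depth X p)"
  using depth_attained[OF assms(1)] assms(2) by (metis prod.collapse)

text \<open>The bounding box \<open>[a1, b1] \<times> [a2, b2]\<close> with its four corners cut off; \<open>s1, \<dots>, s4\<close> count the diagonal steps
  of the cuts at the lower left, upper left, upper right and lower right corner.\<close>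

definition oct_pts :: "int \<Rightarrow> int \<Rightarrow> int \<Rightarrow> int \<Rightarrow> int \<Rightarrow> int \<Rightarrow> int \<Rightarrow> int \<Rightarrow> (int \<times> int) set" where
  "oct_pts a1 b1 a2 b2 s1 s2 s3 s4 = {(x, y). a1 \<le> x \<and> x \<le> b1 \<and> a2 \<le> y \<and> y \<le> b2 \<and>
     a1 + a2 + s1 \<le> x + y \<and> a1 - b2 + s2 \<le> x - y \<and> x + y \<le> b1 + b2 - s3 \<and> x - y \<le> b1 - a2 - s4}"

text \<open>The flag of a line is \<open>True\<close> for rows and \<open>False\<close> for columns.\<close>

definition grid_line :: "(int \<times> int) set \<Rightarrow> bool \<times> int \<Rightarrow> (int \<times> int) set" where
  "grid_line X l = {p \<in> X. (if fst l then snd p else fst p) = snd l}"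

lemma index_cases:
  assumes "i \<in> {1..4::nat}" obtains "i = 1" | "i = 2" | "i = 3" | "i = 4"
  using assms by force

text \<open>The inequalities between the cuts and the box say that each axis-parallel side keeps at least one
  point; then all eight constraints are attained.\<close>

locale int_octagon =
  fixes a1 b1 a2 b2 s1 s2 s3 s4 :: int
  assumes cut_nonneg: "0 \<le> s1" "0 \<le> s2" "0 \<le> s3" "0 \<le> s4"
    and side_nonempty: "s1 + s4 \<le> b1 - a1" "s1 + s2 \<le> b2 - a2" "s2 + s3 \<le> b1 - a1" "s3 + s4 \<le> b2 - a2"
begin

abbreviation "X \<equiv> oct_pts a1 b1 a2 b2 s1 s2 s3 s4"

text \<open>Side lengths in lattice points, in the order lowest, leftmost, highest, rightmost; diagonal cuts are
  numbered so that cut \<open>i\<close> lies between side \<open>i\<close> and the next side clockwise.\<close>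

definition len :: "nat \<Rightarrow> int" where
  "len i = [b1 - a1 - s1 - s4 + 1, b2 - a2 - s1 - s2 + 1, b1 - a1 - s2 - s3 + 1, b2 - a2 - s3 - s4 + 1] ! (i - 1)"

definition cut :: "nat \<Rightarrow> int" where
  "cut i = [s1, s2, s3, s4] ! (i - 1)"

text \<open>The row or column at position \<open>t\<close> counted inwards from side \<open>i\<close>, where \<open>t = 1\<close> is the external slice.\<close>

definition side_line :: "nat \<Rightarrow> int \<Rightarrow> bool \<times> int" where
  "side_line i t = [(True, a2 + t - 1), (False, a1 + t - 1), (True, b2 - t + 1), (False, b1 - t + 1)] ! (i - 1)"

definition lines :: "(bool \<times> int) set" where
  "lines = {True} \<times> {a2..b2} \<union> {False} \<times> {a1..b1}"

lemma oct_mem: "(x, y) \<in> X \<longleftrightarrow> a1 \<le> x \<and> x \<le> b1 \<and> a2 \<le> y \<and> y \<le> b2 \<and>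
     a1 + a2 + s1 \<le> x + y \<and> a1 - b2 + s2 \<le> x - y \<and> x + y \<le> b1 + b2 - s3 \<and> x - y \<le> b1 - a2 - s4"
  by (simp add: oct_pts_def)

lemmas oct_defs = len_def cut_def side_line_def lines_def grid_line_def oct_mem

lemma finite_X: "finite X"
  by (rule finite_subset[of _ "{a1..b1} \<times> {a2..b2}"]) (auto simp: oct_pts_def)

lemma outside: "(a1 - 1, y) \<notin> X" "(b1 + 1, y) \<notin> X" "(x, a2 - 1) \<notin> X" "(x, b2 + 1) \<notin> X"
  by (auto simp: oct_pts_def)

text \<open>Leaving the octagon means violating one of its eight constraints, and a step in the \<open>l\<^sup>1\<close> sense
  changes each of them by at most one.\<close>

lemma depth_ge_slack:
  assumes "a1 + t \<le> x + 1" "x + t \<le> b1 + 1" "a2 + t \<le> y + 1" "y + t \<le> b2 + 1"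
    "a1 + a2 + s1 + t \<le> x + y + 1" "a1 - b2 + s2 + t \<le> x - y + 1"
    "x + y + t \<le> b1 + b2 - s3 + 1" "x - y + t \<le> b1 - a2 - s4 + 1" "1 \<le> t"
  shows "t \<le> int (depth X (x, y))"
proof (rule depth_ge)
  have *: "(x, y) \<in> X" using assms by (auto simp: oct_pts_def)
  then show "((a1 - 1, y) \<in> X) \<noteq> ((x, y) \<in> X)" using outside by blast
  fix x' y' assume "((x', y') \<in> X) \<noteq> ((x, y) \<in> X)"
  with * have "(x', y') \<notin> X" by blast
  then show "t \<le> \<bar>fst (x, y) - x'\<bar> + \<bar>snd (x, y) - y'\<bar>"
    using assms by (simp add: oct_pts_def) linarith
qed

lemma grid_line_box:
  assumes "grid_line X l \<subseteq> {u..v} \<times> {c..c} \<or> grid_line X l \<subseteq> {c..c} \<times> {u..v}" "u \<le> v + 1"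
    and "\<And>p. p \<in> grid_line X l \<Longrightarrow> int (depth X p) \<le> t" "0 \<le> t" and n: "n = v - u + 1"
  shows "(\<Sum>p\<in>grid_line X l. real (depth X p)) \<le> real_of_int (t * n)"
proof -
  have "card (grid_line X l) \<le> nat (v - u + 1)"
    using assms(1)
  proof
    assume "grid_line X l \<subseteq> {u..v} \<times> {c..c}"
    from card_mono[OF _ this] show ?thesis by simp
  next
    assume "grid_line X l \<subseteq> {c..c} \<times> {u..v}"
    from card_mono[OF _ this] show ?thesis by simp
  qed
  then have card: "real (card (grid_line X l)) \<le> real_of_int (v - u + 1)" using assms(2) by linarith
  have "(\<Sum>p\<in>grid_line X l. real (depth X p)) \<le> (\<Sum>p\<in>grid_line X l. real_of_int t)"
    using assms(3) by (intro sum_mono) (metis of_int_le_iff of_int_of_nat_eq)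
  also have "\<dots> = real_of_int t * real (card (grid_line X l))" by simp
  also have "\<dots> \<le> real_of_int t * real_of_int (v - u + 1)" using card assms(4) by (intro mult_left_mono) auto
  finally show ?thesis by (simp add: n)
qed

text \<open>The diagonal sides have slope one, so the line at position \<open>t\<close> exceeds the side by at most \<open>t - 1\<close> points
  at either end, and stepping straight out across the side takes \<open>t\<close> steps.\<close>

lemma side_line_weight_le:
  assumes i: "i \<in> {1..4}" and t: "1 \<le> t"
  shows "(\<Sum>p\<in>grid_line X (side_line i t). real (depth X p)) \<le> real_of_int (t * (len i + 2 * (t - 1)))"
  using i
proof (cases rule: index_cases)
  case 1
  show ?thesis
  proof (rule grid_line_box[where c="a2 + t - 1" and u="a1 + s1 - (t - 1)" and v="b1 - s4 + (t - 1)"])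
    fix p assume "p \<in> grid_line X (side_line i t)"
    then show "int (depth X p) \<le> t" using outside(3)[of "fst p"] t 1
      by (intro depth_le[where q="(fst p, a2 - 1)"]) (auto simp: grid_line_def side_line_def)
  qed (use 1 t side_nonempty in \<open>auto simp: oct_defs\<close>)
next
  case 2
  show ?thesis
  proof (rule grid_line_box[where c="a1 + t - 1" and u="a2 + s1 - (t - 1)" and v="b2 - s2 + (t - 1)"])
    fix p assume "p \<in> grid_line X (side_line i t)"
    then show "int (depth X p) \<le> t" using outside(1)[of "snd p"] t 2
      by (intro depth_le[where q="(a1 - 1, snd p)"]) (auto simp: grid_line_def side_line_def)
  qed (use 2 t side_nonempty in \<open>auto simp: oct_defs\<close>)
next
  case 3
  show ?thesis
  proof (rule grid_line_box[where c="b2 - t + 1" and u="a1 + s2 - (t - 1)" and v="b1 - s3 + (t - 1)"])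
    fix p assume "p \<in> grid_line X (side_line i t)"
    then show "int (depth X p) \<le> t" using outside(4)[of "fst p"] t 3
      by (intro depth_le[where q="(fst p, b2 + 1)"]) (auto simp: grid_line_def side_line_def)
  qed (use 3 t side_nonempty in \<open>auto simp: oct_defs\<close>)
next
  case 4
  show ?thesis
  proof (rule grid_line_box[where c="b1 - t + 1" and u="a2 + s4 - (t - 1)" and v="b2 - s3 + (t - 1)"])
    fix p assume "p \<in> grid_line X (side_line i t)"
    then show "int (depth X p) \<le> t" using outside(2)[of "snd p"] t 4
      by (intro depth_le[where q="(b1 + 1, snd p)"]) (auto simp: grid_line_def side_line_def)
  qed (use 4 t side_nonempty in \<open>auto simp: oct_defs\<close>)
qed

text \<open>Apart from \<open>t - 1\<close> points at either end of the side, the nearest way out of the octagon leads across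
  the side itself.\<close>

lemma side_line_core:
  assumes i: "i \<in> {1..4}" and t: "1 \<le> t" "\<And>j. j \<in> {1..4} \<Longrightarrow> 2 * t \<le> len j"
  shows "\<exists>Q\<subseteq>grid_line X (side_line i t). len i - 2 * (t - 1) \<le> int (card Q) \<and> (\<forall>p\<in>Q. t \<le> int (depth X p))"
proof -
  have tl: "2 * t \<le> b1 - a1 - s1 - s4 + 1" "2 * t \<le> b2 - a2 - s1 - s2 + 1" "2 * t \<le> b1 - a1 - s2 - s3 + 1" "2 * t \<le> b2 - a2 - s3 - s4 + 1"
    using t(2)[of 1] t(2)[of 2] t(2)[of 3] t(2)[of 4] by (auto simp: len_def)
  show ?thesis
    using i
  proof (cases rule: index_cases)
    case 1
    show ?thesis
      by (rule exI[of _ "{a1 + s1 + (t - 1)..b1 - s4 - (t - 1)} \<times> {a2 + t - 1}"])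
         (use 1 t(1) tl cut_nonneg in \<open>auto simp: oct_defs intro!: depth_ge_slack\<close>)
  next
    case 2
    show ?thesis
      by (rule exI[of _ "{a1 + t - 1} \<times> {a2 + s1 + (t - 1)..b2 - s2 - (t - 1)}"])
         (use 2 t(1) tl cut_nonneg in \<open>auto simp: oct_defs intro!: depth_ge_slack\<close>)
  next
    case 3
    show ?thesis
      by (rule exI[of _ "{a1 + s2 + (t - 1)..b1 - s3 - (t - 1)} \<times> {b2 - t + 1}"])
         (use 3 t(1) tl cut_nonneg in \<open>auto simp: oct_defs intro!: depth_ge_slack\<close>)
  next
    case 4
    show ?thesis
      by (rule exI[of _ "{b1 - t + 1} \<times> {a2 + s4 + (t - 1)..b2 - s3 - (t - 1)}"])
         (use 4 t(1) tl cut_nonneg in \<open>auto simp: oct_defs intro!: depth_ge_slack\<close>)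
  qed
qed

text \<open>For lines far from all sides only a lower bound is needed. Every row and column of the octagon is at
  least as long as its shortest side, and \<open>t - 1\<close> points at either end are given up for the constraints that
  bound the line.\<close>

lemma interior_line_core:
  assumes N: "\<And>j. j \<in> {1..4} \<Longrightarrow> N \<le> len j" and t: "1 \<le> t"
    and l: "l \<in> lines" and deep: "\<And>i s. i \<in> {1..4} \<Longrightarrow> 1 \<le> s \<Longrightarrow> s < t \<Longrightarrow> l \<noteq> side_line i s"
  shows "\<exists>Q\<subseteq>grid_line X l. N - 2 * (t - 1) \<le> int (card Q) \<and> (\<forall>p\<in>Q. t \<le> int (depth X p))"
proof -
  have nl: "N \<le> b1 - a1 - s1 - s4 + 1" "N \<le> b2 - a2 - s1 - s2 + 1" "N \<le> b1 - a1 - s2 - s3 + 1" "N \<le> b2 - a2 - s3 - s4 + 1"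
    using N[of 1] N[of 2] N[of 3] N[of 4] by (auto simp: len_def)
  consider y where "l = (True, y)" "a2 \<le> y" "y \<le> b2" | x where "l = (False, x)" "a1 \<le> x" "x \<le> b1"
    using l by (auto simp: lines_def)
  then show ?thesis
  proof cases
    case 1
    \<comment> \<open>the end points of the row; the constraints at either end change by one per point\<close>
    define lo where "lo = max a1 (max (a1 + a2 + s1 - y) (a1 - b2 + s2 + y))"
    define hi where "hi = min b1 (min (b1 + b2 - s3 - y) (b1 - a2 - s4 + y))"
    have "\<not> y - a2 + 1 < t" "\<not> b2 - y + 1 < t"
      using deep[of 1 "y - a2 + 1"] deep[of 3 "b2 - y + 1"] 1 by (auto simp: side_line_def)
    then have y: "a2 + t \<le> y + 1" "y + t \<le> b2 + 1" by auto
    have "N \<le> hi - lo + 1" using nl cut_nonneg 1 side_nonempty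
      unfolding lo_def hi_def by (auto simp: max_def min_def)
    moreover have "a1 \<le> lo" "a1 + a2 + s1 - y \<le> lo" "a1 - b2 + s2 + y \<le> lo"
      "hi \<le> b1" "hi \<le> b1 + b2 - s3 - y" "hi \<le> b1 - a2 - s4 + y"
      by (simp_all add: lo_def hi_def)
    ultimately show ?thesis
      by (intro exI[of _ "{lo + (t - 1)..hi - (t - 1)} \<times> {y}"])
         (use 1 y t in \<open>auto simp: grid_line_def oct_mem intro!: depth_ge_slack\<close>)
  next
    case 2
    define lo where "lo = max a2 (max (a1 + a2 + s1 - x) (x - b1 + a2 + s4))"
    define hi where "hi = min b2 (min (b1 + b2 - s3 - x) (x - a1 + b2 - s2))"
    have "\<not> x - a1 + 1 < t" "\<not> b1 - x + 1 < t"
      using deep[of 2 "x - a1 + 1"] deep[of 4 "b1 - x + 1"] 2 by (auto simp: side_line_def)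
    then have x: "a1 + t \<le> x + 1" "x + t \<le> b1 + 1" by auto
    have "N \<le> hi - lo + 1" using nl cut_nonneg 2 side_nonempty
      unfolding lo_def hi_def by (auto simp: max_def min_def)
    moreover have "a2 \<le> lo" "a1 + a2 + s1 - x \<le> lo" "x - b1 + a2 + s4 \<le> lo"
      "hi \<le> b2" "hi \<le> b1 + b2 - s3 - x" "hi \<le> x - a1 + b2 - s2"
      by (simp_all add: lo_def hi_def)
    ultimately show ?thesis
      by (intro exI[of _ "{x} \<times> {lo + (t - 1)..hi - (t - 1)}"])
         (use 2 x t in \<open>auto simp: grid_line_def oct_mem intro!: depth_ge_slack\<close>)
  qed
qed

lemma weighted_lines_grid:
  assumes "0 < \<kappa>"
  shows "weighted_lines lines (grid_line X) (\<lambda>p. real (depth X p)) \<kappa>"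
proof
  show "finite lines" by (simp add: lines_def)
  show "finite (grid_line X l)" for l using finite_X by (simp add: grid_line_def)
  show "card (grid_line X l \<inter> grid_line X l') \<le> 1" if "l \<noteq> l'" for l l'
  proof -
    have "p = q" if "p \<in> grid_line X l \<inter> grid_line X l'" "q \<in> grid_line X l \<inter> grid_line X l'" for p q
      using that \<open>l \<noteq> l'\<close> by (cases l; cases l'; cases p; cases q) (auto simp: grid_line_def split: if_splits)
    then show ?thesis by (intro card_le_Suc0_iff_eq[THEN iffD2, unfolded One_nat_def[symmetric]])
        (use finite_X in \<open>auto simp: grid_line_def\<close>)
  qed
  show "card {l \<in> lines. p \<in> grid_line X l} \<le> 2" for p
  proof -
    have "{l \<in> lines. p \<in> grid_line X l} \<subseteq> {(True, snd p), (False, fst p)}"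
      by (auto simp: grid_line_def split: if_splits)
    from card_mono[OF _ this] show ?thesis by (simp add: numeral_2_eq_2)
  qed
qed (use assms in auto)

end

lemma initial_segment:
  assumes "S \<subseteq> {1..n::nat}" "\<And>t. 1 \<le> t \<Longrightarrow> Suc t \<in> S \<Longrightarrow> t \<in> S"
  shows "S = {1..card S}"
proof -
  have fin: "finite S" using assms(1) finite_subset by blast
  have "\<exists>m. S = {1..m}"
  proof (cases "S = {}")
    case False
    have below: "t \<in> S" if "1 \<le> t" "t \<le> Max S" for t
      using that(2,1)
    proof (induction t rule: inc_induct)
      case base show ?case using False fin by (rule Max_in[rotated])
    next
      case (step t) then show ?case using assms(2)[of t] by (metis le_SucI)
    qed
    have "S = {1..Max S}"
    proof (intro equalityI subsetI)
      fix t assume "t \<in> S"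
      then have "1 \<le> t" "t \<le> Max S" using assms(1) fin by auto
      then show "t \<in> {1..Max S}" by simp
    next
      fix t assume "t \<in> {1..Max S}"
      then show "t \<in> S" using below by simp
    qed
    then show ?thesis by blast
  qed (intro exI[of _ 0], simp)
  then show ?thesis by auto
qed

context int_octagon begin

text \<open>Removing the line at position \<open>t\<close> next to side \<open>i\<close> costs \<open>\<kappa> * t * len i\<close> up to a bounded number of points
  and saves \<open>4\<close>. Lines at positions beyond \<open>t0\<close> are too expensive, so at most \<open>4 * t0\<close> lines are
  removed; hence crossings change the cost of a line by at most \<open>4 * t0\<close> points. As the cost grows with
  \<open>t\<close> by more than this error, the removed lines next to a side are the outermost ones, and their number
  \<open>\<alpha> i\<close> is pinned down by the cost of the last removed and of the first remaining line.\<close>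

theorem optimal_removal:
  fixes \<kappa> :: real and t0 :: nat
  assumes kappa: "0 < \<kappa>" and N: "\<And>j. j \<in> {1..4} \<Longrightarrow> N \<le> len j"
    and t0: "1 \<le> t0" and N_big: "8 * int t0 ^ 2 < N"
    and deep: "8 < \<kappa> * (real t0 * (real_of_int N - 6 * real t0))"
    and opt: "weighted_lines.optimal lines (grid_line X) (\<lambda>p. real (depth X p)) \<kappa> T"
  obtains \<alpha> :: "nat \<Rightarrow> nat" where
    "\<And>i. i \<in> {1..4} \<Longrightarrow> \<alpha> i \<le> t0"
    "\<And>i. i \<in> {1..4} \<Longrightarrow> \<kappa> * real (\<alpha> i) * (real_of_int (len i) - 6 * real t0) \<le> 4"
    "\<And>i. i \<in> {1..4} \<Longrightarrow> 4 \<le> \<kappa> * real (\<alpha> i + 1) * (real_of_int (len i) + 2 * real (\<alpha> i))"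
    "T = {side_line i (int t) | i t. i \<in> {1..4} \<and> 1 \<le> t \<and> t \<le> \<alpha> i}"
proof -
  interpret weighted_lines lines "grid_line X" "\<lambda>p. real (depth X p)" \<kappa>
    by (rule weighted_lines_grid[OF kappa])
  have TL: "T \<subseteq> lines" using opt by (simp add: optimal_def)
  \<comment> \<open>the lines at positions up to t0 next to one of the sides; all others are deep\<close>
  define shallow where "shallow = (\<lambda>(i, t). side_line i (int t)) ` ({1..4::nat} \<times> {1..t0})"
  have t0_sq: "int t0 \<le> int t0 ^ 2" using t0 by (simp add: power2_eq_square)
  have len_big: "8 * int t0 \<le> len j" if "j \<in> {1..4}" for j using N[OF that] N_big t0_sq by linarith
  have card_shallow: "card shallow \<le> 4 * t0"
    unfolding shallow_def using card_image_le[of "{1..4::nat} \<times> {1..t0}" "\<lambda>(i, t). side_line i (int t)"]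
    by (simp add: card_cartesian_product)
  have fin_shallow: "finite shallow" by (simp add: shallow_def)
  \<comment> \<open>each point of a deep line weighs at least t0, apart from 2 t0 points near its ends and 4 t0 crossings with shallow lines\<close>
  have "T - shallow = {}"
  proof -
    have "\<exists>Q\<subseteq>grid_line X l. N - 2 * (int (t0 + 1) - 1) \<le> int (card Q) \<and> (\<forall>p\<in>Q. int (t0 + 1) \<le> int (depth X p))"
      if "l \<in> T - shallow" for l
    proof (rule interior_line_core)
      fix i s assume *: "i \<in> {1..4::nat}" "1 \<le> s" "s < int (t0 + 1)"
      show "l \<noteq> side_line i s"
      proof
        assume "l = side_line i s"
        then have "l \<in> shallow" unfolding shallow_def
          using * by (intro image_eqI[of _ _ "(i, nat s)"]) auto
        then show False using that by simp
      qed
    qed (use N that TL in auto)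
    then obtain Q where Q: "\<And>l. l \<in> T - shallow \<Longrightarrow> Q l \<subseteq> grid_line X l \<and>
       N - 2 * (int (t0 + 1) - 1) \<le> int (card (Q l)) \<and> (\<forall>p\<in>Q l. int (t0 + 1) \<le> int (depth X p))"
      by metis
    show ?thesis
    proof (rule optimal_no_expensive[OF opt, where Q=Q and t="real t0" and q="real_of_int N - 2 * real t0"])
      have "card (T - (T - shallow)) \<le> card shallow" by (intro card_mono fin_shallow) auto
      then have "real (card (T - (T - shallow))) \<le> 4 * real t0" using card_shallow by linarith
      then have "\<kappa> * (real t0 * (real_of_int N - 6 * real t0))
          \<le> \<kappa> * (real t0 * (real_of_int N - 2 * real t0 - real (card (T - (T - shallow)))))"
        using kappa by (intro mult_left_mono) auto
      with deep show "8 < \<kappa> * (real t0 * (real_of_int N - 2 * real t0 - real (card (T - (T - shallow)))))"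
        by linarith
      show "real_of_int N - 2 * real t0 \<le> real (card (Q l))" if "l \<in> T - shallow" for l
      proof -
        have "real_of_int (N - 2 * int t0) \<le> real_of_int (int (card (Q l)))"
          using Q[OF that] unfolding of_int_le_iff by simp
        then show ?thesis by simp
      qed
      show "real t0 \<le> real (depth X p)" if "l \<in> T - shallow" "p \<in> Q l" for l p
        using Q[OF that(1)] that(2) by force
    qed (use Q in auto)
  qed
  then have T_shallow: "T \<subseteq> shallow" by blast
  have card_T: "real (card T) \<le> 4 * real t0"
    using card_mono[OF fin_shallow T_shallow] card_shallow by linarith
  have removed: "\<kappa> * real t * (real_of_int (len i) - 6 * real t0) \<le> 4"
    if i: "i \<in> {1..4}" and t: "1 \<le> t" "t \<le> t0" and mem: "side_line i (int t) \<in> T" for i t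
  proof -
    obtain Q where Q: "Q \<subseteq> grid_line X (side_line i (int t))"
      "len i - 2 * (int t - 1) \<le> int (card Q)" "\<forall>p\<in>Q. int t \<le> int (depth X p)"
      using side_line_core[of i "int t"] i t len_big by force
    have "\<kappa> * real t * (real (card Q) - real (card T)) \<le> 4"
      by (rule optimal_removed[OF opt mem Q(1)]) (use Q in auto)
    moreover have "real_of_int (len i) - 6 * real t0 \<le> real (card Q) - real (card T)"
    proof -
      have "real_of_int (len i - 2 * (int t - 1)) \<le> real_of_int (int (card Q))"
        using Q(2) unfolding of_int_le_iff .
      then show ?thesis using card_T t by simp
    qed
    ultimately show ?thesis using kappa
      by (smt (verit, best) mult_left_mono mult_nonneg_nonneg of_nat_0_le_iff)
  qed
  have kept: "4 \<le> \<kappa> * real t * (real_of_int (len i) + 2 * (real t - 1))"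
    if i: "i \<in> {1..4}" and t: "1 \<le> t" "t \<le> t0 + 1" and nmem: "side_line i (int t) \<notin> T" for i t
  proof -
    have "side_line i (int t) \<in> lines"
      using i t len_big[of 1] len_big[of 2] cut_nonneg t0 by (cases rule: index_cases) (auto simp: lines_def side_line_def len_def)
    then have "4 \<le> \<kappa> * (\<Sum>p\<in>grid_line X (side_line i (int t)). real (depth X p))"
      using optimal_kept[OF opt] nmem by blast
    also have "\<dots> \<le> \<kappa> * real_of_int (int t * (len i + 2 * (int t - 1)))"
      using side_line_weight_le[OF i, of "int t"] t kappa by (intro mult_left_mono) auto
    finally show ?thesis by (simp add: algebra_simps)
  qed
  define S where "S i = {t \<in> {1..t0}. side_line i (int t) \<in> T}" for i
  have S_init: "S i = {1..card (S i)}" if i: "i \<in> {1..4}" for i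
  proof (rule initial_segment)
    show "S i \<subseteq> {1..t0}" by (auto simp: S_def)
    fix t assume t: "1 \<le> t" "Suc t \<in> S i"
    show "t \<in> S i"
    proof (rule ccontr)
      \<comment> \<open>otherwise the cheaper line at position t is kept although the one at position t + 1 is worth removing\<close>
      assume "t \<notin> S i"
      with t have "side_line i (int t) \<notin> T" and "t < t0" by (auto simp: S_def)
      with t have "4 \<le> \<kappa> * (real t * (real_of_int (len i) + 2 * (real t - 1)))" using kept[OF i, of t] by auto
      moreover have "\<kappa> * (real (Suc t) * (real_of_int (len i) - 6 * real t0)) \<le> 4"
        using removed[OF i, of "Suc t"] t by (auto simp: S_def mult.assoc)
      ultimately have "\<kappa> * (real (Suc t) * (real_of_int (len i) - 6 * real t0))
          \<le> \<kappa> * (real t * (real_of_int (len i) + 2 * (real t - 1)))" by linarith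
      then have "real (Suc t) * (real_of_int (len i) - 6 * real t0)
          \<le> real t * (real_of_int (len i) + 2 * (real t - 1))"
        using kappa by simp
      then have "real_of_int (len i) \<le> 6 * real t0 * real (Suc t) + 2 * real t * (real t - 1)"
        by (simp add: algebra_simps)
      also have "\<dots> \<le> 6 * real t0 * real t0 + 2 * real t0 * real t0"
        using \<open>t < t0\<close> t(1) by (intro add_mono mult_mono) auto
      also have "\<dots> = real_of_int (8 * int t0 ^ 2)" by (simp add: power2_eq_square)
      also have "\<dots> < real_of_int (len i)" using N[OF i] N_big unfolding of_int_less_iff by linarith
      finally show False by simp
    qed
  qed
  have mem_S: "t \<in> S i \<longleftrightarrow> 1 \<le> t \<and> t \<le> card (S i)" if "i \<in> {1..4}" for i t
    using S_init[OF that] by (metis atLeastAtMost_iff)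
  show thesis
  proof (rule that)
    fix i :: nat assume i: "i \<in> {1..4}"
    have "card (S i) \<le> card {1..t0}" by (intro card_mono) (auto simp: S_def)
    then show le: "card (S i) \<le> t0" by simp
    show "\<kappa> * real (card (S i)) * (real_of_int (len i) - 6 * real t0) \<le> 4"
    proof (cases "card (S i) = 0")
      case False
      then have "card (S i) \<in> S i" unfolding mem_S[OF i] by simp
      then show ?thesis using removed[OF i] by (auto simp: S_def)
    qed simp
    \<comment> \<open>for card (S i) = t0 this line is deep, hence not among the shallow ones that T consists of\<close>
    have "side_line i (int (card (S i) + 1)) \<notin> T"
    proof
      assume mem: "side_line i (int (card (S i) + 1)) \<in> T"
      have "card (S i) + 1 \<notin> S i" unfolding mem_S[OF i] by simp
      with mem le have eq: "card (S i) = t0" by (auto simp: S_def)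
      from mem T_shallow obtain j s where "j \<in> {1..4::nat}" "s \<in> {1..t0}" "side_line i (int (t0 + 1)) = side_line j (int s)"
        unfolding eq shallow_def by auto
      moreover have "len 1 \<le> b1 - a1 + 1" "len 2 \<le> b2 - a2 + 1" using cut_nonneg by (auto simp: len_def)
      ultimately show False using len_big[of 1] len_big[of 2] t0 i
        by (elim index_cases) (auto simp: side_line_def)
    qed
    from kept[OF i _ _ this] le show "4 \<le> \<kappa> * real (card (S i) + 1) * (real_of_int (len i) + 2 * real (card (S i)))"
      by simp
  next
    show "T = {side_line i (int t) | i t. i \<in> {1..4} \<and> 1 \<le> t \<and> t \<le> card (S i)}"
    proof (intro equalityI subsetI)
      fix l assume l: "l \<in> T"
      with T_shallow obtain i t where it: "i \<in> {1..4::nat}" "t \<in> {1..t0}" "l = side_line i (int t)"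
        unfolding shallow_def by auto
      then have "t \<in> S i" using l by (auto simp: S_def)
      then have "1 \<le> t" "t \<le> card (S i)" unfolding mem_S[OF it(1)] by auto
      with it show "l \<in> {side_line i (int t) | i t. i \<in> {1..4} \<and> 1 \<le> t \<and> t \<le> card (S i)}" by blast
    next
      fix l assume "l \<in> {side_line i (int t) | i t. i \<in> {1..4} \<and> 1 \<le> t \<and> t \<le> card (S i)}"
      then obtain i t where it: "i \<in> {1..4::nat}" "1 \<le> t" "t \<le> card (S i)" "l = side_line i (int t)" by blast
      then have "t \<in> S i" unfolding mem_S[OF it(1)] by simp
      then show "l \<in> T" using it by (auto simp: S_def)
    qed
  qed
qed

end

section \<open>Octagons in the plane\<close>

definition emb :: "real \<Rightarrow> int \<times> int \<Rightarrow> point" where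
  "emb \<epsilon> z = (\<epsilon> * of_int (fst z), \<epsilon> * of_int (snd z))"

lemma grid_eq: "grid \<epsilon> = range (emb \<epsilon>)"
proof (intro equalityI subsetI)
  fix p assume "p \<in> grid \<epsilon>"
  then obtain m n where "p = emb \<epsilon> (m, n)" by (auto simp: grid_def emb_def)
  then show "p \<in> range (emb \<epsilon>)" by blast
qed (auto simp: grid_def emb_def)

lemma emb_inj: "\<epsilon> \<noteq> 0 \<Longrightarrow> inj (emb \<epsilon>)"
  by (auto simp: inj_def emb_def prod_eq_iff)

lemma emb_eq_iff: "\<epsilon> \<noteq> 0 \<Longrightarrow> emb \<epsilon> z = emb \<epsilon> w \<longleftrightarrow> z = w"
  by (rule inj_eq[OF emb_inj])

lemma extremal_emb:
  assumes "0 < \<epsilon>"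
  shows "extremal (emb \<epsilon> ` S) (of_int m, of_int n)
    = emb \<epsilon> ` {z \<in> S. \<forall>w\<in>S. m * fst w + n * snd w \<le> m * fst z + n * snd z}"
proof -
  have "(of_int m, of_int n) \<bullet> emb \<epsilon> w \<le> (of_int m, of_int n) \<bullet> emb \<epsilon> z \<longleftrightarrow>
      m * fst w + n * snd w \<le> m * fst z + n * snd z" for w z
  proof -
    have "(of_int m, of_int n) \<bullet> emb \<epsilon> p = \<epsilon> * of_int (m * fst p + n * snd p)" for p
      by (simp add: emb_def algebra_simps)
    then show ?thesis using assms by (simp only: mult_le_cancel_left_pos of_int_le_iff)
  qed
  note inner_iff = this[symmetric]
  show ?thesis unfolding extremal_def by (simp only: inner_iff) blast
qed

text \<open>For \<open>n > 0\<close> the two endpoints determine the direction; for \<open>n = 0\<close> every direction yields the single point.\<close>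

lemma dseg_emb:
  assumes eps: "0 < \<epsilon>" and n: "0 \<le> n" and v: "(v1, v2) \<in> {(1, 0), (0, 1), (1, 1), (1, -1)}"
  shows "dseg \<epsilon> (emb \<epsilon> (x, y)) (emb \<epsilon> (x + n * v1, y + n * v2)) = {emb \<epsilon> (x + s * v1, y + s * v2) | s. 0 \<le> s \<and> s \<le> n}"
proof (intro equalityI subsetI)
  fix p assume "p \<in> dseg \<epsilon> (emb \<epsilon> (x, y)) (emb \<epsilon> (x + n * v1, y + n * v2))"
  then obtain s m w where w: "w \<in> {(1, 0), (0, 1), (1, 1), (1, -1)}"
    and p: "p = emb \<epsilon> (x, y) + (real s * \<epsilon>) *\<^sub>R w"
    and q: "emb \<epsilon> (x + n * v1, y + n * v2) = emb \<epsilon> (x, y) + (real m * \<epsilon>) *\<^sub>R w" and "s \<le> m"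
    unfolding dseg_def by blast
  define w' :: "int \<times> int" where "w' = (\<lfloor>fst w\<rfloor>, \<lfloor>snd w\<rfloor>)"
  have w': "w' \<in> {(1, 0), (0, 1), (1, 1), (1, -1)}" "w = (of_int (fst w'), of_int (snd w'))"
    using w floor_uminus_of_int[of 1, where ?'a=real] by (auto simp: w'_def)
  have shift: "emb \<epsilon> (x, y) + (real j * \<epsilon>) *\<^sub>R w = emb \<epsilon> (x + int j * fst w', y + int j * snd w')" for j
    by (simp add: emb_def w'(2) algebra_simps)
  have "(x + n * v1, y + n * v2) = (x + int m * fst w', y + int m * snd w')"
    using q eps unfolding shift by (simp add: emb_eq_iff)
  then have eq: "n * v1 = int m * fst w'" "n * v2 = int m * snd w'" by auto
  then have "n = int m" using w'(1) v n by auto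
  moreover have "int s * fst w' = int s * v1" "int s * snd w' = int s * v2"
    using eq w'(1) v n \<open>s \<le> m\<close> by auto
  \<comment> \<open>if m = 0 then s = 0, and otherwise w equals the given direction\<close>
  ultimately show "p \<in> {emb \<epsilon> (x + s * v1, y + s * v2) | s. 0 \<le> s \<and> s \<le> n}"
    using p \<open>s \<le> m\<close> unfolding shift by (intro CollectI exI[of _ "int s"]) auto
next
  fix p assume "p \<in> {emb \<epsilon> (x + s * v1, y + s * v2) | s. 0 \<le> s \<and> s \<le> n}"
  then obtain s where s: "0 \<le> s" "s \<le> n" "p = emb \<epsilon> (x + s * v1, y + s * v2)" by blast
  show "p \<in> dseg \<epsilon> (emb \<epsilon> (x, y)) (emb \<epsilon> (x + n * v1, y + n * v2))"
    unfolding dseg_def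
    by (rule CollectI, rule exI[of _ "nat s"], rule exI[of _ "nat n"], rule exI[of _ "(of_int v1, of_int v2)"])
       (use s v n in \<open>auto simp: emb_def algebra_simps\<close>)
qed

lemma mem_cells_iff:
  assumes "0 < \<epsilon>"
  shows "(x, y) \<in> cells \<epsilon> I \<longleftrightarrow> (\<exists>p\<in>I. \<bar>x - fst p\<bar> \<le> \<epsilon> / 2 \<and> \<bar>y - snd p\<bar> \<le> \<epsilon> / 2)"
proof -
  have "(x, y) \<in> (\<lambda>z. p + \<epsilon> *\<^sub>R z) ` cbox (-1/2, -1/2) (1/2, 1/2) \<longleftrightarrow> \<bar>x - fst p\<bar> \<le> \<epsilon> / 2 \<and> \<bar>y - snd p\<bar> \<le> \<epsilon> / 2"
    for p :: point
  proof
    assume "(x, y) \<in> (\<lambda>z. p + \<epsilon> *\<^sub>R z) ` cbox (-1/2, -1/2) (1/2, 1/2)"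
    then obtain u v where uv: "- 1/2 \<le> u" "u \<le> 1/2" "-1/2 \<le> v" "v \<le> 1/2" "x = fst p + \<epsilon> * u" "y = snd p + \<epsilon> * v"
      by (cases p) (auto simp: cbox_Pair_eq)
    have "\<epsilon> * \<bar>u\<bar> \<le> \<epsilon> * (1/2)" "\<epsilon> * \<bar>v\<bar> \<le> \<epsilon> * (1/2)" using uv assms by (intro mult_left_mono; auto)+
    then show "\<bar>x - fst p\<bar> \<le> \<epsilon> / 2 \<and> \<bar>y - snd p\<bar> \<le> \<epsilon> / 2"
      using uv assms by (simp add: abs_mult)
  next
    assume *: "\<bar>x - fst p\<bar> \<le> \<epsilon> / 2 \<and> \<bar>y - snd p\<bar> \<le> \<epsilon> / 2"
    then have "x - fst p \<le> \<epsilon> / 2" "- (\<epsilon> / 2) \<le> x - fst p" "y - snd p \<le> \<epsilon> / 2" "- (\<epsilon> / 2) \<le> y - snd p"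
      by linarith+
    then show "(x, y) \<in> (\<lambda>z. p + \<epsilon> *\<^sub>R z) ` cbox (-1/2, -1/2) (1/2, 1/2)"
      using assms by (intro image_eqI[of _ _ "((x - fst p) / \<epsilon>, (y - snd p) / \<epsilon>)"])
         (auto simp: cbox_Pair_eq prod_eq_iff field_simps)
  qed
  then show ?thesis by (auto simp: cells_def)
qed

text \<open>A segment in one of the four directions is recognised by its endpoints and by monotonicity of both
  coordinates, which bounds all distances by the one between the endpoints. The second coordinate may increase or
  decrease from \<open>P\<close> to \<open>Q\<close>.\<close>

lemma diameter_spanned:
  fixes S :: "point set"
  assumes P: "P \<in> S" "Q \<in> S"
    and x: "\<And>z. z \<in> S \<Longrightarrow> fst P \<le> fst z \<and> fst z \<le> fst Q"
    and y: "\<And>z. z \<in> S \<Longrightarrow> \<bar>snd z - snd P\<bar> + \<bar>snd Q - snd z\<bar> \<le> \<bar>snd Q - snd P\<bar>"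
  shows "diameter S = dist P Q"
proof (rule antisym)
  have le: "dist z w \<le> dist P Q" if "z \<in> S" "w \<in> S" for z w
  proof -
    have "\<bar>fst z - fst w\<bar> \<le> \<bar>fst P - fst Q\<bar>" using x[OF that(1)] x[OF that(2)] by linarith
    moreover have "\<bar>snd z - snd w\<bar> \<le> \<bar>snd P - snd Q\<bar>" using y[OF that(1)] y[OF that(2)] by linarith
    ultimately show ?thesis
      by (simp add: dist_prod_def dist_real_def add_mono flip: abs_le_square_iff)
  qed
  then show "diameter S \<le> dist P Q"
    using P by (intro diameter_le) (auto simp: dist_norm)
  have "bounded S" unfolding bounded_def using le P by blast
  then show "dist P Q \<le> diameter S" using P by (rule diameter_bounded_bound)
qed

text \<open>The real counterpart of \<^const>\<open>oct_pts\<close>, with the same order of parameters.\<close>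

definition oct_region :: "real \<Rightarrow> real \<Rightarrow> real \<Rightarrow> real \<Rightarrow> real \<Rightarrow> real \<Rightarrow> real \<Rightarrow> real \<Rightarrow> point set" where
  "oct_region a1 b1 a2 b2 s1 s2 s3 s4 = {(x, y). a1 \<le> x \<and> x \<le> b1 \<and> a2 \<le> y \<and> y \<le> b2 \<and>
     a1 + a2 + s1 \<le> x + y \<and> x + y \<le> b1 + b2 - s3 \<and> a1 - b2 + s2 \<le> x - y \<and> x - y \<le> b1 - a2 - s4}"

locale real_octagon =
  fixes a1 b1 a2 b2 s1 s2 s3 s4 :: real
  assumes cut_nonneg: "0 \<le> s1" "0 \<le> s2" "0 \<le> s3" "0 \<le> s4"
    and side_nonempty: "s1 + s4 \<le> b1 - a1" "s1 + s2 \<le> b2 - a2" "s2 + s3 \<le> b1 - a1" "s3 + s4 \<le> b2 - a2"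
begin

abbreviation "H \<equiv> oct_region a1 b1 a2 b2 s1 s2 s3 s4"

lemma vertices:
  "(a1 + s1, a2) \<in> H" "(b1 - s4, a2) \<in> H" "(a1, a2 + s1) \<in> H" "(a1, b2 - s2) \<in> H"
  "(a1 + s2, b2) \<in> H" "(b1 - s3, b2) \<in> H" "(b1, a2 + s4) \<in> H" "(b1, b2 - s3) \<in> H"
  using cut_nonneg side_nonempty by (auto simp: oct_region_def)

lemma octagon: "H \<in> octagons"
  unfolding octagons_def using vertices(1)
  by (intro CollectI conjI) (blast, unfold oct_region_def, blast)

lemma extremal_diameter:
  assumes "P \<in> H" "Q \<in> H" "\<And>z. z \<in> H \<Longrightarrow> \<nu> \<bullet> z \<le> \<nu> \<bullet> P" "\<nu> \<bullet> Q = \<nu> \<bullet> P"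
    and "\<And>z. z \<in> H \<Longrightarrow> \<nu> \<bullet> z = \<nu> \<bullet> P \<Longrightarrow> fst P \<le> fst z \<and> fst z \<le> fst Q \<and>
       \<bar>snd z - snd P\<bar> + \<bar>snd Q - snd z\<bar> \<le> \<bar>snd Q - snd P\<bar>"
  shows "diameter (extremal H \<nu>) = dist P Q"
proof (rule diameter_spanned)
  show "P \<in> extremal H \<nu>" "Q \<in> extremal H \<nu>" using assms(1-4) by (auto simp: extremal_def)
  fix z assume "z \<in> extremal H \<nu>"
  then have z: "z \<in> H" "\<nu> \<bullet> z = \<nu> \<bullet> P" using assms(1) assms(3)[of z] by (force simp: extremal_def)+
  show "fst P \<le> fst z \<and> fst z \<le> fst Q" "\<bar>snd z - snd P\<bar> + \<bar>snd Q - snd z\<bar> \<le> \<bar>snd Q - snd P\<bar>"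
    using assms(5)[OF z] by auto
qed

lemma axis_side:
  assumes "i \<in> {1..4}"
  shows "diameter (extremal H (axis_nu i)) = [b1 - a1 - s1 - s4, b2 - a2 - s1 - s2, b1 - a1 - s2 - s3, b2 - a2 - s3 - s4] ! (i - 1)"
  using assms
proof (cases rule: index_cases)
  case 1
  have "diameter (extremal H (axis_nu i)) = dist (a1 + s1, a2) (b1 - s4, a2)"
    by (rule extremal_diameter) (use 1 vertices in \<open>auto simp: oct_region_def axis_nu_def\<close>)
  then show ?thesis using 1 side_nonempty by (simp add: dist_Pair_Pair dist_real_def)
next
  case 2
  have "diameter (extremal H (axis_nu i)) = dist (a1, a2 + s1) (a1, b2 - s2)"
    by (rule extremal_diameter) (use 2 vertices side_nonempty in \<open>auto simp: oct_region_def axis_nu_def\<close>)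
  then show ?thesis using 2 side_nonempty by (simp add: dist_Pair_Pair dist_real_def)
next
  case 3
  have "diameter (extremal H (axis_nu i)) = dist (a1 + s2, b2) (b1 - s3, b2)"
    by (rule extremal_diameter) (use 3 vertices in \<open>auto simp: oct_region_def axis_nu_def\<close>)
  then show ?thesis using 3 side_nonempty by (simp add: dist_Pair_Pair dist_real_def)
next
  case 4
  have "diameter (extremal H (axis_nu i)) = dist (b1, a2 + s4) (b1, b2 - s3)"
    by (rule extremal_diameter) (use 4 vertices side_nonempty in \<open>auto simp: oct_region_def axis_nu_def\<close>)
  then show ?thesis using 4 side_nonempty by (simp add: dist_Pair_Pair dist_real_def)
qed

lemma diag_side:
  assumes "i \<in> {1..4}"
  shows "diameter (extremal H (diag_nu i)) = sqrt 2 * [s1, s2, s3, s4] ! (i - 1)"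
proof -
  have diag_dist: "sqrt (2 * s\<^sup>2) = sqrt 2 * s" if "0 \<le> s" for s :: real
    using that by (simp add: real_sqrt_mult)
  show ?thesis
    using assms
  proof (cases rule: index_cases)
    case 1
    have "diameter (extremal H (diag_nu i)) = dist (a1, a2 + s1) (a1 + s1, a2)"
      by (rule extremal_diameter) (use 1 vertices cut_nonneg in \<open>auto simp: oct_region_def diag_nu_def\<close>)
    then show ?thesis using 1 cut_nonneg by (simp add: dist_Pair_Pair dist_real_def diag_dist)
  next
    case 2
    have "diameter (extremal H (diag_nu i)) = dist (a1, b2 - s2) (a1 + s2, b2)"
      by (rule extremal_diameter) (use 2 vertices cut_nonneg in \<open>auto simp: oct_region_def diag_nu_def\<close>)
    then show ?thesis using 2 cut_nonneg by (simp add: dist_Pair_Pair dist_real_def diag_dist)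
  next
    case 3
    have "diameter (extremal H (diag_nu i)) = dist (b1 - s3, b2) (b1, b2 - s3)"
      by (rule extremal_diameter) (use 3 vertices cut_nonneg in \<open>auto simp: oct_region_def diag_nu_def\<close>)
    then show ?thesis using 3 cut_nonneg by (simp add: dist_Pair_Pair dist_real_def diag_dist)
  next
    case 4
    have "diameter (extremal H (diag_nu i)) = dist (b1 - s4, a2) (b1, a2 + s4)"
      by (rule extremal_diameter) (use 4 vertices cut_nonneg in \<open>auto simp: oct_region_def diag_nu_def\<close>)
    then show ?thesis using 4 cut_nonneg by (simp add: dist_Pair_Pair dist_real_def diag_dist)
  qed
qed

lemma axis_support:
  assumes "i \<in> {1..4}"
  shows "(SUP z\<in>H. axis_nu i \<bullet> z) = [- a2, - a1, b2, b1] ! (i - 1)"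
proof -
  have sup: "(SUP z\<in>H. \<nu> \<bullet> z) = \<nu> \<bullet> P" if "P \<in> H" "\<And>z. z \<in> H \<Longrightarrow> \<nu> \<bullet> z \<le> \<nu> \<bullet> P" for \<nu> P
    using that by (intro cSup_eq_maximum) auto
  show ?thesis
    using assms
  proof (cases rule: index_cases)
    case 1
    then show ?thesis using vertices(1) by (subst sup[of "(a1 + s1, a2)"]) (auto simp: oct_region_def axis_nu_def)
  next
    case 2
    then show ?thesis using vertices(3) by (subst sup[of "(a1, a2 + s1)"]) (auto simp: oct_region_def axis_nu_def)
  next
    case 3
    then show ?thesis using vertices(5) by (subst sup[of "(a1 + s2, b2)"]) (auto simp: oct_region_def axis_nu_def)
  next
    case 4
    then show ?thesis using vertices(7) by (subst sup[of "(b1, a2 + s4)"]) (auto simp: oct_region_def axis_nu_def)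
  qed
qed

end

lemma setdist_parallel_lines:
  fixes \<nu> :: "'a::euclidean_space"
  assumes "norm \<nu> = 1"
  shows "setdist {x. \<nu> \<bullet> x = c} {x. \<nu> \<bullet> x = d} = \<bar>c - d\<bar>"
proof (rule antisym)
  have one: "\<nu> \<bullet> \<nu> = 1" using assms by (simp add: norm_eq_1)
  have "setdist {x. \<nu> \<bullet> x = c} {x. \<nu> \<bullet> x = d} \<le> dist (c *\<^sub>R \<nu>) (d *\<^sub>R \<nu>)"
    using one by (intro setdist_le_dist) auto
  also have "\<dots> = \<bar>c - d\<bar>" using assms by (simp add: dist_norm flip: scaleR_diff_left)
  finally show "setdist {x. \<nu> \<bullet> x = c} {x. \<nu> \<bullet> x = d} \<le> \<bar>c - d\<bar>" .
  show "\<bar>c - d\<bar> \<le> setdist {x. \<nu> \<bullet> x = c} {x. \<nu> \<bullet> x = d}"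
  proof (rule le_setdistI)
    show "{x. \<nu> \<bullet> x = c} \<noteq> {}" "{x. \<nu> \<bullet> x = d} \<noteq> {}"
      using one by (auto intro: exI[of _ "c *\<^sub>R \<nu>"] exI[of _ "d *\<^sub>R \<nu>"])
    fix x y assume "x \<in> {x. \<nu> \<bullet> x = c}" "y \<in> {x. \<nu> \<bullet> x = d}"
    then have "c - d = \<nu> \<bullet> (x - y)" by (simp add: inner_diff_right)
    also have "\<bar>\<dots>\<bar> \<le> norm \<nu> * norm (x - y)" by (rule Cauchy_Schwarz_ineq2)
    finally show "\<bar>c - d\<bar> \<le> dist x y" using assms by (simp add: dist_norm)
  qed
qed

section \<open>Geometry of discrete octagons\<close>

lemma mem_grid_lines: "z \<in> \<Union>(grid_line X ` S) \<longleftrightarrow> z \<in> X \<and> ((True, snd z) \<in> S \<or> (False, fst z) \<in> S)"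
proof
  assume "z \<in> \<Union>(grid_line X ` S)"
  then obtain b c where "(b, c) \<in> S" "z \<in> grid_line X (b, c)" by auto
  then show "z \<in> X \<and> ((True, snd z) \<in> S \<or> (False, fst z) \<in> S)"
    by (cases b) (auto simp: grid_line_def)
next
  assume "z \<in> X \<and> ((True, snd z) \<in> S \<or> (False, fst z) \<in> S)"
  then have "z \<in> grid_line X (True, snd z) \<and> (True, snd z) \<in> S \<or> z \<in> grid_line X (False, fst z) \<and> (False, fst z) \<in> S"
    by (simp add: grid_line_def)
  then show "z \<in> \<Union>(grid_line X ` S)" by blast
qed

context int_octagon begin

text \<open>The cells extend the points by \<open>\<epsilon> / 2\<close> in each coordinate, so the diagonal constraints move by \<open>\<epsilon>\<close>;
  written in terms of cuts from the enlarged box, the cuts stay the same.\<close>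

definition cell_hull :: "real \<Rightarrow> point set" where
  "cell_hull \<epsilon> = oct_region (\<epsilon> * (a1 - 1/2)) (\<epsilon> * (b1 + 1/2)) (\<epsilon> * (a2 - 1/2)) (\<epsilon> * (b2 + 1/2))
     (\<epsilon> * real_of_int s1) (\<epsilon> * real_of_int s2) (\<epsilon> * real_of_int s3) (\<epsilon> * real_of_int s4)"

lemma real_octagon_hull:
  assumes eps: "0 < \<epsilon>"
  shows "real_octagon (\<epsilon> * (a1 - 1/2)) (\<epsilon> * (b1 + 1/2)) (\<epsilon> * (a2 - 1/2)) (\<epsilon> * (b2 + 1/2))
     (\<epsilon> * real_of_int s1) (\<epsilon> * real_of_int s2) (\<epsilon> * real_of_int s3) (\<epsilon> * real_of_int s4)"
proof
  have le: "\<epsilon> * real_of_int u + \<epsilon> * real_of_int v \<le> \<epsilon> * (real_of_int b + 1 / 2) - \<epsilon> * (real_of_int a - 1 / 2)"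
    if "u + v \<le> b - a" for u v a b
  proof -
    have "real_of_int (u + v) \<le> real_of_int (b - a)" using that unfolding of_int_le_iff .
    then have "real_of_int u + real_of_int v \<le> (real_of_int b + 1 / 2) - (real_of_int a - 1 / 2)" by simp
    from mult_left_mono[OF this, of \<epsilon>] eps show ?thesis by (simp add: algebra_simps)
  qed
  show "\<epsilon> * real_of_int s1 + \<epsilon> * real_of_int s4 \<le> \<epsilon> * (real_of_int b1 + 1 / 2) - \<epsilon> * (real_of_int a1 - 1 / 2)"
    "\<epsilon> * real_of_int s1 + \<epsilon> * real_of_int s2 \<le> \<epsilon> * (real_of_int b2 + 1 / 2) - \<epsilon> * (real_of_int a2 - 1 / 2)"
    "\<epsilon> * real_of_int s2 + \<epsilon> * real_of_int s3 \<le> \<epsilon> * (real_of_int b1 + 1 / 2) - \<epsilon> * (real_of_int a1 - 1 / 2)"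
    "\<epsilon> * real_of_int s3 + \<epsilon> * real_of_int s4 \<le> \<epsilon> * (real_of_int b2 + 1 / 2) - \<epsilon> * (real_of_int a2 - 1 / 2)"
    by (rule le[OF side_nonempty(1)] le[OF side_nonempty(2)] le[OF side_nonempty(3)] le[OF side_nonempty(4)])+
qed (use eps cut_nonneg in auto)

text \<open>Four vertices of the hull are vertices of cells and lie on all eight supporting lines, so every
  octagon that contains the cells contains the hull.\<close>

lemma oct_hull_emb:
  assumes eps: "0 < \<epsilon>"
  shows "oct_hull \<epsilon> (emb \<epsilon> ` X) = cell_hull \<epsilon>"
proof -
  have cell: "(x, y) \<in> cells \<epsilon> (emb \<epsilon> ` X)"
    if "(m, n) \<in> X" "\<bar>x - \<epsilon> * real_of_int m\<bar> \<le> \<epsilon> / 2" "\<bar>y - \<epsilon> * real_of_int n\<bar> \<le> \<epsilon> / 2" for x y m n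
    unfolding mem_cells_iff[OF eps] using that by (intro bexI[of _ "emb \<epsilon> (m, n)"] conjI imageI) (simp_all add: emb_def)
  have scale: "\<epsilon> * real_of_int u \<le> \<epsilon> * real_of_int v" if "u \<le> v" for u v
    using that eps by simp
  have below: "cells \<epsilon> (emb \<epsilon> ` X) \<subseteq> cell_hull \<epsilon>"
  proof
    fix z assume z: "z \<in> cells \<epsilon> (emb \<epsilon> ` X)"
    obtain x y where xy: "z = (x, y)" by fastforce
    from z obtain m n where mn: "(m, n) \<in> X" "\<bar>x - \<epsilon> * real_of_int m\<bar> \<le> \<epsilon> / 2" "\<bar>y - \<epsilon> * real_of_int n\<bar> \<le> \<epsilon> / 2"
      unfolding xy mem_cells_iff[OF eps] by (auto simp: emb_def)
    have X: "a1 \<le> m" "m \<le> b1" "a2 \<le> n" "n \<le> b2" "a1 + a2 + s1 \<le> m + n" "m + n \<le> b1 + b2 - s3"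
      "a1 - b2 + s2 \<le> m - n" "m - n \<le> b1 - a2 - s4"
      using mn(1) unfolding oct_mem by auto
    have "x - \<epsilon> * real_of_int m \<le> \<epsilon> / 2" "- (\<epsilon> / 2) \<le> x - \<epsilon> * real_of_int m"
      "y - \<epsilon> * real_of_int n \<le> \<epsilon> / 2" "- (\<epsilon> / 2) \<le> y - \<epsilon> * real_of_int n"
      using mn(2,3) by linarith+
    with X[THEN scale] show "z \<in> cell_hull \<epsilon>"
      unfolding xy cell_hull_def oct_region_def by (auto simp: algebra_simps)
  qed
  have least: "cell_hull \<epsilon> \<subseteq> A" if A: "A \<in> octagons" "cells \<epsilon> (emb \<epsilon> ` X) \<subseteq> A" for A
  proof -
    obtain A1 B1 A2 B2 C1 D1 C2 D2 where A_eq: "A = {(x, y). A1 \<le> x \<and> x \<le> B1 \<and> A2 \<le> y \<and> y \<le> B2 \<and>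
                  C1 \<le> x + y \<and> x + y \<le> D1 \<and> C2 \<le> x - y \<and> x - y \<le> D2}"
      using A(1) unfolding octagons_def by blast
    have V: "(a1 + s1, a2) \<in> X" "(a1, b2 - s2) \<in> X" "(b1 - s3, b2) \<in> X" "(b1, a2 + s4) \<in> X"
      using cut_nonneg side_nonempty unfolding oct_mem by auto
    have "(\<epsilon> * (a1 + s1) - \<epsilon> / 2, \<epsilon> * a2 - \<epsilon> / 2) \<in> A"
      by (rule subsetD[OF A(2)], rule cell[OF V(1)]) (use eps in auto)
    moreover have "(\<epsilon> * a1 - \<epsilon> / 2, \<epsilon> * (b2 - s2) + \<epsilon> / 2) \<in> A"
      by (rule subsetD[OF A(2)], rule cell[OF V(2)]) (use eps in auto)
    moreover have "(\<epsilon> * (b1 - s3) + \<epsilon> / 2, \<epsilon> * b2 + \<epsilon> / 2) \<in> A"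
      by (rule subsetD[OF A(2)], rule cell[OF V(3)]) (use eps in auto)
    moreover have "(\<epsilon> * b1 + \<epsilon> / 2, \<epsilon> * (a2 + s4) - \<epsilon> / 2) \<in> A"
      by (rule subsetD[OF A(2)], rule cell[OF V(4)]) (use eps in auto)
    ultimately have facts: "A1 \<le> \<epsilon> * a1 - \<epsilon> / 2" "\<epsilon> * b1 + \<epsilon> / 2 \<le> B1" "A2 \<le> \<epsilon> * a2 - \<epsilon> / 2" "\<epsilon> * b2 + \<epsilon> / 2 \<le> B2"
      "C1 \<le> \<epsilon> * a1 + \<epsilon> * s1 + \<epsilon> * a2 - \<epsilon>" "\<epsilon> * b1 - \<epsilon> * s3 + \<epsilon> * b2 + \<epsilon> \<le> D1"
      "C2 \<le> \<epsilon> * a1 - \<epsilon> * b2 + \<epsilon> * s2 - \<epsilon>" "\<epsilon> * b1 - \<epsilon> * a2 - \<epsilon> * s4 + \<epsilon> \<le> D2"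
      unfolding A_eq by (simp_all add: algebra_simps)
    show ?thesis
    proof
      fix z assume z: "z \<in> cell_hull \<epsilon>"
      obtain x y where xy: "z = (x, y)" by fastforce
      have "\<epsilon> * a1 - \<epsilon> / 2 \<le> x" "x \<le> \<epsilon> * b1 + \<epsilon> / 2" "\<epsilon> * a2 - \<epsilon> / 2 \<le> y" "y \<le> \<epsilon> * b2 + \<epsilon> / 2"
        "\<epsilon> * a1 + \<epsilon> * s1 + \<epsilon> * a2 - \<epsilon> \<le> x + y" "x + y \<le> \<epsilon> * b1 - \<epsilon> * s3 + \<epsilon> * b2 + \<epsilon>"
        "\<epsilon> * a1 - \<epsilon> * b2 + \<epsilon> * s2 - \<epsilon> \<le> x - y" "x - y \<le> \<epsilon> * b1 - \<epsilon> * a2 - \<epsilon> * s4 + \<epsilon>"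
        using z unfolding xy cell_hull_def oct_region_def by (simp_all add: algebra_simps)
      with facts have "A1 \<le> x" "x \<le> B1" "A2 \<le> y" "y \<le> B2" "C1 \<le> x + y" "x + y \<le> D1" "C2 \<le> x - y" "x - y \<le> D2"
        by linarith+
      then show "z \<in> A" unfolding A_eq xy by simp
    qed
  qed
  show ?thesis
    unfolding oct_hull_def
    by (rule Least_equality)
       (use real_octagon.octagon[OF real_octagon_hull[OF eps]] below least cell_hull_def in auto)
qed

lemma axis_len_emb:
  assumes eps: "0 < \<epsilon>" and i: "i \<in> {1..4}"
  shows "axis_len \<epsilon> (emb \<epsilon> ` X) i = \<epsilon> * real_of_int (len i)"
  using i unfolding axis_len_def oct_hull_emb[OF eps] cell_hull_def
    real_octagon.axis_side[OF real_octagon_hull[OF eps] i]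
  by (cases rule: index_cases) (auto simp: len_def algebra_simps)

lemma diag_len_emb:
  assumes eps: "0 < \<epsilon>" and i: "i \<in> {1..4}"
  shows "diag_len \<epsilon> (emb \<epsilon> ` X) i = sqrt 2 * (\<epsilon> * real_of_int (cut i))"
  using i unfolding diag_len_def oct_hull_emb[OF eps] cell_hull_def
    real_octagon.diag_side[OF real_octagon_hull[OF eps] i]
  by (cases rule: index_cases) (auto simp: cut_def)

lemma axis_line_emb:
  assumes eps: "0 < \<epsilon>" and i: "i \<in> {1..4}"
  shows "axis_line \<epsilon> (emb \<epsilon> ` X) i
    = {x. axis_nu i \<bullet> x = \<epsilon> * (real_of_int ([- a2, - a1, b2, b1] ! (i - 1)) + 1 / 2)}"
  using i unfolding axis_line_def oct_hull_emb[OF eps] cell_hull_def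
    real_octagon.axis_support[OF real_octagon_hull[OF eps] i]
  by (cases rule: index_cases) (auto simp: algebra_simps)

lemma discrete_octagon_emb:
  assumes eps: "0 < \<epsilon>"
  shows "discrete_octagon \<epsilon> (emb \<epsilon> ` X)"
proof -
  define A :: "point set" where "A = {(x, y). \<epsilon> * a1 \<le> x \<and> x \<le> \<epsilon> * b1 \<and> \<epsilon> * a2 \<le> y \<and> y \<le> \<epsilon> * b2 \<and>
    \<epsilon> * (a1 + a2 + s1) \<le> x + y \<and> x + y \<le> \<epsilon> * (b1 + b2 - s3) \<and>
    \<epsilon> * (a1 - b2 + s2) \<le> x - y \<and> x - y \<le> \<epsilon> * (b1 - a2 - s4)}"
  have mem: "emb \<epsilon> z \<in> A \<longleftrightarrow> z \<in> X" for z
  proof -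
    obtain m n where z: "z = (m, n)" by fastforce
    have scale: "\<epsilon> * real_of_int u \<le> \<epsilon> * real_of_int v \<longleftrightarrow> u \<le> v" for u v
      using eps by simp
    have "emb \<epsilon> z \<in> A \<longleftrightarrow> \<epsilon> * real_of_int a1 \<le> \<epsilon> * real_of_int m \<and> \<epsilon> * real_of_int m \<le> \<epsilon> * real_of_int b1 \<and>
      \<epsilon> * real_of_int a2 \<le> \<epsilon> * real_of_int n \<and> \<epsilon> * real_of_int n \<le> \<epsilon> * real_of_int b2 \<and>
      \<epsilon> * real_of_int (a1 + a2 + s1) \<le> \<epsilon> * real_of_int (m + n) \<and> \<epsilon> * real_of_int (m + n) \<le> \<epsilon> * real_of_int (b1 + b2 - s3) \<and>
      \<epsilon> * real_of_int (a1 - b2 + s2) \<le> \<epsilon> * real_of_int (m - n) \<and> \<epsilon> * real_of_int (m - n) \<le> \<epsilon> * real_of_int (b1 - a2 - s4)"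
      unfolding z emb_def A_def by (simp add: distrib_left right_diff_distrib)
    also have "\<dots> \<longleftrightarrow> z \<in> X" unfolding scale z oct_mem by blast
    finally show ?thesis .
  qed
  have "(a1 + s1, a2) \<in> X" using cut_nonneg side_nonempty by (simp add: oct_mem)
  then have "A \<noteq> {}" using mem by blast
  then have "A \<in> octagons" unfolding octagons_def A_def by blast
  moreover have "emb \<epsilon> ` X = A \<inter> grid \<epsilon>" unfolding grid_eq using mem by blast
  ultimately show ?thesis unfolding discrete_octagon_def by blast
qed

lemma slice_emb:
  assumes eps: "0 < \<epsilon>" and i: "i \<in> {1..4}"
  shows "slice (emb \<epsilon> ` X) i = emb \<epsilon> ` grid_line X (side_line i 1)"
proof -
  have slice: "slice (emb \<epsilon> ` X) i = emb \<epsilon> ` {z \<in> X. m * fst z + n * snd z = h}"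
    if "axis_nu i = (of_int m, of_int n)" "v \<in> X" "m * fst v + n * snd v = h"
      "\<And>z. z \<in> X \<Longrightarrow> m * fst z + n * snd z \<le> h" for m n h v
    unfolding slice_def that(1) extremal_emb[OF eps]
    using that(2-4) by (intro arg_cong[where f="image _"]) (auto intro: antisym)
  show ?thesis
    using i
  proof (cases rule: index_cases)
    case 1
    have "slice (emb \<epsilon> ` X) i = emb \<epsilon> ` {z \<in> X. 0 * fst z + (-1) * snd z = - a2}"
      by (rule slice[of _ _ "(a1 + s1, a2)"])
         (use 1 cut_nonneg side_nonempty in \<open>auto simp: axis_nu_def oct_pts_def\<close>)
    then show ?thesis using 1 by (simp add: grid_line_def side_line_def)
  next
    case 2
    have "slice (emb \<epsilon> ` X) i = emb \<epsilon> ` {z \<in> X. (-1) * fst z + 0 * snd z = - a1}"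
      by (rule slice[of _ _ "(a1, a2 + s1)"])
         (use 2 cut_nonneg side_nonempty in \<open>auto simp: axis_nu_def oct_pts_def\<close>)
    then show ?thesis using 2 by (simp add: grid_line_def side_line_def)
  next
    case 3
    have "slice (emb \<epsilon> ` X) i = emb \<epsilon> ` {z \<in> X. 0 * fst z + 1 * snd z = b2}"
      by (rule slice[of _ _ "(a1 + s2, b2)"])
         (use 3 cut_nonneg side_nonempty in \<open>auto simp: axis_nu_def oct_pts_def\<close>)
    then show ?thesis using 3 by (simp add: grid_line_def side_line_def)
  next
    case 4
    have "slice (emb \<epsilon> ` X) i = emb \<epsilon> ` {z \<in> X. 1 * fst z + 0 * snd z = b1}"
      by (rule slice[of _ _ "(b1, a2 + s4)"])
         (use 4 cut_nonneg side_nonempty in \<open>auto simp: axis_nu_def oct_pts_def\<close>)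
    then show ?thesis using 4 by (simp add: grid_line_def side_line_def)
  qed
qed

lemma outer_lines:
  "grid_line X (side_line 1 1) = {a1 + s1..b1 - s4} \<times> {a2}"
  "grid_line X (side_line 2 1) = {a1} \<times> {a2 + s1..b2 - s2}"
  "grid_line X (side_line 3 1) = {a1 + s2..b1 - s3} \<times> {b2}"
  "grid_line X (side_line 4 1) = {b1} \<times> {a2 + s4..b2 - s3}"
  using cut_nonneg side_nonempty by (auto simp: grid_line_def side_line_def oct_mem)

lemma card_slice_emb:
  assumes eps: "0 < \<epsilon>" and i: "i \<in> {1..4}"
  shows "int (card (slice (emb \<epsilon> ` X) i)) = len i"
proof -
  have "card (slice (emb \<epsilon> ` X) i) = card (grid_line X (side_line i 1))"
    unfolding slice_emb[OF eps i] using emb_inj[of \<epsilon>] eps by (intro card_image) (auto intro: inj_on_subset)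
  then show ?thesis using i side_nonempty
    by (elim index_cases) (simp_all add: outer_lines len_def del: One_nat_def)
qed

end

lemma the_extremal_emb:
  assumes "0 < \<epsilon>" "v \<in> S" "\<And>z. z \<in> S \<Longrightarrow> z \<noteq> v \<Longrightarrow> m * fst z + n * snd z < m * fst v + n * snd v"
  shows "the_elem (extremal (emb \<epsilon> ` S) (of_int m, of_int n)) = emb \<epsilon> v"
proof -
  have "{z \<in> S. \<forall>w\<in>S. m * fst w + n * snd w \<le> m * fst z + n * snd z} = {v}"
    using assms(2,3) by force
  then show ?thesis unfolding extremal_emb[OF assms(1)] by simp
qed

context int_octagon begin

lemma slice_ends:
  assumes eps: "0 < \<epsilon>"
  shows "slice_p (emb \<epsilon> ` X) 1 = emb \<epsilon> (a1 + s1, a2)" "slice_q (emb \<epsilon> ` X) 1 = emb \<epsilon> (b1 - s4, a2)"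
    "slice_p (emb \<epsilon> ` X) 2 = emb \<epsilon> (a1, a2 + s1)" "slice_q (emb \<epsilon> ` X) 2 = emb \<epsilon> (a1, b2 - s2)"
    "slice_p (emb \<epsilon> ` X) 3 = emb \<epsilon> (a1 + s2, b2)" "slice_q (emb \<epsilon> ` X) 3 = emb \<epsilon> (b1 - s3, b2)"
    "slice_p (emb \<epsilon> ` X) 4 = emb \<epsilon> (b1, a2 + s4)" "slice_q (emb \<epsilon> ` X) 4 = emb \<epsilon> (b1, b2 - s3)"
proof -
  have left: "the_elem (extremal (emb \<epsilon> ` S) (-1, 0)) = emb \<epsilon> v"
    if "v \<in> S" "\<And>z. z \<in> S \<Longrightarrow> z \<noteq> v \<Longrightarrow> fst v < fst z" for S v
    using the_extremal_emb[OF eps that(1), of "-1" 0] that(2) by simp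
  have right: "the_elem (extremal (emb \<epsilon> ` S) (1, 0)) = emb \<epsilon> v"
    if "v \<in> S" "\<And>z. z \<in> S \<Longrightarrow> z \<noteq> v \<Longrightarrow> fst z < fst v" for S v
    using the_extremal_emb[OF eps that(1), of 1 0] that(2) by simp
  have low: "the_elem (extremal (emb \<epsilon> ` S) (0, -1)) = emb \<epsilon> v"
    if "v \<in> S" "\<And>z. z \<in> S \<Longrightarrow> z \<noteq> v \<Longrightarrow> snd v < snd z" for S v
    using the_extremal_emb[OF eps that(1), of 0 "-1"] that(2) by simp
  have high: "the_elem (extremal (emb \<epsilon> ` S) (0, 1)) = emb \<epsilon> v"
    if "v \<in> S" "\<And>z. z \<in> S \<Longrightarrow> z \<noteq> v \<Longrightarrow> snd z < snd v" for S v
    using the_extremal_emb[OF eps that(1), of 0 1] that(2) by simp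
  note slices = slice_p_def slice_q_def slice_emb[OF eps] outer_lines
  show "slice_p (emb \<epsilon> ` X) 1 = emb \<epsilon> (a1 + s1, a2)" "slice_p (emb \<epsilon> ` X) 3 = emb \<epsilon> (a1 + s2, b2)"
    using side_nonempty by (simp_all add: slices del: One_nat_def) (rule left; force)+
  show "slice_q (emb \<epsilon> ` X) 1 = emb \<epsilon> (b1 - s4, a2)" "slice_q (emb \<epsilon> ` X) 3 = emb \<epsilon> (b1 - s3, b2)"
    using side_nonempty by (simp_all add: slices del: One_nat_def) (rule right; force)+
  show "slice_p (emb \<epsilon> ` X) 2 = emb \<epsilon> (a1, a2 + s1)" "slice_p (emb \<epsilon> ` X) 4 = emb \<epsilon> (b1, a2 + s4)"
    using side_nonempty by (simp_all add: slices del: One_nat_def) (rule low; force)+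
  show "slice_q (emb \<epsilon> ` X) 2 = emb \<epsilon> (a1, b2 - s2)" "slice_q (emb \<epsilon> ` X) 4 = emb \<epsilon> (b1, b2 - s3)"
    using side_nonempty by (simp_all add: slices del: One_nat_def) (rule high; force)+
qed

lemma diag_seg_emb:
  assumes eps: "0 < \<epsilon>"
  shows "diag_seg \<epsilon> (emb \<epsilon> ` X) 1 = {emb \<epsilon> (a1 + t, a2 + s1 - t) | t. 0 \<le> t \<and> t \<le> s1}"
    "diag_seg \<epsilon> (emb \<epsilon> ` X) 2 = {emb \<epsilon> (a1 + t, b2 - s2 + t) | t. 0 \<le> t \<and> t \<le> s2}"
    "diag_seg \<epsilon> (emb \<epsilon> ` X) 3 = {emb \<epsilon> (b1 - s3 + t, b2 - t) | t. 0 \<le> t \<and> t \<le> s3}"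
    "diag_seg \<epsilon> (emb \<epsilon> ` X) 4 = {emb \<epsilon> (b1 - s4 + t, a2 + t) | t. 0 \<le> t \<and> t \<le> s4}"
  using dseg_emb[OF eps cut_nonneg(1), of 1 "-1" a1 "a2 + s1"] dseg_emb[OF eps cut_nonneg(2), of 1 1 a1 "b2 - s2"]
    dseg_emb[OF eps cut_nonneg(3), of 1 "-1" "b1 - s3" "b2"] dseg_emb[OF eps cut_nonneg(4), of 1 1 "b1 - s4" "a2"]
  by (simp_all add: diag_seg_def slice_ends[OF eps] del: One_nat_def)

end

text \<open>Replacing each constraint by the extreme value that the set attains leaves the set unchanged. The
  points that attain the four axis-parallel constraints show that these sides are nonempty.\<close>

lemma discrete_octagon_params:
  assumes eps: "0 < \<epsilon>" and oct: "discrete_octagon \<epsilon> I" and fin: "finite I" and ne: "I \<noteq> {}"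
  obtains a1 b1 a2 b2 s1 s2 s3 s4 where "int_octagon a1 b1 a2 b2 s1 s2 s3 s4"
    "I = emb \<epsilon> ` oct_pts a1 b1 a2 b2 s1 s2 s3 s4"
proof -
  obtain A where I: "I = A \<inter> grid \<epsilon>" and "A \<in> octagons"
    using oct unfolding discrete_octagon_def by blast
  then obtain A1 B1 A2 B2 C1 D1 C2 D2 where A_eq: "A = {(x, y). A1 \<le> x \<and> x \<le> B1 \<and> A2 \<le> y \<and> y \<le> B2 \<and>
                  C1 \<le> x + y \<and> x + y \<le> D1 \<and> C2 \<le> x - y \<and> x - y \<le> D2}"
    unfolding octagons_def by blast
  define Y where "Y = {z. emb \<epsilon> z \<in> A}"
  have I_eq: "I = emb \<epsilon> ` Y" unfolding I Y_def grid_eq by blast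
  have "finite Y" using fin eps emb_inj[of \<epsilon>] unfolding I_eq by (metis finite_imageD inj_on_subset less_irrefl subset_UNIV)
  have "Y \<noteq> {}" using ne I_eq by blast
  have minimum: "\<exists>z\<in>Y. \<forall>w\<in>Y. f z \<le> f w" for f :: "int \<times> int \<Rightarrow> int"
    using ex_min_if_finite[of "f ` Y"] \<open>finite Y\<close> \<open>Y \<noteq> {}\<close> by (auto simp: not_less)
  obtain p1 where p1: "p1 \<in> Y" "\<forall>w\<in>Y. fst p1 \<le> fst w" using minimum[of fst] by blast
  obtain p2 where p2: "p2 \<in> Y" "\<forall>w\<in>Y. - fst p2 \<le> - fst w" using minimum[of "\<lambda>z. - fst z"] by blast
  obtain p3 where p3: "p3 \<in> Y" "\<forall>w\<in>Y. snd p3 \<le> snd w" using minimum[of snd] by blast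
  obtain p4 where p4: "p4 \<in> Y" "\<forall>w\<in>Y. - snd p4 \<le> - snd w" using minimum[of "\<lambda>z. - snd z"] by blast
  obtain p5 where p5: "p5 \<in> Y" "\<forall>w\<in>Y. fst p5 + snd p5 \<le> fst w + snd w" using minimum[of "\<lambda>z. fst z + snd z"] by blast
  obtain p6 where p6: "p6 \<in> Y" "\<forall>w\<in>Y. - (fst p6 + snd p6) \<le> - (fst w + snd w)" using minimum[of "\<lambda>z. - (fst z + snd z)"] by blast
  obtain p7 where p7: "p7 \<in> Y" "\<forall>w\<in>Y. fst p7 - snd p7 \<le> fst w - snd w" using minimum[of "\<lambda>z. fst z - snd z"] by blast
  obtain p8 where p8: "p8 \<in> Y" "\<forall>w\<in>Y. - (fst p8 - snd p8) \<le> - (fst w - snd w)" using minimum[of "\<lambda>z. - (fst z - snd z)"] by blast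
  define a1 b1 a2 b2 where "a1 = fst p1" "b1 = fst p2" "a2 = snd p3" "b2 = snd p4"
  define s1 s2 s3 s4 where "s1 = fst p5 + snd p5 - a1 - a2" "s2 = fst p7 - snd p7 - a1 + b2"
    "s3 = b1 + b2 - fst p6 - snd p6" "s4 = b1 - a2 - fst p8 + snd p8"
  note defs = a1_b1_a2_b2_def s1_s2_s3_s4_def
  have bounds: "a1 \<le> fst w" "fst w \<le> b1" "a2 \<le> snd w" "snd w \<le> b2" "a1 + a2 + s1 \<le> fst w + snd w"
    "fst w + snd w \<le> b1 + b2 - s3" "a1 - b2 + s2 \<le> fst w - snd w" "fst w - snd w \<le> b1 - a2 - s4"
    if "w \<in> Y" for w
    using bspec[OF p1(2) that] bspec[OF p2(2) that] bspec[OF p3(2) that] bspec[OF p4(2) that]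
      bspec[OF p5(2) that] bspec[OF p6(2) that] bspec[OF p7(2) that] bspec[OF p8(2) that]
    unfolding defs by simp_all
  have "int_octagon a1 b1 a2 b2 s1 s2 s3 s4"
  proof
    show "0 \<le> s1" "0 \<le> s2" "0 \<le> s3" "0 \<le> s4"
      using bounds[OF p5(1)] bounds[OF p6(1)] bounds[OF p7(1)] bounds[OF p8(1)] unfolding s1_s2_s3_s4_def by linarith+
    show "s1 + s4 \<le> b1 - a1" "s1 + s2 \<le> b2 - a2" "s2 + s3 \<le> b1 - a1" "s3 + s4 \<le> b2 - a2"
      using bounds[OF p1(1)] bounds[OF p2(1)] bounds[OF p3(1)] bounds[OF p4(1)] unfolding a1_b1_a2_b2_def by linarith+
  qed
  moreover have "Y = oct_pts a1 b1 a2 b2 s1 s2 s3 s4"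
  proof (intro equalityI subsetI)
    fix w assume "w \<in> Y"
    then show "w \<in> oct_pts a1 b1 a2 b2 s1 s2 s3 s4" using bounds[of w] by (cases w) (auto simp: oct_pts_def)
  next
    fix w assume w: "w \<in> oct_pts a1 b1 a2 b2 s1 s2 s3 s4"
    have scale: "\<epsilon> * real_of_int u \<le> \<epsilon> * real_of_int v" if "u \<le> v" for u v
      using that eps by simp
    have "fst p1 \<le> fst w" "fst w \<le> fst p2" "snd p3 \<le> snd w" "snd w \<le> snd p4"
      "fst p5 + snd p5 \<le> fst w + snd w" "fst w + snd w \<le> fst p6 + snd p6" "fst p7 - snd p7 \<le> fst w - snd w"
      "fst w - snd w \<le> fst p8 - snd p8"
      using w unfolding oct_pts_def defs by auto
    note above = this[THEN scale]
    have "A1 \<le> \<epsilon> * fst p1" using p1(1) by (simp add: Y_def A_eq emb_def)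
    moreover have "\<epsilon> * fst p2 \<le> B1" using p2(1) by (simp add: Y_def A_eq emb_def)
    moreover have "A2 \<le> \<epsilon> * snd p3" using p3(1) by (simp add: Y_def A_eq emb_def)
    moreover have "\<epsilon> * snd p4 \<le> B2" using p4(1) by (simp add: Y_def A_eq emb_def)
    moreover have "C1 \<le> \<epsilon> * (fst p5 + snd p5)" using p5(1) by (simp add: Y_def A_eq emb_def algebra_simps)
    moreover have "\<epsilon> * (fst p6 + snd p6) \<le> D1" using p6(1) by (simp add: Y_def A_eq emb_def algebra_simps)
    moreover have "C2 \<le> \<epsilon> * (fst p7 - snd p7)" using p7(1) by (simp add: Y_def A_eq emb_def algebra_simps)
    moreover have "\<epsilon> * (fst p8 - snd p8) \<le> D2" using p8(1) by (simp add: Y_def A_eq emb_def algebra_simps)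
    ultimately have "A1 \<le> \<epsilon> * fst w" "\<epsilon> * fst w \<le> B1" "A2 \<le> \<epsilon> * snd w" "\<epsilon> * snd w \<le> B2"
      "C1 \<le> \<epsilon> * (fst w + snd w)" "\<epsilon> * (fst w + snd w) \<le> D1"
      "C2 \<le> \<epsilon> * (fst w - snd w)" "\<epsilon> * (fst w - snd w) \<le> D2"
      using above by linarith+
    then show "w \<in> Y" by (simp add: Y_def A_eq emb_def algebra_simps)
  qed
  ultimately show thesis using that I_eq by blast
qed

context int_octagon begin

text \<open>A diagonal side stays on its line while the two adjacent sides move inwards, so it loses as many steps
  as they move together, and disappears when it has too few.\<close>

lemma shrink:
  fixes \<alpha> :: "nat \<Rightarrow> int"
  assumes "\<And>j. j \<in> {1..4} \<Longrightarrow> 0 \<le> \<alpha> j" "\<And>i j. i \<in> {1..4} \<Longrightarrow> j \<in> {1..4} \<Longrightarrow> 2 * \<alpha> j < len i"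
  shows "int_octagon (a1 + \<alpha> 2) (b1 - \<alpha> 4) (a2 + \<alpha> 1) (b2 - \<alpha> 3)
      (max 0 (s1 - \<alpha> 1 - \<alpha> 2)) (max 0 (s2 - \<alpha> 2 - \<alpha> 3)) (max 0 (s3 - \<alpha> 3 - \<alpha> 4)) (max 0 (s4 - \<alpha> 4 - \<alpha> 1))"
proof -
  have "0 \<le> \<alpha> 1" "0 \<le> \<alpha> 2" "0 \<le> \<alpha> 3" "0 \<le> \<alpha> 4" using assms(1) by auto
  moreover have "2 * \<alpha> j < b1 - a1 - s1 - s4 + 1" "2 * \<alpha> j < b2 - a2 - s1 - s2 + 1"
     "2 * \<alpha> j < b1 - a1 - s2 - s3 + 1" "2 * \<alpha> j < b2 - a2 - s3 - s4 + 1" if "j \<in> {1..4}" for j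
    using assms(2)[of 1 j] assms(2)[of 2 j] assms(2)[of 3 j] assms(2)[of 4 j] that by (auto simp: len_def)
  note this[of 1] this[of 2] this[of 3] this[of 4]
  ultimately show ?thesis using cut_nonneg by unfold_locales auto
qed

lemma removed_lines:
  "{side_line i t | i t. i \<in> {1..4} \<and> 1 \<le> t \<and> t \<le> \<alpha> i}
    = {True} \<times> {a2..a2 + \<alpha> 1 - 1} \<union> {False} \<times> {a1..a1 + \<alpha> 2 - 1} \<union> {True} \<times> {b2 - \<alpha> 3 + 1..b2} \<union> {False} \<times> {b1 - \<alpha> 4 + 1..b1}"
    (is "?T = ?S")
proof (intro equalityI subsetI)
  fix l assume "l \<in> ?T"
  then obtain i t where l: "l = side_line i t" "1 \<le> t" "t \<le> \<alpha> i" and i: "i \<in> {1..4::nat}" by blast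
  from i show "l \<in> ?S" by (cases rule: index_cases) (use l in \<open>auto simp: side_line_def\<close>)
next
  fix l assume "l \<in> ?S"
  then consider y where "l = (True, y)" "a2 \<le> y" "y \<le> a2 + \<alpha> 1 - 1" | x where "l = (False, x)" "a1 \<le> x" "x \<le> a1 + \<alpha> 2 - 1"
    | y where "l = (True, y)" "b2 - \<alpha> 3 + 1 \<le> y" "y \<le> b2" | x where "l = (False, x)" "b1 - \<alpha> 4 + 1 \<le> x" "x \<le> b1" by auto
  then show "l \<in> ?T"
  proof cases
    case (1 y) then show ?thesis by (intro CollectI exI[of _ 1] exI[of _ "y - a2 + 1"]) (auto simp: side_line_def)
  next
    case (2 x) then show ?thesis by (intro CollectI exI[of _ 2] exI[of _ "x - a1 + 1"]) (auto simp: side_line_def)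
  next
    case (3 y) then show ?thesis by (intro CollectI exI[of _ 3] exI[of _ "b2 - y + 1"]) (auto simp: side_line_def)
  next
    case (4 x) then show ?thesis by (intro CollectI exI[of _ 4] exI[of _ "b1 - x + 1"]) (auto simp: side_line_def)
  qed
qed

lemma shrink_pts:
  fixes \<alpha> :: "nat \<Rightarrow> int"
  assumes "\<And>j. j \<in> {1..4} \<Longrightarrow> 0 \<le> \<alpha> j"
  shows "oct_pts (a1 + \<alpha> 2) (b1 - \<alpha> 4) (a2 + \<alpha> 1) (b2 - \<alpha> 3)
      (max 0 (s1 - \<alpha> 1 - \<alpha> 2)) (max 0 (s2 - \<alpha> 2 - \<alpha> 3)) (max 0 (s3 - \<alpha> 3 - \<alpha> 4)) (max 0 (s4 - \<alpha> 4 - \<alpha> 1))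
    = X - \<Union>(grid_line X ` {side_line i t | i t. i \<in> {1..4} \<and> 1 \<le> t \<and> t \<le> \<alpha> i})" (is "_ = X - \<Union>(grid_line X ` ?T)")
proof (intro set_eqI)
  fix z :: "int \<times> int"
  obtain x y where z: "z = (x, y)" by fastforce
  show "z \<in> oct_pts (a1 + \<alpha> 2) (b1 - \<alpha> 4) (a2 + \<alpha> 1) (b2 - \<alpha> 3)
      (max 0 (s1 - \<alpha> 1 - \<alpha> 2)) (max 0 (s2 - \<alpha> 2 - \<alpha> 3)) (max 0 (s3 - \<alpha> 3 - \<alpha> 4)) (max 0 (s4 - \<alpha> 4 - \<alpha> 1))
    \<longleftrightarrow> z \<in> X - \<Union>(grid_line X ` ?T)"
    unfolding removed_lines Diff_iff mem_grid_lines z using assms[of 1] assms[of 2] assms[of 3] assms[of 4] by (auto simp: oct_pts_def)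
qed

lemma inner_oct_emb:
  assumes eps: "0 < \<epsilon>"
  shows "inner_oct (emb \<epsilon> ` X) = emb \<epsilon> ` oct_pts (a1 + 1) (b1 - 1) (a2 + 1) (b2 - 1)
      (max 0 (s1 - 2)) (max 0 (s2 - 2)) (max 0 (s3 - 2)) (max 0 (s4 - 2))"
proof -
  have "{side_line i t | i t. i \<in> {1..4} \<and> 1 \<le> t \<and> t \<le> 1} = (\<lambda>i. side_line i 1) ` {1..4::nat}"
  proof -
    have "1 \<le> t \<and> t \<le> 1 \<longleftrightarrow> t = 1" for t :: int by auto
    then show ?thesis by (simp only:) blast
  qed
  then have inner: "oct_pts (a1 + 1) (b1 - 1) (a2 + 1) (b2 - 1)
      (max 0 (s1 - 2)) (max 0 (s2 - 2)) (max 0 (s3 - 2)) (max 0 (s4 - 2))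
     = X - (\<Union>i\<in>{1..4::nat}. grid_line X (side_line i 1))"
    using shrink_pts[of "\<lambda>_. 1"] by (simp add: image_image)
  have "(\<Union>i\<in>{1..4}. slice (emb \<epsilon> ` X) i) = emb \<epsilon> ` (\<Union>i\<in>{1..4::nat}. grid_line X (side_line i 1))"
    unfolding image_UN using slice_emb[OF eps] by (intro SUP_cong) auto
  then show ?thesis unfolding inner_oct_def inner
    using emb_inj[of \<epsilon>] eps by (simp add: image_set_diff)
qed

lemma displacement_shrink:
  fixes \<alpha> :: "nat \<Rightarrow> int"
  assumes eps: "0 < \<epsilon>" and i: "i \<in> {1..4}"
    and J: "int_octagon (a1 + \<alpha> 2) (b1 - \<alpha> 4) (a2 + \<alpha> 1) (b2 - \<alpha> 3) t1 t2 t3 t4" and "0 \<le> \<alpha> i"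
  shows "displacement \<epsilon> (emb \<epsilon> ` X) (emb \<epsilon> ` oct_pts (a1 + \<alpha> 2) (b1 - \<alpha> 4) (a2 + \<alpha> 1) (b2 - \<alpha> 3) t1 t2 t3 t4) i
    = real_of_int (\<alpha> i)"
proof -
  have "norm (axis_nu i) = 1" using i by (elim index_cases) (auto simp: axis_nu_def norm_Pair)
  then have "displacement \<epsilon> (emb \<epsilon> ` X) (emb \<epsilon> ` oct_pts (a1 + \<alpha> 2) (b1 - \<alpha> 4) (a2 + \<alpha> 1) (b2 - \<alpha> 3) t1 t2 t3 t4) i
    = \<bar>\<epsilon> * (real_of_int ([- a2, - a1, b2, b1] ! (i - 1)) + 1 / 2)
       - \<epsilon> * (real_of_int ([- (a2 + \<alpha> 1), - (a1 + \<alpha> 2), b2 - \<alpha> 3, b1 - \<alpha> 4] ! (i - 1)) + 1 / 2)\<bar> / \<epsilon>"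
    unfolding displacement_def axis_line_emb[OF eps i] int_octagon.axis_line_emb[OF J eps i]
    by (simp add: setdist_parallel_lines)
  also have "\<dots> = \<bar>\<epsilon> * real_of_int (\<alpha> i)\<bar> / \<epsilon>"
    using i by (elim index_cases) (auto simp: algebra_simps)
  also have "\<dots> = real_of_int (\<alpha> i)" using eps \<open>0 \<le> \<alpha> i\<close> by (simp add: abs_mult)
  finally show ?thesis .
qed

end

section \<open>The functional in lattice coordinates\<close>

definition hbond :: "real \<Rightarrow> int \<times> int \<Rightarrow> point set" where
  "hbond \<epsilon> z = {emb \<epsilon> z, emb \<epsilon> (fst z + 1, snd z)}"

definition vbond :: "real \<Rightarrow> int \<times> int \<Rightarrow> point set" where
  "vbond \<epsilon> z = {emb \<epsilon> z, emb \<epsilon> (fst z, snd z + 1)}"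

lemma dist_emb_eq_iff:
  assumes eps: "0 < \<epsilon>"
  shows "dist (emb \<epsilon> p) (emb \<epsilon> q) = \<epsilon> \<longleftrightarrow> \<bar>fst p - fst q\<bar> + \<bar>snd p - snd q\<bar> = 1"
proof -
  define m n where "m = fst p - fst q" and "n = snd p - snd q"
  have "dist (emb \<epsilon> p) (emb \<epsilon> q) = sqrt ((\<epsilon> * m)\<^sup>2 + (\<epsilon> * n)\<^sup>2)"
    by (simp add: emb_def dist_Pair_Pair dist_real_def m_def n_def right_diff_distrib)
  also have "\<dots> = \<epsilon> * sqrt (real_of_int (m\<^sup>2 + n\<^sup>2))"
    using eps by (simp add: power_mult_distrib real_sqrt_mult flip: distrib_left)
  finally have "dist (emb \<epsilon> p) (emb \<epsilon> q) = \<epsilon> \<longleftrightarrow> m\<^sup>2 + n\<^sup>2 = 1"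
    using eps by (simp flip: of_int_power of_int_add)
  also have "\<dots> \<longleftrightarrow> \<bar>m\<bar> + \<bar>n\<bar> = 1"
  proof
    assume sq: "m\<^sup>2 + n\<^sup>2 = 1"
    then have "m\<^sup>2 \<le> 1" "n\<^sup>2 \<le> 1" using zero_le_power2[of m] zero_le_power2[of n] by linarith+
    then have "\<bar>m\<bar> \<le> 1" "\<bar>n\<bar> \<le> 1" by (simp_all add: abs_square_le_1)
    then have "m \<in> {-1, 0, 1}" "n \<in> {-1, 0, 1}" by auto
    then show "\<bar>m\<bar> + \<bar>n\<bar> = 1" using sq by auto
  next
    assume "\<bar>m\<bar> + \<bar>n\<bar> = 1"
    then have "m \<in> {-1, 0, 1}" "n \<in> {-1, 0, 1}" "\<bar>m\<bar> + \<bar>n\<bar> = 1" by auto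
    then show "m\<^sup>2 + n\<^sup>2 = 1" by auto
  qed
  finally show ?thesis unfolding m_def n_def .
qed

text \<open>Each bond is counted once, through its left or its lower end.\<close>

lemma bonds_eq:
  assumes eps: "0 < \<epsilon>"
  shows "bonds \<epsilon> = range (hbond \<epsilon>) \<union> range (vbond \<epsilon>)"
proof (intro equalityI subsetI)
  fix e assume "e \<in> bonds \<epsilon>"
  then obtain p q where e: "e = {emb \<epsilon> p, emb \<epsilon> q}" and "dist (emb \<epsilon> p) (emb \<epsilon> q) = \<epsilon>"
    unfolding bonds_def grid_eq by blast
  then have "\<bar>fst p - fst q\<bar> + \<bar>snd p - snd q\<bar> = 1" using dist_emb_eq_iff[OF eps] by blast
  then have "fst q = fst p + 1 \<and> snd q = snd p \<or> fst p = fst q + 1 \<and> snd p = snd q \<or>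
      fst q = fst p \<and> snd q = snd p + 1 \<or> fst p = fst q \<and> snd p = snd q + 1" by arith
  then consider "q = (fst p + 1, snd p)" | "p = (fst q + 1, snd q)" | "q = (fst p, snd p + 1)" | "p = (fst q, snd q + 1)"
    by (auto simp: prod_eq_iff)
  then have "e = hbond \<epsilon> p \<or> e = hbond \<epsilon> q \<or> e = vbond \<epsilon> p \<or> e = vbond \<epsilon> q"
    unfolding e hbond_def vbond_def by cases (metis insert_commute)+
  then show "e \<in> range (hbond \<epsilon>) \<union> range (vbond \<epsilon>)" by blast
next
  fix e assume "e \<in> range (hbond \<epsilon>) \<union> range (vbond \<epsilon>)"
  then obtain z where "e = hbond \<epsilon> z \<or> e = vbond \<epsilon> z" by blast
  then obtain w where "e = {emb \<epsilon> z, emb \<epsilon> w}" "\<bar>fst z - fst w\<bar> + \<bar>snd z - snd w\<bar> = 1"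
    unfolding hbond_def vbond_def by fastforce
  then show "e \<in> bonds \<epsilon>"
    unfolding bonds_def grid_eq using dist_emb_eq_iff[OF eps, of z w] by blast
qed

lemma inj_hbond: "0 < \<epsilon> \<Longrightarrow> inj (hbond \<epsilon>)"
  by (auto simp: inj_def hbond_def doubleton_eq_iff emb_eq_iff)

lemma inj_vbond: "0 < \<epsilon> \<Longrightarrow> inj (vbond \<epsilon>)"
  by (auto simp: inj_def vbond_def doubleton_eq_iff emb_eq_iff)

lemma hbond_vbond_disjoint: "0 < \<epsilon> \<Longrightarrow> range (hbond \<epsilon>) \<inter> range (vbond \<epsilon>) = {}"
  by (auto simp: hbond_def vbond_def doubleton_eq_iff emb_eq_iff)

lemma infsum_ennreal_finite_support:
  fixes f :: "'a \<Rightarrow> real"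
  assumes "finite A" "\<And>z. 0 \<le> f z" "\<And>z. z \<notin> A \<Longrightarrow> f z = 0"
  shows "(\<Sum>\<^sub>\<infinity>z. ennreal (f z)) = ennreal (\<Sum>z\<in>A. f z)"
proof -
  have "(\<Sum>\<^sub>\<infinity>z. ennreal (f z)) = (\<Sum>\<^sub>\<infinity>z\<in>A. ennreal (f z))"
    by (rule infsum_cong_neutral) (use assms in auto)
  then show ?thesis using assms by (simp add: sum_ennreal)
qed

lemma energy_emb:
  assumes eps: "0 < \<epsilon>" and k: "k < 1" and val: "\<And>z. v z \<in> {1, -1, 0}" and v: "\<And>z. v z = u (emb \<epsilon> z)"
    and out: "\<And>x y. \<bar>x\<bar> \<ge> M \<or> \<bar>y\<bar> \<ge> M \<Longrightarrow> v (x, y) = -1"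
  shows "energy k \<epsilon> u = ennreal (\<epsilon> * lattice_energy k v M)"
proof -
  define g where "g e = ennreal (\<epsilon> * (1 - prod u e - k * (1 - (prod u e)\<^sup>2)))" for e
  define fh where "fh z = \<epsilon> * bond_energy k (v z) (v (fst z + 1, snd z))" for z
  define fv where "fv z = \<epsilon> * bond_energy k (v z) (v (fst z, snd z + 1))" for z
  have gh: "g \<circ> hbond \<epsilon> = (\<lambda>z. ennreal (fh z))"
    using eps by (auto simp: fun_eq_iff g_def fh_def hbond_def bond_energy_def emb_eq_iff v)
  have gv: "g \<circ> vbond \<epsilon> = (\<lambda>z. ennreal (fv z))"
    using eps by (auto simp: fun_eq_iff g_def fv_def vbond_def bond_energy_def emb_eq_iff v)
  have nonneg: "0 \<le> fh z" "0 \<le> fv z" for z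
    using eps bond_energy_nonneg[OF k val val] by (simp_all add: fh_def fv_def)
  have "energy k \<epsilon> u = infsum g (range (hbond \<epsilon>) \<union> range (vbond \<epsilon>))"
    unfolding energy_def bonds_eq[OF eps] g_def ..
  also have "\<dots> = infsum g (range (hbond \<epsilon>)) + infsum g (range (vbond \<epsilon>))"
    by (rule infsum_Un_disjoint) (auto intro: nonneg_summable_on_complete simp: hbond_vbond_disjoint[OF eps])
  also have "\<dots> = (\<Sum>\<^sub>\<infinity>z. ennreal (fh z)) + (\<Sum>\<^sub>\<infinity>z. ennreal (fv z))"
    unfolding infsum_reindex[OF inj_hbond[OF eps]] infsum_reindex[OF inj_vbond[OF eps]] gh gv ..
  also have "(\<Sum>\<^sub>\<infinity>z. ennreal (fh z)) = ennreal (\<Sum>z\<in>{-M..<M} \<times> {-M..M}. fh z)"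
  proof (rule infsum_ennreal_finite_support)
    fix z :: "int \<times> int" assume "z \<notin> {-M..<M} \<times> {-M..M}"
    then have "\<bar>snd z\<bar> \<ge> M \<or> (\<bar>fst z\<bar> \<ge> M \<and> \<bar>fst z + 1\<bar> \<ge> M)" by (cases z) auto
    \<comment> \<open>bonds that leave the box join two spins -1 and cost nothing\<close>
    then have "v z = -1" "v (fst z + 1, snd z) = -1"
      using out[of "fst z" "snd z"] out[of "fst z + 1" "snd z"] by auto
    then show "fh z = 0" by (simp add: fh_def bond_energy_def)
  qed (use nonneg in auto)
  also have "(\<Sum>\<^sub>\<infinity>z. ennreal (fv z)) = ennreal (\<Sum>z\<in>{-M..M} \<times> {-M..<M}. fv z)"
  proof (rule infsum_ennreal_finite_support)
    fix z :: "int \<times> int" assume "z \<notin> {-M..M} \<times> {-M..<M}"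
    then have "\<bar>fst z\<bar> \<ge> M \<or> (\<bar>snd z\<bar> \<ge> M \<and> \<bar>snd z + 1\<bar> \<ge> M)" by (cases z) auto
    then have "v z = -1" "v (fst z, snd z + 1) = -1"
      using out[of "fst z" "snd z"] out[of "fst z" "snd z + 1"] by auto
    then show "fv z = 0" by (simp add: fv_def bond_energy_def)
  qed (use nonneg in auto)
  also have "(\<Sum>z\<in>{-M..<M} \<times> {-M..M}. fh z) = \<epsilon> * (\<Sum>y\<in>{-M..M}. line_energy k (\<lambda>x. v (x, y)) M)"
  proof -
    have "(\<Sum>z\<in>{-M..<M} \<times> {-M..M}. fh z) = (\<Sum>x\<in>{-M..<M}. \<Sum>y\<in>{-M..M}. fh (x, y))"
      by (simp add: sum.cartesian_product)
    also have "\<dots> = (\<Sum>y\<in>{-M..M}. \<Sum>x\<in>{-M..<M}. fh (x, y))" by (rule sum.swap)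
    finally show ?thesis by (simp add: fh_def line_energy_def sum_distrib_left)
  qed
  also have "(\<Sum>z\<in>{-M..M} \<times> {-M..<M}. fv z) = \<epsilon> * (\<Sum>x\<in>{-M..M}. line_energy k (\<lambda>y. v (x, y)) M)"
  proof -
    have "(\<Sum>z\<in>{-M..M} \<times> {-M..<M}. fv z) = (\<Sum>x\<in>{-M..M}. \<Sum>y\<in>{-M..<M}. fv (x, y))"
      by (simp add: sum.cartesian_product)
    then show ?thesis by (simp add: fv_def line_energy_def sum_distrib_left)
  qed
  also have "ennreal (\<epsilon> * (\<Sum>y\<in>{-M..M}. line_energy k (\<lambda>x. v (x, y)) M)) + ennreal (\<epsilon> * (\<Sum>x\<in>{-M..M}. line_energy k (\<lambda>y. v (x, y)) M))
     = ennreal (\<epsilon> * lattice_energy k v M)"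
  proof (subst ennreal_plus[symmetric])
    show "0 \<le> \<epsilon> * (\<Sum>y\<in>{-M..M}. line_energy k (\<lambda>x. v (x, y)) M)"
      "0 \<le> \<epsilon> * (\<Sum>x\<in>{-M..M}. line_energy k (\<lambda>y. v (x, y)) M)"
      using eps unfolding line_energy_def by (intro mult_nonneg_nonneg sum_nonneg bond_energy_nonneg k val; simp)+
  qed (simp add: lattice_energy_def distrib_left)
  finally show ?thesis .
qed

lemma depth_pos:
  assumes "(q0 \<in> X) \<noteq> (p \<in> X)"
  shows "1 \<le> depth X p"
proof -
  obtain q where "(q \<in> X) \<noteq> (p \<in> X)" "int (depth X p) = \<bar>fst p - fst q\<bar> + \<bar>snd p - snd q\<bar>"
    using depth_attained[OF assms] by metis
  moreover from this(1) have "q \<noteq> p" by blast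
  then have "\<bar>fst p - fst q\<bar> + \<bar>snd p - snd q\<bar> \<noteq> 0" by (auto simp: prod_eq_iff)
  ultimately show ?thesis by linarith
qed

lemma bdist_emb:
  assumes eps: "0 < \<epsilon>" and opp: "(q0 \<in> X) \<noteq> (p \<in> X)"
  shows "bdist \<epsilon> (emb \<epsilon> ` X) (emb \<epsilon> p) = ennreal (\<epsilon> * real (depth X p))"
proof -
  have mem: "emb \<epsilon> z \<in> emb \<epsilon> ` X \<longleftrightarrow> z \<in> X" for z
    using eps by (intro inj_image_mem_iff emb_inj) simp
  have compl: "grid \<epsilon> - emb \<epsilon> ` X = emb \<epsilon> ` (- X)"
    unfolding grid_eq Compl_eq_Diff_UNIV using eps by (intro image_set_diff[symmetric] emb_inj) simp
  have norm1: "norm1 (emb \<epsilon> p - emb \<epsilon> q) = \<epsilon> * real_of_int (\<bar>fst p - fst q\<bar> + \<bar>snd p - snd q\<bar>)" for q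
    using eps by (simp add: norm1_def emb_def abs_mult distrib_left flip: right_diff_distrib)
  have "bdist \<epsilon> (emb \<epsilon> ` X) (emb \<epsilon> p) = (INF q\<in>{q. (q \<in> X) \<noteq> (p \<in> X)}. ennreal (norm1 (emb \<epsilon> p - emb \<epsilon> q)))"
  proof (cases "p \<in> X")
    case True
    then have "{q. (q \<in> X) \<noteq> (p \<in> X)} = - X" by auto
    then show ?thesis using True unfolding bdist_def compl by (simp add: image_image mem)
  next
    case False
    then have "{q. (q \<in> X) \<noteq> (p \<in> X)} = X" by auto
    then show ?thesis using False unfolding bdist_def by (simp add: image_image mem)
  qed
  also have "\<dots> = ennreal (\<epsilon> * real (depth X p))"
  proof (rule antisym)
    obtain q where q: "(q \<in> X) \<noteq> (p \<in> X)" "int (depth X p) = \<bar>fst p - fst q\<bar> + \<bar>snd p - snd q\<bar>"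
      using depth_attained[OF opp] by metis
    then have "real_of_int (\<bar>fst p - fst q\<bar> + \<bar>snd p - snd q\<bar>) = real (depth X p)" by (metis of_int_of_nat_eq)
    then have "ennreal (norm1 (emb \<epsilon> p - emb \<epsilon> q)) = ennreal (\<epsilon> * real (depth X p))" by (simp only: norm1)
    then show "(INF q\<in>{q. (q \<in> X) \<noteq> (p \<in> X)}. ennreal (norm1 (emb \<epsilon> p - emb \<epsilon> q))) \<le> ennreal (\<epsilon> * real (depth X p))"
      using q(1) by (intro INF_lower2[of q]) auto
  next
    show "ennreal (\<epsilon> * real (depth X p)) \<le> (INF q\<in>{q. (q \<in> X) \<noteq> (p \<in> X)}. ennreal (norm1 (emb \<epsilon> p - emb \<epsilon> q)))"
    proof (rule INF_greatest)
      fix q assume "q \<in> {q. (q \<in> X) \<noteq> (p \<in> X)}"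
      then have "int (depth X p) \<le> \<bar>fst p - fst q\<bar> + \<bar>snd p - snd q\<bar>" by (intro depth_le) auto
      then have "real (depth X p) \<le> real_of_int (\<bar>fst p - fst q\<bar> + \<bar>snd p - snd q\<bar>)" by linarith
      then show "ennreal (\<epsilon> * real (depth X p)) \<le> ennreal (norm1 (emb \<epsilon> p - emb \<epsilon> q))"
        unfolding norm1 using eps by (intro ennreal_leI mult_left_mono) auto
    qed
  qed
  finally show ?thesis .
qed

definition sites :: "real \<Rightarrow> (point \<Rightarrow> real) \<Rightarrow> real \<Rightarrow> (int \<times> int) set" where
  "sites \<epsilon> u s = {z. u (emb \<epsilon> z) = s}"

lemma phase_emb: "phase \<epsilon> u = emb \<epsilon> ` sites \<epsilon> u 1"
  by (auto simp: phase_def sites_def grid_eq)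

lemma surf_emb: "surf \<epsilon> u = emb \<epsilon> ` sites \<epsilon> u 0"
  by (auto simp: surf_def sites_def grid_eq)

lemma card_emb: "0 < \<epsilon> \<Longrightarrow> card (emb \<epsilon> ` S) = card S"
  by (intro card_image) (auto simp: inj_on_def emb_eq_iff)

lemma finite_emb: "0 < \<epsilon> \<Longrightarrow> finite (emb \<epsilon> ` S) \<longleftrightarrow> finite S"
  by (intro finite_image_iff) (auto simp: inj_on_def emb_eq_iff)

lemma admissible_sites:
  assumes "0 < \<epsilon>" "u \<in> admissible \<epsilon>"
  shows "u (emb \<epsilon> z) \<in> {1, -1, 0}" "finite (sites \<epsilon> u 0)"
proof -
  show "u (emb \<epsilon> z) \<in> {1, -1, 0}" using assms(2) by (auto simp: admissible_def grid_eq)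
  have "finite (surf \<epsilon> u)" using assms(2) by (simp add: admissible_def surf_def)
  then show "finite (sites \<epsilon> u 0)" unfolding surf_emb finite_emb[OF assms(1)] .
qed

lemma opposite_site_exists:
  assumes "finite X" "X \<noteq> {}"
  obtains q :: "int \<times> int" where "(q \<in> X) \<noteq> (p \<in> X)"
proof (cases "p \<in> X")
  case True
  have "infinite (UNIV :: (int \<times> int) set)" by (simp add: finite_prod)
  then obtain q where "q \<notin> X" using assms(1) ex_new_if_finite by blast
  then show ?thesis using that True by blast
next
  case False
  then show ?thesis using that assms(2) by blast
qed

text \<open>Every site in the symmetric difference is at distance at least \<open>\<epsilon>\<close> from the boundary of the old phase,
  so finite dissipation excludes infinitely many of them.\<close>

lemma finite_phase:
  assumes eps: "0 < \<epsilon>" and tau: "0 < \<tau>" and X: "finite (sites \<epsilon> w 1)" "sites \<epsilon> w 1 \<noteq> {}"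
    and fin: "functional k \<tau> \<gamma> \<epsilon> u w < \<infinity>"
  shows "finite (sites \<epsilon> u 1)"
proof (rule ccontr)
  assume inf: "infinite (sites \<epsilon> u 1)"
  let ?S = "(phase \<epsilon> u - phase \<epsilon> w) \<union> (phase \<epsilon> w - phase \<epsilon> u)"
  have "infinite (phase \<epsilon> u)" "finite (phase \<epsilon> w)" using inf X finite_emb[OF eps] unfolding phase_emb by auto
  then have "infinite ?S" by auto
  have "(\<Sum>\<^sub>\<infinity>p\<in>?S. ennreal (\<epsilon>\<^sup>2) * bdist \<epsilon> (phase \<epsilon> w) p) = \<infinity>"
  proof (rule infsum_superconst_infinite_ennreal[OF _ _ \<open>infinite ?S\<close>])
    show "0 < ennreal (\<epsilon>\<^sup>2) * ennreal \<epsilon>" using eps by (simp add: ennreal_zero_less_mult_iff)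
    fix p assume "p \<in> ?S"
    then obtain z where p: "p = emb \<epsilon> z" unfolding phase_emb by blast
    obtain q where q: "(q \<in> sites \<epsilon> w 1) \<noteq> (z \<in> sites \<epsilon> w 1)" using opposite_site_exists[OF X] .
    have "ennreal \<epsilon> \<le> bdist \<epsilon> (phase \<epsilon> w) p"
      unfolding p phase_emb bdist_emb[OF eps q] using depth_pos[OF q] eps by (intro ennreal_leI) auto
    then show "ennreal (\<epsilon>\<^sup>2) * ennreal \<epsilon> \<le> ennreal (\<epsilon>\<^sup>2) * bdist \<epsilon> (phase \<epsilon> w) p"
      by (intro mult_left_mono) auto
  qed
  then have "functional k \<tau> \<gamma> \<epsilon> u w = \<infinity>"
    using tau by (simp add: functional_def ennreal_mult_eq_top_iff)
  with fin show False by simp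
qed

text \<open>With \<open>\<tau> = \<zeta> * \<epsilon>\<close> and after division by \<open>\<epsilon>\<close>, energy and dissipation are of the same order on lines
  of \<open>1 / \<epsilon>\<close> points, whereas the penalty on the number of particles blows up for \<open>\<gamma> < 2\<close>. For spins that
  are \<open>-1\<close> outside a box the functional is a finite real number.\<close>

lemma functional_emb:
  assumes eps: "0 < \<epsilon>" and zeta: "0 < \<zeta>" and k: "k < 1" and u: "u \<in> admissible \<epsilon>"
    and X: "finite (sites \<epsilon> w 1)" "sites \<epsilon> w 1 \<noteq> {}"
    and out: "\<And>x y. \<bar>x\<bar> \<ge> M \<or> \<bar>y\<bar> \<ge> M \<Longrightarrow> u (emb \<epsilon> (x, y)) = -1"
  shows "functional k (\<zeta> * \<epsilon>) \<gamma> \<epsilon> u w = ennreal (\<epsilon> * (lattice_energy k (\<lambda>z. u (emb \<epsilon> z)) M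
    + \<epsilon> / \<zeta> * (\<Sum>p\<in>(sites \<epsilon> u 1 - sites \<epsilon> w 1) \<union> (sites \<epsilon> w 1 - sites \<epsilon> u 1). real (depth (sites \<epsilon> w 1) p))
    + \<epsilon> powr (\<gamma> - 2) / \<zeta> * \<bar>real (card (sites \<epsilon> u 0)) - real (card (sites \<epsilon> w 0))\<bar>))"
proof -
  let ?X = "sites \<epsilon> w 1" and ?J = "sites \<epsilon> u 1"
  let ?S = "(?J - ?X) \<union> (?X - ?J)" and ?d = "\<bar>real (card (sites \<epsilon> u 0)) - real (card (sites \<epsilon> w 0))\<bar>"
  define E where "E = lattice_energy k (\<lambda>z. u (emb \<epsilon> z)) M"
  define D where "D = (\<Sum>p\<in>?S. real (depth ?X p))"
  have "?J \<subseteq> {-M..M} \<times> {-M..M}"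
  proof
    fix z assume "z \<in> ?J"
    then have "u (emb \<epsilon> (fst z, snd z)) \<noteq> -1" by (simp add: sites_def)
    then show "z \<in> {-M..M} \<times> {-M..M}" using out[of "fst z" "snd z"] by (cases z) force
  qed
  then have J: "finite ?J" by (rule finite_subset) simp
  have val: "u (emb \<epsilon> z) \<in> {1, -1, 0}" for z using admissible_sites[OF eps u] by blast
  have E0: "0 \<le> E" unfolding E_def lattice_energy_def line_energy_def
    by (intro add_nonneg_nonneg sum_nonneg bond_energy_nonneg k val)
  have D0: "0 \<le> D" unfolding D_def by (intro sum_nonneg) simp
  have energy: "energy k \<epsilon> u = ennreal (\<epsilon> * E)"
    unfolding E_def by (rule energy_emb[where v="\<lambda>z. u (emb \<epsilon> z)"]) (use eps k val out in auto)
  have "phase \<epsilon> u - phase \<epsilon> w \<union> (phase \<epsilon> w - phase \<epsilon> u) = emb \<epsilon> ` ?S"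
    unfolding phase_emb image_Un using emb_inj[of \<epsilon>] eps by (simp add: image_set_diff)
  then have "(\<Sum>\<^sub>\<infinity>p\<in>phase \<epsilon> u - phase \<epsilon> w \<union> (phase \<epsilon> w - phase \<epsilon> u). ennreal (\<epsilon>\<^sup>2) * bdist \<epsilon> (phase \<epsilon> w) p)
     = (\<Sum>p\<in>emb \<epsilon> ` ?S. ennreal (\<epsilon>\<^sup>2) * bdist \<epsilon> (phase \<epsilon> w) p)"
    using J X by simp
  also have "\<dots> = (\<Sum>p\<in>?S. ennreal (\<epsilon>\<^sup>2) * bdist \<epsilon> (phase \<epsilon> w) (emb \<epsilon> p))"
    using eps by (subst sum.reindex) (auto simp: inj_on_def emb_eq_iff)
  also have "\<dots> = (\<Sum>p\<in>?S. ennreal (\<epsilon> ^ 3 * real (depth ?X p)))"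
  proof (rule sum.cong[OF refl])
    fix p
    obtain q where q: "(q \<in> ?X) \<noteq> (p \<in> ?X)" using opposite_site_exists[OF X] .
    show "ennreal (\<epsilon>\<^sup>2) * bdist \<epsilon> (phase \<epsilon> w) (emb \<epsilon> p) = ennreal (\<epsilon> ^ 3 * real (depth ?X p))"
      unfolding phase_emb bdist_emb[OF eps q] using eps
      by (simp add: power2_eq_square power3_eq_cube mult.assoc flip: ennreal_mult)
  qed
  also have "\<dots> = ennreal (\<epsilon> ^ 3 * D)"
    using eps by (simp add: sum_ennreal D_def sum_distrib_left)
  finally have dissipation: "(\<Sum>\<^sub>\<infinity>p\<in>phase \<epsilon> u - phase \<epsilon> w \<union> (phase \<epsilon> w - phase \<epsilon> u). ennreal (\<epsilon>\<^sup>2) * bdist \<epsilon> (phase \<epsilon> w) p)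
     = ennreal (\<epsilon> ^ 3 * D)" .
  have "functional k (\<zeta> * \<epsilon>) \<gamma> \<epsilon> u w
    = ennreal (\<epsilon> * E) + ennreal (1 / (\<zeta> * \<epsilon>)) * (ennreal (\<epsilon> ^ 3 * D) + ennreal (\<epsilon> powr \<gamma> * ?d))"
    unfolding functional_def energy dissipation surf_emb card_emb[OF eps] ..
  also have "\<dots> = ennreal (\<epsilon> * E + 1 / (\<zeta> * \<epsilon>) * (\<epsilon> ^ 3 * D + \<epsilon> powr \<gamma> * ?d))"
    using eps zeta E0 D0 by (simp flip: ennreal_plus ennreal_mult)
  also have "\<epsilon> * E + 1 / (\<zeta> * \<epsilon>) * (\<epsilon> ^ 3 * D + \<epsilon> powr \<gamma> * ?d)
     = \<epsilon> * (E + \<epsilon> / \<zeta> * D + \<epsilon> powr (\<gamma> - 2) / \<zeta> * ?d)"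
  proof -
    have "\<epsilon> powr \<gamma> = \<epsilon>\<^sup>2 * \<epsilon> powr (\<gamma> - 2)"
      using eps by (simp add: powr_diff powr_numeral)
    then show ?thesis using eps zeta by (simp add: field_simps power2_eq_square power3_eq_cube)
  qed
  finally show ?thesis unfolding E_def D_def .
qed

section \<open>Corner sites and minimizers\<close>

context int_octagon begin

text \<open>Just outside a diagonal side, within the bounding box, each site has two neighbours in the octagon. A
  side of zero length contributes no site, since its line then misses the box.\<close>

definition corners :: "(int \<times> int) set" where
  "corners = {(x, y). a1 \<le> x \<and> x \<le> b1 \<and> a2 \<le> y \<and> y \<le> b2 \<and>
     (x + y = a1 + a2 + s1 - 1 \<or> x - y = a1 - b2 + s2 - 1 \<or> x + y = b1 + b2 - s3 + 1 \<or> x - y = b1 - a2 - s4 + 1)}"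

lemma finite_corners: "finite corners"
  by (rule finite_subset[of _ "{a1..b1} \<times> {a2..b2}"]) (auto simp: corners_def)

lemma card_corners: "s1 + s2 + s3 + s4 \<le> int (card corners)"
proof -
  let ?Q1 = "(\<lambda>j. (a1 + j, a2 + s1 - 1 - j)) ` {0..<s1}"
  let ?Q2 = "(\<lambda>j. (a1 + j, b2 - s2 + 1 + j)) ` {0..<s2}"
  let ?Q3 = "(\<lambda>j. (b1 - j, b2 - s3 + 1 + j)) ` {0..<s3}"
  let ?Q4 = "(\<lambda>j. (b1 - j, a2 + s4 - 1 - j)) ` {0..<s4}"
  have card: "int (card ?Q1) = s1" "int (card ?Q2) = s2" "int (card ?Q3) = s3" "int (card ?Q4) = s4"
    using cut_nonneg by (subst card_image; auto simp: inj_on_def)+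
  have sub: "?Q1 \<union> ?Q2 \<union> ?Q3 \<union> ?Q4 \<subseteq> corners"
    using cut_nonneg side_nonempty by (auto simp: corners_def)
  have "?Q1 \<inter> ?Q2 = {}" using side_nonempty by auto
  moreover have "(?Q1 \<union> ?Q2) \<inter> ?Q3 = {}" using cut_nonneg side_nonempty by auto
  moreover have "(?Q1 \<union> ?Q2 \<union> ?Q3) \<inter> ?Q4 = {}" using cut_nonneg side_nonempty by auto
  ultimately have "card (?Q1 \<union> ?Q2 \<union> ?Q3 \<union> ?Q4) = card ?Q1 + card ?Q2 + card ?Q3 + card ?Q4"
    by (simp add: card_Un_disjoint)
  moreover have "card (?Q1 \<union> ?Q2 \<union> ?Q3 \<union> ?Q4) \<le> card corners"
    by (rule card_mono[OF finite_corners sub])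
  ultimately show ?thesis using card by linarith
qed

text \<open>The chains of corner sites along different diagonal sides are separated by the axis-parallel sides, and
  consecutive sites of one chain differ in both coordinates.\<close>

lemma corner_neighbours:
  assumes "(x, y) \<in> corners"
  shows "(x, y) \<notin> X" "((x - 1, y) \<in> X) \<noteq> ((x + 1, y) \<in> X)" "((x, y - 1) \<in> X) \<noteq> ((x, y + 1) \<in> X)"
    "(x + 1, y) \<notin> corners" "(x, y + 1) \<notin> corners"
proof -
  have box: "a1 \<le> x" "x \<le> b1" "a2 \<le> y" "y \<le> b2" using assms by (auto simp: corners_def)
  consider "x + y = a1 + a2 + s1 - 1" | "x - y = a1 - b2 + s2 - 1" | "x + y = b1 + b2 - s3 + 1" | "x - y = b1 - a2 - s4 + 1"
    using assms by (auto simp: corners_def)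
  note c = this
  show "(x, y) \<notin> X" using c by cases (auto simp: oct_mem)
  show "((x - 1, y) \<in> X) \<noteq> ((x + 1, y) \<in> X)"
    using c by cases (use box cut_nonneg side_nonempty in \<open>auto simp: oct_mem\<close>)
  show "((x, y - 1) \<in> X) \<noteq> ((x, y + 1) \<in> X)"
    using c by cases (use box cut_nonneg side_nonempty in \<open>auto simp: oct_mem\<close>)
  show "(x + 1, y) \<notin> corners" "(x, y + 1) \<notin> corners"
    using c by (cases; use box cut_nonneg side_nonempty in \<open>auto simp: corners_def\<close>)+
qed

lemma line_convex_X: "line_convex X"
  unfolding line_convex_def by (intro conjI allI impI) (elim conjE, simp add: oct_mem)+

lemma rows_columns: "fst ` X = {a1..b1}" "snd ` X = {a2..b2}"
proof -
  have "\<exists>y. (x, y) \<in> X" if "a1 \<le> x" "x \<le> b1" for x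
    using that cut_nonneg side_nonempty
    by (intro exI[of _ "max a2 (max (a1 + a2 + s1 - x) (x - b1 + a2 + s4))"]) (auto simp: oct_mem max_def)
  then have "x \<in> fst ` X" if "x \<in> {a1..b1}" for x using that by (metis atLeastAtMost_iff fst_conv imageI)
  then show "fst ` X = {a1..b1}" by (force simp: oct_pts_def)
  have "\<exists>x. (x, y) \<in> X" if "a2 \<le> y" "y \<le> b2" for y
    using that cut_nonneg side_nonempty
    by (intro exI[of _ "max a1 (max (a1 + a2 + s1 - y) (a1 - b2 + s2 + y))"]) (auto simp: oct_mem max_def)
  then have "y \<in> snd ` X" if "y \<in> {a2..b2}" for y using that by (metis atLeastAtMost_iff snd_conv imageI)
  then show "snd ` X = {a2..b2}" by (force simp: oct_pts_def)
qed

lemma corner_sites_emb: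
  assumes eps: "0 < \<epsilon>"
  shows "card corners \<le> card (corner_sites \<epsilon> (emb \<epsilon> ` X))"
proof -
  have mem: "emb \<epsilon> z \<in> emb \<epsilon> ` S \<longleftrightarrow> z \<in> S" for z S
    using eps by (intro inj_image_mem_iff emb_inj) simp
  have nbrs: "nbrs \<epsilon> (emb \<epsilon> z) = emb \<epsilon> ` {(fst z + 1, snd z), (fst z - 1, snd z), (fst z, snd z + 1), (fst z, snd z - 1)}" for z
    by (simp add: nbrs_def emb_def algebra_simps)
  have "finite (corner_sites \<epsilon> (emb \<epsilon> ` X))"
  proof (rule finite_subset)
    show "corner_sites \<epsilon> (emb \<epsilon> ` X) \<subseteq> (\<Union>p\<in>emb \<epsilon> ` X. nbrs \<epsilon> p)"
    proof
      fix p assume "p \<in> corner_sites \<epsilon> (emb \<epsilon> ` X)"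
      then obtain q where q: "q \<in> nbrs \<epsilon> p" "q \<in> emb \<epsilon> ` X" unfolding corner_sites_def outer_bd_def by blast
      then have "p \<in> nbrs \<epsilon> q" by (auto simp: nbrs_def)
      with q(2) show "p \<in> (\<Union>p\<in>emb \<epsilon> ` X. nbrs \<epsilon> p)" by blast
    qed
    show "finite (\<Union>p\<in>emb \<epsilon> ` X. nbrs \<epsilon> p)" using finite_X by (auto simp: nbrs_def)
  qed
  moreover have "emb \<epsilon> ` corners \<subseteq> corner_sites \<epsilon> (emb \<epsilon> ` X)"
  proof
    fix p assume "p \<in> emb \<epsilon> ` corners"
    then obtain x y where xy: "(x, y) \<in> corners" "p = emb \<epsilon> (x, y)" by auto
    let ?N = "{(x + 1, y), (x - 1, y), (x, y + 1), (x, y - 1)}"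
    have "nbrs \<epsilon> p \<inter> emb \<epsilon> ` X = emb \<epsilon> ` (?N \<inter> X)"
      unfolding xy(2) nbrs using eps by (simp add: image_Int emb_inj)
    moreover have "card (?N \<inter> X) = 2"
      using corner_neighbours(2,3)[OF xy(1)]
      by (cases "(x - 1, y) \<in> X"; cases "(x, y - 1) \<in> X") (auto simp: Int_insert_left)
    ultimately have "card (nbrs \<epsilon> p \<inter> emb \<epsilon> ` X) = 2" using card_emb[OF eps] by simp
    moreover from this have "nbrs \<epsilon> p \<inter> emb \<epsilon> ` X \<noteq> {}" by auto
    moreover have "p \<in> grid \<epsilon> - emb \<epsilon> ` X" using corner_neighbours(1)[OF xy(1)] by (simp add: xy(2) grid_eq mem)
    ultimately show "p \<in> corner_sites \<epsilon> (emb \<epsilon> ` X)" unfolding corner_sites_def outer_bd_def by blast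
  qed
  ultimately show ?thesis using card_mono card_emb[OF eps] by metis
qed

end

text \<open>The spin field with phase \<open>J\<close> and particles on \<open>Z\<close>, the competitor in the minimality argument.\<close>

definition place :: "real \<Rightarrow> (int \<times> int) set \<Rightarrow> (int \<times> int) set \<Rightarrow> point \<Rightarrow> real" where
  "place \<epsilon> J Z = (\<lambda>p\<in>grid \<epsilon>. if p \<in> emb \<epsilon> ` J then 1 else if p \<in> emb \<epsilon> ` Z then 0 else -1)"

lemma place_emb:
  assumes "0 < \<epsilon>"
  shows "place \<epsilon> J Z (emb \<epsilon> z) = (if z \<in> J then 1 else if z \<in> Z then 0 else -1)"
proof -
  have "emb \<epsilon> z \<in> emb \<epsilon> ` S \<longleftrightarrow> z \<in> S" for S
    using assms by (intro inj_image_mem_iff emb_inj) simp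
  then show ?thesis by (simp add: place_def grid_eq)
qed

lemma sites_place:
  assumes "0 < \<epsilon>" "Z \<inter> J = {}"
  shows "sites \<epsilon> (place \<epsilon> J Z) 1 = J" "sites \<epsilon> (place \<epsilon> J Z) 0 = Z"
  using assms by (auto simp: sites_def place_emb)

lemma admissible_place:
  assumes "0 < \<epsilon>" "finite Z"
  shows "place \<epsilon> J Z \<in> admissible \<epsilon>"
proof -
  have "{p \<in> grid \<epsilon>. place \<epsilon> J Z p = 0} \<subseteq> emb \<epsilon> ` Z"
    by (auto simp: place_def split: if_splits)
  then have "finite {p \<in> grid \<epsilon>. place \<epsilon> J Z p = 0}" using assms(2) finite_subset by blast
  then show ?thesis by (auto simp: admissible_def place_def)
qed

lemma finite_box:
  assumes "finite (S :: (int \<times> int) set)"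
  obtains M where "\<And>M' x y. M \<le> M' \<Longrightarrow> \<bar>x\<bar> \<ge> M' \<or> \<bar>y\<bar> \<ge> M' \<Longrightarrow> (x, y) \<notin> S"
proof
  fix M' x y :: int
  assume M: "(\<Sum>z\<in>S. \<bar>fst z\<bar> + \<bar>snd z\<bar>) + 1 \<le> M'" and xy: "\<bar>x\<bar> \<ge> M' \<or> \<bar>y\<bar> \<ge> M'"
  show "(x, y) \<notin> S"
  proof
    assume "(x, y) \<in> S"
    from member_le_sum[OF this, of "\<lambda>z. \<bar>fst z\<bar> + \<bar>snd z\<bar>"] assms have "\<bar>x\<bar> + \<bar>y\<bar> \<le> (\<Sum>z\<in>S. \<bar>fst z\<bar> + \<bar>snd z\<bar>)"
      by simp
    with M xy show False by linarith
  qed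
qed

lemma lattice_energy_nonneg:
  assumes "k < 1" "\<And>z. v z \<in> {1, -1, 0}"
  shows "0 \<le> lattice_energy k v M"
  unfolding lattice_energy_def line_energy_def
  by (intro add_nonneg_nonneg sum_nonneg bond_energy_nonneg assms)

context int_octagon begin

lemma removal_cost_split:
  "removal_cost \<kappa> D pts ({True} \<times> R \<union> {False} \<times> C)
    = \<kappa> * (\<Sum>p\<in>\<Union>(pts ` ({True} \<times> R \<union> {False} \<times> C)). D p) - 4 * (real (card R) + real (card C))"
  if "finite R" "finite C" for R C :: "int set"
  using that by (subst removal_cost_def, subst card_Un_disjoint) (auto simp: card_cartesian_product)

text \<open>In units of \<open>\<epsilon>\<close>, the functional of any \<open>u\<close> is at least a constant plus the removal cost of the lines of \<open>X\<close> that its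
  phase misses, plus the dissipation of all other sites that changed, minus \<open>4 * k\<close> per particle. The set
  \<open>J0\<close> with particles on corner sites outside \<open>X\<close>, where they cost no dissipation, attains this bound
  with the least removal cost. Hence for a minimizer all excess terms vanish: the missed lines form an
  optimal removal, and no other site changed. Additional particles do not pay, because their penalty
  exceeds the \<open>4 * k\<close> that each of them could gain.\<close>

lemma minimizer_removes_optimal_lines:
  fixes u w :: "point \<Rightarrow> real"
  assumes eps: "0 < \<epsilon>" and zeta: "0 < \<zeta>" and k: "0 < k" "k < 1"
    and w: "sites \<epsilon> w 1 = X"
    and min: "minimizer k (\<zeta> * \<epsilon>) \<gamma> \<epsilon> w u"
    and surf_rigid: "4 * k < \<epsilon> powr (\<gamma> - 2) / \<zeta>"
    and opt: "weighted_lines.optimal lines (grid_line X) (\<lambda>p. real (depth X p)) (\<epsilon> / \<zeta>) T0"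
    and J0: "J0 = X - \<Union>(grid_line X ` T0)" "line_convex J0"
      "fst ` J0 = {x \<in> {a1..b1}. (False, x) \<notin> T0}" "snd ` J0 = {y \<in> {a2..b2}. (True, y) \<notin> T0}"
    and Z: "finite Z" "Z \<inter> X = {}" "card Z = card (sites \<epsilon> w 0)"
      "\<And>x y. (x, y) \<in> Z \<Longrightarrow> ((x - 1, y) \<in> J0) \<noteq> ((x + 1, y) \<in> J0) \<and> ((x, y - 1) \<in> J0) \<noteq> ((x, y + 1) \<in> J0)"
      "\<And>x y. (x, y) \<in> Z \<Longrightarrow> (x + 1, y) \<notin> Z \<and> (x, y + 1) \<notin> Z"
  obtains T where "weighted_lines.optimal lines (grid_line X) (\<lambda>p. real (depth X p)) (\<epsilon> / \<zeta>) T"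
    "sites \<epsilon> u 1 = X - \<Union>(grid_line X ` T)"
proof -
  define \<kappa> where "\<kappa> = \<epsilon> / \<zeta>"
  have kappa: "0 < \<kappa>" using eps zeta by (simp add: \<kappa>_def)
  interpret weighted_lines lines "grid_line X" "\<lambda>p. real (depth X p)" \<kappa>
    by (rule weighted_lines_grid[OF kappa])
  let ?cost = "removal_cost \<kappa> (\<lambda>p. real (depth X p)) (grid_line X)"
  have opt: "optimal T0" using opt unfolding \<kappa>_def .
  have T0L: "T0 \<subseteq> lines" using opt by (simp add: optimal_def)
  define u0 where "u0 = place \<epsilon> J0 Z"
  have ZJ0: "Z \<inter> J0 = {}" using Z(2) J0(1) by blast
  note u0_sites = sites_place[OF eps ZJ0, folded u0_def]
  have u0_emb: "u0 (emb \<epsilon> z) = (if z \<in> J0 then 1 else if z \<in> Z then 0 else -1)" for z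
    unfolding u0_def by (rule place_emb[OF eps])
  have u0_adm: "u0 \<in> admissible \<epsilon>" unfolding u0_def by (rule admissible_place[OF eps Z(1)])
  have u_adm: "u \<in> admissible \<epsilon>" and le: "functional k (\<zeta> * \<epsilon>) \<gamma> \<epsilon> u w \<le> functional k (\<zeta> * \<epsilon>) \<gamma> \<epsilon> u0 w"
    using min u0_adm unfolding minimizer_def is_arg_min_linorder by auto
  have Xne: "X \<noteq> {}" using cut_nonneg side_nonempty oct_mem[of "a1 + s1" a2] by force
  have X_fin: "finite (sites \<epsilon> w 1)" "sites \<epsilon> w 1 \<noteq> {}" using Xne finite_X by (auto simp: w)
  have J0_fin: "finite J0" using J0(1) finite_X by simp
  obtain M0 where M0: "\<And>M' x y. M0 \<le> M' \<Longrightarrow> \<bar>x\<bar> \<ge> M' \<or> \<bar>y\<bar> \<ge> M' \<Longrightarrow> (x, y) \<notin> J0 \<union> Z"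
    using finite_box[of "J0 \<union> Z"] J0_fin Z(1) by blast
  have out0: "u0 (emb \<epsilon> (x, y)) = -1" if "M0 \<le> M'" "\<bar>x\<bar> \<ge> M' \<or> \<bar>y\<bar> \<ge> M'" for M' x y
    using M0[OF that] by (simp add: u0_emb)
  have "functional k (\<zeta> * \<epsilon>) \<gamma> \<epsilon> u0 w < \<infinity>"
    by (subst functional_emb[OF eps zeta k(2) u0_adm X_fin out0[OF order_refl]]) auto
  then have "functional k (\<zeta> * \<epsilon>) \<gamma> \<epsilon> u w < \<infinity>" using le by (rule order.strict_trans1[rotated])
  then have J_fin: "finite (sites \<epsilon> u 1)" using eps zeta by (intro finite_phase[OF eps _ X_fin]) auto
  have Zu_fin: "finite (sites \<epsilon> u 0)" and u_val: "\<And>z. u (emb \<epsilon> z) \<in> {1, -1, 0}"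
    using admissible_sites[OF eps u_adm] by auto
  obtain M1 where M1: "\<And>M' x y. M1 \<le> M' \<Longrightarrow> \<bar>x\<bar> \<ge> M' \<or> \<bar>y\<bar> \<ge> M' \<Longrightarrow> (x, y) \<notin> sites \<epsilon> u 1 \<union> sites \<epsilon> u 0"
    using finite_box[of "sites \<epsilon> u 1 \<union> sites \<epsilon> u 0"] J_fin Zu_fin by blast
  \<comment> \<open>one box outside which both competitors equal -1\<close>
  define M where "M = max M0 M1"
  have out_u0: "u0 (emb \<epsilon> (x, y)) = -1" if "\<bar>x\<bar> \<ge> M \<or> \<bar>y\<bar> \<ge> M" for x y
    by (rule out0[OF _ that]) (simp add: M_def)
  have out_u: "u (emb \<epsilon> (x, y)) = -1" if "\<bar>x\<bar> \<ge> M \<or> \<bar>y\<bar> \<ge> M" for x y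
  proof -
    have "(x, y) \<notin> sites \<epsilon> u 1 \<union> sites \<epsilon> u 0" by (rule M1[OF _ that]) (simp add: M_def)
    then show ?thesis using u_val[of "(x, y)"] by (auto simp: sites_def)
  qed
  define J m C \<rho> where "J = sites \<epsilon> u 1" and "m = real (card (sites \<epsilon> u 0))" and "C = real (card (sites \<epsilon> w 0))"
    and "\<rho> = \<epsilon> powr (\<gamma> - 2) / \<zeta>"
  define S where "S = (J - X) \<union> (X - J)"
  define Eu where "Eu = lattice_energy k (\<lambda>z. u (emb \<epsilon> z)) M"
  define E0 where "E0 = lattice_energy k (\<lambda>z. u0 (emb \<epsilon> z)) M"
  have Fu: "functional k (\<zeta> * \<epsilon>) \<gamma> \<epsilon> u w
      = ennreal (\<epsilon> * (Eu + \<kappa> * (\<Sum>p\<in>S. real (depth X p)) + \<rho> * \<bar>m - C\<bar>))"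
    unfolding S_def J_def m_def C_def \<rho>_def \<kappa>_def Eu_def w[symmetric]
    by (rule functional_emb[OF eps zeta k(2) u_adm X_fin]) (rule out_u)
  have S0: "(J0 - X) \<union> (X - J0) = \<Union>(grid_line X ` T0)"
    unfolding J0(1) by (auto simp: grid_line_def)
  have "functional k (\<zeta> * \<epsilon>) \<gamma> \<epsilon> u0 w = ennreal (\<epsilon> * (E0
      + \<kappa> * (\<Sum>p\<in>(sites \<epsilon> u0 1 - sites \<epsilon> w 1) \<union> (sites \<epsilon> w 1 - sites \<epsilon> u0 1). real (depth (sites \<epsilon> w 1) p))
      + \<rho> * \<bar>real (card (sites \<epsilon> u0 0)) - real (card (sites \<epsilon> w 0))\<bar>))"
    unfolding E0_def \<kappa>_def \<rho>_def
    by (rule functional_emb[OF eps zeta k(2) u0_adm X_fin]) (rule out_u0)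
  then have Fu0: "functional k (\<zeta> * \<epsilon>) \<gamma> \<epsilon> u0 w
      = ennreal (\<epsilon> * (E0 + \<kappa> * (\<Sum>p\<in>\<Union>(grid_line X ` T0). real (depth X p))))"
    unfolding u0_sites w S0 Z(3) by simp
  have "0 \<le> E0" unfolding E0_def by (rule lattice_energy_nonneg[OF k(2)]) (simp add: u0_emb)
  then have "0 \<le> \<epsilon> * (E0 + \<kappa> * (\<Sum>p\<in>\<Union>(grid_line X ` T0). real (depth X p)))"
    using eps kappa by (intro mult_nonneg_nonneg add_nonneg_nonneg sum_nonneg) auto
  with le have compare: "Eu + \<kappa> * (\<Sum>p\<in>S. real (depth X p)) + \<rho> * \<bar>m - C\<bar>
      \<le> E0 + \<kappa> * (\<Sum>p\<in>\<Union>(grid_line X ` T0). real (depth X p))"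
    unfolding Fu Fu0 using eps by (simp add: ennreal_le_iff)
  define R0 C0 where "R0 = {y \<in> {a2..b2}. (True, y) \<in> T0}" and "C0 = {x \<in> {a1..b1}. (False, x) \<in> T0}"
  define R1 C1 where "R1 = {y \<in> {a2..b2}. y \<notin> snd ` J}" and "C1 = {x \<in> {a1..b1}. x \<notin> fst ` J}"
  define T where "T = {True} \<times> R1 \<union> {False} \<times> C1"
  \<comment> \<open>the energy bound for a phase that meets every row and column of X\<close>
  define base where "base = 4 * (real (card {a1..b1}) + real (card {a2..b2}))"
  have fins: "finite R0" "finite C0" "finite R1" "finite C1"
    unfolding R0_def C0_def R1_def C1_def by (rule finite_subset[OF Collect_restrict], simp)+
  have card_split: "real (card A) = real (card {x \<in> A. P x}) + real (card {x \<in> A. \<not> P x})" if "finite A" for A :: "int set" and P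
  proof -
    have "card A = card ({x \<in> A. P x} \<union> {x \<in> A. \<not> P x})" by (rule arg_cong[where f=card]) auto
    also have "\<dots> = card {x \<in> A. P x} + card {x \<in> A. \<not> P x}" using that by (intro card_Un_disjoint) auto
    finally show ?thesis by simp
  qed
  have E0_eq: "E0 = base - 4 * (real (card R0) + real (card C0)) - 4 * k * C"
  proof -
    have "E0 = 4 * real (card (fst ` {p. u0 (emb \<epsilon> p) = 1}) + card (snd ` {p. u0 (emb \<epsilon> p) = 1}))
           - 4 * k * real (card {p. u0 (emb \<epsilon> p) = 0})"
      unfolding E0_def
    proof (rule lattice_energy_corners[where v="\<lambda>z. u0 (emb \<epsilon> z)" and M=M])
      show "\<bar>x\<bar> \<ge> M \<or> \<bar>y\<bar> \<ge> M \<Longrightarrow> u0 (emb \<epsilon> (x, y)) = -1" for x y by (rule out_u0)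
      show "line_convex {p. u0 (emb \<epsilon> p) = 1}" using J0(2) by (simp add: u0_emb)
    qed (use Z(4,5) in \<open>auto simp: u0_emb split: if_splits\<close>)
    also have "{p. u0 (emb \<epsilon> p) = 1} = J0" using u0_sites(1) by (simp add: sites_def)
    also have "{p. u0 (emb \<epsilon> p) = 0} = Z" using u0_sites(2) by (simp add: sites_def)
    finally show ?thesis
      using card_split[of "{a1..b1}" "\<lambda>x. (False, x) \<in> T0"] card_split[of "{a2..b2}" "\<lambda>y. (True, y) \<in> T0"]
      unfolding J0(3,4) base_def R0_def C0_def C_def Z(3) by simp
  qed
  have Eu_ge: "base - 4 * (real (card R1) + real (card C1)) - 4 * k * m \<le> Eu"
  proof -
    have "4 * real (card (fst ` {p. u (emb \<epsilon> p) = 1}) + card (snd ` {p. u (emb \<epsilon> p) = 1}))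
           - 4 * k * real (card {p. u (emb \<epsilon> p) = 0}) \<le> Eu"
      unfolding Eu_def using out_u by (intro lattice_energy_ge[OF k(1) u_val]) auto
    then have "4 * (real (card (fst ` J)) + real (card (snd ` J))) - 4 * k * m \<le> Eu"
      by (simp add: J_def m_def sites_def)
    moreover have "card {x \<in> {a1..b1}. x \<in> fst ` J} \<le> card (fst ` J)" "card {y \<in> {a2..b2}. y \<in> snd ` J} \<le> card (snd ` J)"
      using J_fin by (auto intro!: card_mono simp: J_def)
    ultimately show ?thesis
      using card_split[of "{a1..b1}" "\<lambda>x. x \<in> fst ` J"] card_split[of "{a2..b2}" "\<lambda>y. y \<in> snd ` J"]
      unfolding base_def R1_def C1_def by simp
  qed
  have T0_eq: "T0 = {True} \<times> R0 \<union> {False} \<times> C0"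
    using T0L unfolding R0_def C0_def lines_def by auto
  have cost0: "?cost T0 = \<kappa> * (\<Sum>p\<in>\<Union>(grid_line X ` T0). real (depth X p)) - 4 * (real (card R0) + real (card C0))"
    using removal_cost_split[OF fins(1,2), where \<kappa>=\<kappa> and D="\<lambda>p. real (depth X p)" and pts="grid_line X"] unfolding T0_eq .
  have cost: "?cost T = \<kappa> * (\<Sum>p\<in>\<Union>(grid_line X ` T). real (depth X p)) - 4 * (real (card R1) + real (card C1))"
    using removal_cost_split[OF fins(3,4), where \<kappa>=\<kappa> and D="\<lambda>p. real (depth X p)" and pts="grid_line X"] unfolding T_def .
  have TL: "T \<subseteq> lines" unfolding T_def R1_def C1_def lines_def by auto
  have T_sub: "\<Union>(grid_line X ` T) \<subseteq> X - J"
  proof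
    fix z assume "z \<in> \<Union>(grid_line X ` T)"
    then have "z \<in> X" "snd z \<in> R1 \<or> fst z \<in> C1" unfolding mem_grid_lines T_def by auto
    then show "z \<in> X - J" unfolding R1_def C1_def by auto
  qed
  \<comment> \<open>changed sites outside the missed lines\<close>
  define rest where "rest = S - \<Union>(grid_line X ` T)"
  have S_fin: "finite S" using J_fin finite_X by (simp add: S_def J_def)
  have "(\<Sum>p\<in>S. real (depth X p)) = (\<Sum>p\<in>\<Union>(grid_line X ` T). real (depth X p)) + (\<Sum>p\<in>rest. real (depth X p))"
    unfolding rest_def using S_fin T_sub by (subst sum.subset_diff[of "\<Union>(grid_line X ` T)" S]) (auto simp: S_def)
  then have "?cost T + \<kappa> * (\<Sum>p\<in>rest. real (depth X p)) + (\<rho> * \<bar>m - C\<bar> - 4 * k * (m - C)) \<le> ?cost T0"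
    using compare Eu_ge E0_eq cost cost0 by (simp add: algebra_simps)
  moreover have "4 * k * (m - C) \<le> \<rho> * \<bar>m - C\<bar>"
  proof -
    have "4 * k * (m - C) \<le> 4 * k * \<bar>m - C\<bar>" using k by (intro mult_left_mono) auto
    also have "\<dots> \<le> \<rho> * \<bar>m - C\<bar>" using surf_rigid by (intro mult_right_mono) (auto simp: \<rho>_def)
    finally show ?thesis .
  qed
  ultimately have bound: "?cost T + \<kappa> * (\<Sum>p\<in>rest. real (depth X p)) \<le> ?cost T0" by linarith
  have cost_min: "?cost T0 \<le> ?cost T'" if "T' \<subseteq> lines" for T' using opt that by (simp add: optimal_def)
  have "\<kappa> * (\<Sum>p\<in>rest. real (depth X p)) \<le> 0" using bound cost_min[OF TL] by linarith
  then have rest0: "(\<Sum>p\<in>rest. real (depth X p)) \<le> 0" using kappa by (simp add: mult_le_0_iff)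
  have "rest = {}"
  proof (rule ccontr)
    assume "rest \<noteq> {}"
    have "1 \<le> depth X p" for p
      using opposite_site_exists[OF finite_X Xne, of p] depth_pos by metis
    then have "0 < (\<Sum>p\<in>rest. real (depth X p))"
      using \<open>rest \<noteq> {}\<close> S_fin by (intro sum_pos) (auto simp: rest_def Suc_le_eq)
    with rest0 show False by linarith
  qed
  then have "S \<subseteq> \<Union>(grid_line X ` T)" by (simp add: rest_def)
  with T_sub have "J = X - \<Union>(grid_line X ` T)" unfolding S_def by blast
  moreover have "optimal T"
    unfolding optimal_def
  proof (intro conjI allI impI TL)
    fix T' assume "T' \<subseteq> lines"
    moreover have "0 \<le> \<kappa> * (\<Sum>p\<in>rest. real (depth X p))" using kappa by (intro mult_nonneg_nonneg sum_nonneg) auto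
    ultimately show "?cost T \<le> ?cost T'" using bound cost_min[of T'] by linarith
  qed
  ultimately show thesis using that unfolding J_def \<kappa>_def by blast
qed

end

section \<open>Displacements and the limit of small scales\<close>

text \<open>The conclusion about one time step from \<open>I\<close> to \<open>J\<close>, with \<open>n\<close> particles and error constant \<open>c\<close>.\<close>

definition crystalline_step :: "real \<Rightarrow> real \<Rightarrow> real \<Rightarrow> nat \<Rightarrow> point set \<Rightarrow> point set \<Rightarrow> bool" where
  "crystalline_step \<epsilon> \<zeta> c n I J \<longleftrightarrow> discrete_octagon \<epsilon> J \<and> J \<subseteq> I \<and> card (corner_sites \<epsilon> J) \<ge> n + 2 \<and>
    (\<forall>i\<in>{1..4}. diag_len \<epsilon> J i > 0 \<longrightarrow> diag_seg \<epsilon> J i \<subseteq> diag_seg \<epsilon> I i) \<and>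
    (\<forall>i\<in>{1..4}. diag_len \<epsilon> I i = 0 \<longrightarrow> diag_len \<epsilon> J i = 0) \<and>
    (\<forall>i\<in>{1..4}. if infdist (4 * \<zeta> / axis_len \<epsilon> I i) (real ` {1..}) \<ge> c * \<epsilon>
       then displacement \<epsilon> I J i = real_of_int \<lfloor>4 * \<zeta> / axis_len \<epsilon> I i\<rfloor>
       else displacement \<epsilon> I J i \<in>
         {real_of_int (round (4 * \<zeta> / axis_len \<epsilon> I i) - 1), real_of_int (round (4 * \<zeta> / axis_len \<epsilon> I i))})"

lemma infdist_ge_iff_naturals:
  fixes x d :: real
  shows "infdist x (real ` {1..}) \<ge> d \<longleftrightarrow> (\<forall>n\<ge>1. d \<le> \<bar>x - real n\<bar>)"
proof
  assume *: "infdist x (real ` {1..}) \<ge> d"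
  show "\<forall>n\<ge>1. d \<le> \<bar>x - real n\<bar>"
  proof (intro allI impI)
    fix n :: nat assume "1 \<le> n"
    then have "infdist x (real ` {1..}) \<le> dist x (real n)" by (intro infdist_le) auto
    with * show "d \<le> \<bar>x - real n\<bar>" by (simp add: dist_real_def)
  qed
next
  assume *: "\<forall>n\<ge>1. d \<le> \<bar>x - real n\<bar>"
  have "d \<le> (INF a\<in>real ` {1..}. dist x a)"
    by (rule cINF_greatest) (use * in \<open>auto simp: dist_real_def\<close>)
  then show "infdist x (real ` {1..}) \<ge> d" by (subst infdist_notempty) auto
qed

text \<open>If \<open>a\<close> is the integer part of \<open>x\<close> up to an error \<open>d\<close> on both sides, then only the passage of \<open>x\<close>
  across a positive integer can make a difference.\<close>

lemma almost_floor:
  fixes x d :: real and a :: nat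
  assumes "real a < x + d" "x - d < real a + 1" "d \<le> 1/4" "0 \<le> x"
  shows "if infdist x (real ` {1..}) \<ge> d then real a = real_of_int \<lfloor>x\<rfloor>
     else real a \<in> {real_of_int (round x - 1), real_of_int (round x)}"
proof (cases "infdist x (real ` {1..}) \<ge> d")
  case True
  then have far: "d \<le> \<bar>x - real n\<bar>" if "1 \<le> n" for n using that unfolding infdist_ge_iff_naturals by blast
  have "real a \<le> x"
  proof (rule ccontr)
    assume "\<not> real a \<le> x"
    moreover from this assms(4) have "1 \<le> a" by (cases a) auto
    ultimately show False using far[of a] assms(1) by auto
  qed
  moreover have "x < real a + 1"
  proof (rule ccontr)
    assume "\<not> x < real a + 1"
    then show False using far[of "a + 1"] assms(2) by auto
  qed
  ultimately have "\<lfloor>x\<rfloor> = int a" by (intro floor_unique) auto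
  then show ?thesis using True by simp
next
  case False
  then obtain n :: nat where n: "1 \<le> n" "\<bar>x - real n\<bar> < d" unfolding infdist_ge_iff_naturals by auto
  have "round x = int n" using n(2) assms(3) by (intro round_unique') auto
  moreover have "real a < real n + 1" "real n < real a + 2" using n(2) assms by linarith+
  then have "a \<le> n" "n \<le> a + 1" by linarith+
  then have "int a = int n - 1 \<or> int a = int n" by linarith
  then have "real a = real_of_int (int n - 1) \<or> real a = real_of_int (int n)" by auto
  ultimately show ?thesis using False by auto
qed

context int_octagon begin

text \<open>At scale \<open>\<epsilon>\<close>, with sides of length at least \<open>b\<close>, the bounded errors in the number of points become
  errors of order \<open>\<epsilon>\<close> in \<open>4 * \<zeta> / P\<close>, with a factor that depends only on \<open>b\<close> and \<open>t0\<close>.\<close>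

theorem optimal_shape:
  fixes \<epsilon> \<zeta> b :: real and t0 :: nat
  assumes eps: "0 < \<epsilon>" and zeta: "0 < \<zeta>" and b: "0 < b"
    and sides: "\<And>j. j \<in> {1..4} \<Longrightarrow> b \<le> \<epsilon> * real_of_int (len j)"
    and t0: "1 \<le> t0" "16 * \<zeta> < real t0 * b"
    and small: "8 * real t0 ^ 2 * \<epsilon> < b" "6 * real t0 ^ 2 * \<epsilon> < 8 * \<zeta>"
    and opt: "weighted_lines.optimal lines (grid_line X) (\<lambda>p. real (depth X p)) (\<epsilon> / \<zeta>) T"
  obtains \<alpha> :: "nat \<Rightarrow> nat" where
    "\<And>i j. i \<in> {1..4} \<Longrightarrow> j \<in> {1..4} \<Longrightarrow> 2 * int (\<alpha> j) < len i"
    "\<And>i. i \<in> {1..4} \<Longrightarrow> real (\<alpha> i) < 4 * \<zeta> / (\<epsilon> * real_of_int (len i)) + 8 * real (t0 + 1) ^ 2 / b * \<epsilon>"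
    "\<And>i. i \<in> {1..4} \<Longrightarrow> 4 * \<zeta> / (\<epsilon> * real_of_int (len i)) - 8 * real (t0 + 1) ^ 2 / b * \<epsilon> < real (\<alpha> i) + 1"
    "T = {side_line i t | i t. i \<in> {1..4} \<and> 1 \<le> t \<and> t \<le> int (\<alpha> i)}"
proof -
  define N where "N = \<lceil>b / \<epsilon>\<rceil>"
  have N: "N \<le> len j" if "j \<in> {1..4}" for j
    using sides[OF that] eps unfolding N_def by (simp add: ceiling_le_iff pos_divide_le_eq mult.commute)
  have N_ge: "b / \<epsilon> \<le> real_of_int N" unfolding N_def by (rule le_of_int_ceiling)
  have kappa: "0 < \<epsilon> / \<zeta>" using eps zeta by simp
  have "8 * real t0 ^ 2 < b / \<epsilon>" using small(1) eps by (simp add: pos_less_divide_eq)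
  with N_ge have "real_of_int (8 * int t0 ^ 2) < real_of_int N" by simp
  then have N_big: "8 * int t0 ^ 2 < N" by (simp only: of_int_less_iff)
  have deep: "8 < \<epsilon> / \<zeta> * (real t0 * (real_of_int N - 6 * real t0))"
  proof -
    \<comment> \<open>t0 b exceeds 16 zeta, and the correction is less than 8 for small scales\<close>
    have "16 - 8 < real t0 * b / \<zeta> - 6 * real t0 ^ 2 * \<epsilon> / \<zeta>"
      using t0(2) small(2) zeta by (intro diff_strict_mono) (simp_all add: pos_less_divide_eq pos_divide_less_eq)
    also have "\<dots> = \<epsilon> / \<zeta> * (real t0 * (b / \<epsilon> - 6 * real t0))"
      using eps zeta by (simp add: field_simps power2_eq_square)
    also have "\<dots> \<le> \<epsilon> / \<zeta> * (real t0 * (real_of_int N - 6 * real t0))"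
      using N_ge kappa by (intro mult_left_mono) auto
    finally show ?thesis by simp
  qed
  obtain \<alpha> where \<alpha>: "\<And>i. i \<in> {1..4} \<Longrightarrow> \<alpha> i \<le> t0"
    "\<And>i. i \<in> {1..4} \<Longrightarrow> \<epsilon> / \<zeta> * real (\<alpha> i) * (real_of_int (len i) - 6 * real t0) \<le> 4"
    "\<And>i. i \<in> {1..4} \<Longrightarrow> 4 \<le> \<epsilon> / \<zeta> * real (\<alpha> i + 1) * (real_of_int (len i) + 2 * real (\<alpha> i))"
    "T = {side_line i (int t) | i t. i \<in> {1..4} \<and> 1 \<le> t \<and> t \<le> \<alpha> i}"
    using optimal_removal[OF kappa N t0(1) N_big deep opt] by blast
  have t0_sq: "int t0 \<le> int t0 ^ 2" using t0(1) by (simp add: power2_eq_square)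
  show thesis
  proof (rule that)
    fix i j :: nat assume "i \<in> {1..4}" "j \<in> {1..4}"
    then show "2 * int (\<alpha> j) < len i" using N[of i] N_big t0_sq \<alpha>(1)[of j] by linarith
  next
    fix i :: nat assume i: "i \<in> {1..4}"
    define P x a where "P = \<epsilon> * real_of_int (len i)" and "x = 4 * \<zeta> / (\<epsilon> * real_of_int (len i))" and "a = real (\<alpha> i)"
    have P: "b \<le> P" "0 < P" using sides[OF i] b by (simp_all add: P_def)
    have a: "0 \<le> a" "a \<le> real t0" using \<alpha>(1)[OF i] by (simp_all add: a_def)
    have "x = 4 * \<zeta> / P" unfolding x_def P_def ..
    then have xP: "x * P = 4 * \<zeta>" using P by simp
    have "8 * real (t0 + 1) ^ 2 * \<epsilon> = 8 * real (t0 + 1) ^ 2 / b * \<epsilon> * b" using b by simp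
    also have "\<dots> \<le> 8 * real (t0 + 1) ^ 2 / b * \<epsilon> * P" using b eps P by (intro mult_left_mono) auto
    finally have slack: "8 * real (t0 + 1) ^ 2 * \<epsilon> \<le> 8 * real (t0 + 1) ^ 2 / b * \<epsilon> * P" .
    \<comment> \<open>the last removed line bounds a from above, the first remaining line from below\<close>
    have "a * (P - 6 * real t0 * \<epsilon>) \<le> 4 * \<zeta>"
      using \<alpha>(2)[OF i] zeta unfolding a_def P_def by (simp add: field_simps)
    then have "a * P \<le> x * P + 6 * real t0 * a * \<epsilon>" unfolding xP by (simp add: algebra_simps)
    also have "\<dots> \<le> x * P + 6 * real t0 * real t0 * \<epsilon>" using a eps by (intro add_left_mono mult_right_mono mult_left_mono) auto
    also have "\<dots> < x * P + 8 * real (t0 + 1) ^ 2 * \<epsilon>"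
    proof -
      have "6 * real t0 * real t0 < 8 * real (t0 + 1) ^ 2" by (simp add: power2_eq_square algebra_simps add_pos_nonneg)
      then show ?thesis using eps by simp
    qed
    also have "\<dots> \<le> x * P + 8 * real (t0 + 1) ^ 2 / b * \<epsilon> * P"
      using slack by simp
    finally have "a * P < (x + 8 * real (t0 + 1) ^ 2 / b * \<epsilon>) * P" by (simp add: algebra_simps)
    then show "real (\<alpha> i) < 4 * \<zeta> / (\<epsilon> * real_of_int (len i)) + 8 * real (t0 + 1) ^ 2 / b * \<epsilon>"
      using P unfolding a_def[symmetric] x_def[symmetric] by simp
    have "4 * \<zeta> \<le> (a + 1) * (P + 2 * a * \<epsilon>)"
      using \<alpha>(3)[OF i] zeta unfolding a_def P_def by (simp add: field_simps)
    then have "x * P \<le> (a + 1) * P + 2 * (a + 1) * a * \<epsilon>" unfolding xP by (simp add: algebra_simps)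
    also have "\<dots> \<le> (a + 1) * P + 2 * real (t0 + 1) * real (t0 + 1) * \<epsilon>"
      using a eps by (intro add_left_mono mult_right_mono mult_mono) auto
    also have "\<dots> < (a + 1) * P + 8 * real (t0 + 1) ^ 2 * \<epsilon>"
    proof -
      have "2 * real (t0 + 1) * real (t0 + 1) < 8 * real (t0 + 1) ^ 2" by (simp add: power2_eq_square)
      then show ?thesis using eps by (metis add_strict_left_mono mult_strict_right_mono)
    qed
    also have "\<dots> \<le> (a + 1) * P + 8 * real (t0 + 1) ^ 2 / b * \<epsilon> * P"
      using slack by simp
    finally have "(x - 8 * real (t0 + 1) ^ 2 / b * \<epsilon>) * P < (a + 1) * P" by (simp add: algebra_simps)
    then show "4 * \<zeta> / (\<epsilon> * real_of_int (len i)) - 8 * real (t0 + 1) ^ 2 / b * \<epsilon> < real (\<alpha> i) + 1"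
      using P unfolding a_def[symmetric] x_def[symmetric] by simp
  next
    show "T = {side_line i t | i t. i \<in> {1..4} \<and> 1 \<le> t \<and> t \<le> int (\<alpha> i)}"
      unfolding \<alpha>(4)
    proof (intro equalityI subsetI)
      fix l assume "l \<in> {side_line i t | i t. i \<in> {1..4} \<and> 1 \<le> t \<and> t \<le> int (\<alpha> i)}"
      then obtain i t where "i \<in> {1..4::nat}" "1 \<le> t" "t \<le> int (\<alpha> i)" "l = side_line i t" by blast
      then show "l \<in> {side_line i (int t) | i t. i \<in> {1..4} \<and> 1 \<le> t \<and> t \<le> \<alpha> i}"
        by (intro CollectI exI[of _ i] exI[of _ "nat t"]) auto
    qed force
  qed
qed

text \<open>The sides of the inner octagon differ by at most two points from those of \<open>X\<close>, which changes
  \<open>4 * \<zeta> / P\<close> by less than one; the summand \<open>2\<close> in \<^const>\<open>c_alpha\<close> absorbs this and the rounding.\<close>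

lemma c_alpha_ge:
  assumes eps: "0 < \<epsilon>" and zeta: "0 < \<zeta>" and b: "0 < b"
    and sides: "\<And>j. j \<in> {1..4} \<Longrightarrow> b \<le> \<epsilon> * real_of_int (len j)"
    and small: "4 * \<epsilon> < b" "16 * \<zeta> * \<epsilon> \<le> b\<^sup>2" and i: "i \<in> {1..4}"
    and a: "real a < 4 * \<zeta> / (\<epsilon> * real_of_int (len i)) + 1 / 4"
  shows "int a \<le> c_alpha \<zeta> \<epsilon> (emb \<epsilon> ` X)"
proof -
  have len4: "4 < len j" if "j \<in> {1..4}" for j
  proof -
    have "\<epsilon> * 4 < \<epsilon> * real_of_int (len j)" using sides[OF that] small(1) by linarith
    then show ?thesis using eps by simp
  qed
  have inner: "int_octagon (a1 + 1) (b1 - 1) (a2 + 1) (b2 - 1)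
      (max 0 (s1 - 2)) (max 0 (s2 - 2)) (max 0 (s3 - 2)) (max 0 (s4 - 2))"
    using shrink[of "\<lambda>_. 1"] len4 by force
  interpret I: int_octagon "a1 + 1" "b1 - 1" "a2 + 1" "b2 - 1" "max 0 (s1 - 2)" "max 0 (s2 - 2)" "max 0 (s3 - 2)" "max 0 (s4 - 2)"
    by (rule inner)
  have inner_len: "axis_len \<epsilon> (inner_oct (emb \<epsilon> ` X)) j = \<epsilon> * real_of_int (I.len j)" if "j \<in> {1..4}" for j
    unfolding inner_oct_emb[OF eps] using I.axis_len_emb[OF eps that] .
  have len_bounds: "I.len j \<le> len j + 2 \<and> len j - 2 \<le> I.len j" if "j \<in> {1..4}" for j
    using that cut_nonneg unfolding len_def I.len_def by (elim index_cases) (auto simp: max_def)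
  define m where "m = (MIN j\<in>{1..4}. axis_len \<epsilon> (inner_oct (emb \<epsilon> ` X)) j)"
  define P where "P = \<epsilon> * real_of_int (len i)"
  have "m \<le> axis_len \<epsilon> (inner_oct (emb \<epsilon> ` X)) i" unfolding m_def using i by (intro Min_le) auto
  also have "\<dots> \<le> \<epsilon> * real_of_int (len i + 2)"
    unfolding inner_len[OF i] using len_bounds[OF i] eps by (intro mult_left_mono) linarith+
  finally have m_le: "m \<le> P + 2 * \<epsilon>" by (simp add: P_def algebra_simps)
  have "0 < m" unfolding m_def
  proof (subst Min_gr_iff)
    show "\<forall>x\<in>axis_len \<epsilon> (inner_oct (emb \<epsilon> ` X)) ` {1..4}. 0 < x"
    proof (intro ballI)
      fix x assume "x \<in> axis_len \<epsilon> (inner_oct (emb \<epsilon> ` X)) ` {1..4}"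
      then obtain j where j: "j \<in> {1..4}" "x = axis_len \<epsilon> (inner_oct (emb \<epsilon> ` X)) j" by blast
      have "0 < I.len j" using len4[OF j(1)] len_bounds[OF j(1)] by linarith
      then show "0 < x" unfolding j(2) inner_len[OF j(1)] using eps by simp
    qed
  qed auto
  have P: "b \<le> P" "0 < P" using sides[OF i] b by (simp_all add: P_def)
  have "4 * \<zeta> / P - 4 * \<zeta> / m \<le> 4 * \<zeta> / P - 4 * \<zeta> / (P + 2 * \<epsilon>)"
    using m_le \<open>0 < m\<close> zeta by (intro diff_left_mono divide_left_mono) (auto intro: mult_pos_pos)
  also have "\<dots> = 8 * \<zeta> * \<epsilon> / (P * (P + 2 * \<epsilon>))" using P eps by (simp add: field_simps)
  also have "\<dots> \<le> 8 * \<zeta> * \<epsilon> / (b * b)"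
    using P b eps zeta by (intro divide_left_mono mult_mono mult_pos_pos) auto
  also have "\<dots> \<le> 1 / 2" using small(2) b by (simp add: field_simps power2_eq_square)
  finally have "4 * \<zeta> / P \<le> 4 * \<zeta> / m + 1 / 2" by simp
  with a have "real a - 1 \<le> 4 * \<zeta> / m" unfolding P_def[symmetric] by linarith
  then have "int a - 1 \<le> \<lfloor>4 * \<zeta> / m\<rfloor>" by (simp add: le_floor_iff)
  then show ?thesis unfolding c_alpha_def m_def by linarith
qed

end

lemma finite_grid_ball:
  assumes eps: "0 < \<epsilon>" and sub: "emb \<epsilon> ` S \<subseteq> ball c R"
  shows "finite S"
proof -
  have "bounded (emb \<epsilon> ` S)" using sub bounded_ball bounded_subset by blast
  then obtain B where B: "\<And>z. z \<in> S \<Longrightarrow> norm (emb \<epsilon> z) \<le> B" unfolding bounded_iff by blast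
  define M where "M = \<lceil>B / \<epsilon>\<rceil>"
  have "S \<subseteq> {-M..M} \<times> {-M..M}"
  proof
    fix z assume z: "z \<in> S"
    have "\<bar>n\<bar> \<le> M" if "\<bar>\<epsilon> * real_of_int n\<bar> \<le> B" for n
    proof -
      have "real_of_int \<bar>n\<bar> \<le> B / \<epsilon>" using that eps by (simp add: abs_mult pos_le_divide_eq mult.commute)
      then show ?thesis unfolding M_def by linarith
    qed
    moreover have "\<bar>\<epsilon> * real_of_int (fst z)\<bar> \<le> B" "\<bar>\<epsilon> * real_of_int (snd z)\<bar> \<le> B"
      using B[OF z] norm_fst_le[of "\<epsilon> * real_of_int (fst z)" "\<epsilon> * real_of_int (snd z)"]
        norm_snd_le[of "\<epsilon> * real_of_int (snd z)" "\<epsilon> * real_of_int (fst z)"] by (simp_all add: emb_def)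
    ultimately have "\<bar>fst z\<bar> \<le> M" "\<bar>snd z\<bar> \<le> M" by blast+
    then show "z \<in> {-M..M} \<times> {-M..M}" by (cases z) auto
  qed
  then show ?thesis by (rule finite_subset) simp
qed

context int_octagon begin

text \<open>One step at a fixed scale. Optimal removals shrink the octagon by at most \<^const>\<open>c_alpha\<close> lines at each
  side, so each diagonal side loses at most twice as many steps and the hypothesis on the diagonal sides
  leaves two corner sites more than there are particles. This is used first for some optimal removal,
  to see that it can be completed to a competitor with all particles on corner sites, and then for the
  removal that belongs to the minimizer.\<close>

theorem minimizer_is_shrunk_octagon:
  fixes u w :: "point \<Rightarrow> real" and t0 :: nat and b c :: real
  assumes c_def: "c = 8 * real (t0 + 1) ^ 2 / b"
    and eps: "0 < \<epsilon>" and zeta: "0 < \<zeta>" and k: "0 < k" "k < 1"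
    and w: "sites \<epsilon> w 1 = X" and min: "minimizer k (\<zeta> * \<epsilon>) \<gamma> \<epsilon> w u"
    and surf_rigid: "4 * k < \<epsilon> powr (\<gamma> - 2) / \<zeta>"
    and b: "0 < b" and sides: "\<And>j. j \<in> {1..4} \<Longrightarrow> b \<le> \<epsilon> * real_of_int (len j)"
    and t0: "1 \<le> t0" "16 * \<zeta> < real t0 * b"
    and small: "8 * real t0 ^ 2 * \<epsilon> < b" "6 * real t0 ^ 2 * \<epsilon> < 8 * \<zeta>" "c * \<epsilon> \<le> 1/4"
      "4 * \<epsilon> < b" "16 * \<zeta> * \<epsilon> \<le> b\<^sup>2"
    and room: "real (card (sites \<epsilon> w 0)) + 2 \<le> (\<Sum>i=1..4. diag_len \<epsilon> (emb \<epsilon> ` X) i / (sqrt 2 * \<epsilon>)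
       - 2 * real_of_int (c_alpha \<zeta> \<epsilon> (emb \<epsilon> ` X)))"
  shows "crystalline_step \<epsilon> \<zeta> c (card (sites \<epsilon> w 0)) (emb \<epsilon> ` X) (phase \<epsilon> u)"
proof -
  have kappa: "0 < \<epsilon> / \<zeta>" using eps zeta by simp
  interpret weighted_lines lines "grid_line X" "\<lambda>p. real (depth X p)" "\<epsilon> / \<zeta>"
    by (rule weighted_lines_grid[OF kappa])
  define ca where "ca = c_alpha \<zeta> \<epsilon> (emb \<epsilon> ` X)"
  have shape: "\<exists>\<alpha>. (\<forall>i\<in>{1..4}. \<forall>j\<in>{1..4}. 2 * int (\<alpha> j) < len i) \<and>
      (\<forall>i\<in>{1..4}. real (\<alpha> i) < 4 * \<zeta> / (\<epsilon> * real_of_int (len i)) + c * \<epsilon> \<and>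
         4 * \<zeta> / (\<epsilon> * real_of_int (len i)) - c * \<epsilon> < real (\<alpha> i) + 1 \<and> int (\<alpha> i) \<le> ca) \<and>
      T = {side_line i t | i t. i \<in> {1..4} \<and> 1 \<le> t \<and> t \<le> int (\<alpha> i)}" if opt: "optimal T" for T
  proof -
    obtain \<alpha> where \<alpha>: "\<And>i j. i \<in> {1..4} \<Longrightarrow> j \<in> {1..4} \<Longrightarrow> 2 * int (\<alpha> j) < len i"
      "\<And>i. i \<in> {1..4} \<Longrightarrow> real (\<alpha> i) < 4 * \<zeta> / (\<epsilon> * real_of_int (len i)) + c * \<epsilon>"
      "\<And>i. i \<in> {1..4} \<Longrightarrow> 4 * \<zeta> / (\<epsilon> * real_of_int (len i)) - c * \<epsilon> < real (\<alpha> i) + 1"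
      "T = {side_line i t | i t. i \<in> {1..4} \<and> 1 \<le> t \<and> t \<le> int (\<alpha> i)}"
      using optimal_shape[OF eps zeta b sides t0 small(1,2) opt] unfolding c_def by blast
    moreover have "int (\<alpha> i) \<le> ca" if i: "i \<in> {1..4}" for i
      unfolding ca_def by (rule c_alpha_ge[OF eps zeta b sides small(4,5) i]) (use \<alpha>(2)[OF i] small(3) in auto)
    ultimately show ?thesis by blast
  qed
  have sum4: "(\<Sum>i=1..4. f i) = f 1 + f 2 + f 3 + f 4" for f :: "nat \<Rightarrow> real"
    by (simp add: eval_nat_numeral)
  have "(\<Sum>i=1..4. diag_len \<epsilon> (emb \<epsilon> ` X) i / (sqrt 2 * \<epsilon>) - 2 * real_of_int ca)
      = (\<Sum>i=1..4. real_of_int (cut i) - 2 * real_of_int ca)"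
    using eps by (intro sum.cong refl) (simp add: diag_len_emb)
  then have "real (card (sites \<epsilon> w 0)) + 2 \<le> (\<Sum>i=1..4. real_of_int (cut i) - 2 * real_of_int ca)"
    using room unfolding ca_def[symmetric] by (simp only:)
  then have "real_of_int (int (card (sites \<epsilon> w 0)) + 2) \<le> real_of_int (cut 1 + cut 2 + cut 3 + cut 4 - 8 * ca)"
    unfolding sum4 by simp
  then have room': "int (card (sites \<epsilon> w 0)) + 2 \<le> s1 + s2 + s3 + s4 - 8 * ca"
    unfolding of_int_le_iff by (simp add: cut_def)
  have trimmed: "s1 + s2 + s3 + s4 - 8 * ca \<le> max 0 (s1 - int (\<beta> 1) - int (\<beta> 2)) + max 0 (s2 - int (\<beta> 2) - int (\<beta> 3))
      + max 0 (s3 - int (\<beta> 3) - int (\<beta> 4)) + max 0 (s4 - int (\<beta> 4) - int (\<beta> 1))"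
    if "\<forall>i\<in>{1..4}. int (\<beta> i) \<le> ca" for \<beta> :: "nat \<Rightarrow> nat"
    using that[rule_format, of 1] that[rule_format, of 2] that[rule_format, of 3] that[rule_format, of 4]
    unfolding max_def by auto
  obtain T0 where T0: "optimal T0" using optimal_exists by blast
  obtain \<beta> where \<beta>: "\<forall>i\<in>{1..4}. \<forall>j\<in>{1..4}. 2 * int (\<beta> j) < len i" "\<forall>i\<in>{1..4}. int (\<beta> i) \<le> ca"
     "T0 = {side_line i t | i t. i \<in> {1..4} \<and> 1 \<le> t \<and> t \<le> int (\<beta> i)}"
    using shape[OF T0] by blast
  obtain T where T: "optimal T" and J_eq: "sites \<epsilon> u 1 = X - \<Union>(grid_line X ` T)"
  proof -
    interpret K: int_octagon "a1 + int (\<beta> 2)" "b1 - int (\<beta> 4)" "a2 + int (\<beta> 1)" "b2 - int (\<beta> 3)"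
      "max 0 (s1 - int (\<beta> 1) - int (\<beta> 2))" "max 0 (s2 - int (\<beta> 2) - int (\<beta> 3))"
      "max 0 (s3 - int (\<beta> 3) - int (\<beta> 4))" "max 0 (s4 - int (\<beta> 4) - int (\<beta> 1))"
      using shrink[of "\<lambda>i. int (\<beta> i)"] \<beta>(1) by simp
    have K_eq: "K.X = X - \<Union>(grid_line X ` T0)"
      using shrink_pts[of "\<lambda>i. int (\<beta> i)"] unfolding \<beta>(3) by simp
    have "int (card (sites \<epsilon> w 0)) + 2 \<le> int (card K.corners)"
      using room' K.card_corners trimmed[OF \<beta>(2)] by linarith
    then have "card (sites \<epsilon> w 0) \<le> card K.corners" by linarith
    then obtain Z where Z: "Z \<subseteq> K.corners" "card Z = card (sites \<epsilon> w 0)" "finite Z"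
      using obtain_subset_with_card_n by metis
    have T0_lines: "T0 = {True} \<times> {a2..a2 + int (\<beta> 1) - 1} \<union> {False} \<times> {a1..a1 + int (\<beta> 2) - 1}
        \<union> {True} \<times> {b2 - int (\<beta> 3) + 1..b2} \<union> {False} \<times> {b1 - int (\<beta> 4) + 1..b1}"
      unfolding \<beta>(3) by (rule removed_lines)
    show thesis
    proof (rule minimizer_removes_optimal_lines[OF eps zeta k w min surf_rigid T0 K_eq K.line_convex_X _ _ Z(3) _ Z(2) _ _ that])
      show "fst ` K.X = {x \<in> {a1..b1}. (False, x) \<notin> T0}" unfolding K.rows_columns T0_lines by auto
      show "snd ` K.X = {y \<in> {a2..b2}. (True, y) \<notin> T0}" unfolding K.rows_columns T0_lines by auto
      show "Z \<inter> X = {}"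
      proof -
        \<comment> \<open>a nonzero cut of the shrunk octagon lies on the same diagonal line as that of X\<close>
        have "z \<notin> X" if "z \<in> K.corners" for z
          using that unfolding K.corners_def by (cases z) (auto simp: oct_mem max_def split: if_splits)
        then show ?thesis using Z(1) by blast
      qed
    next
      fix x y assume "(x, y) \<in> Z"
      then have c: "(x, y) \<in> K.corners" using Z(1) by blast
      show "((x - 1, y) \<in> K.X) \<noteq> ((x + 1, y) \<in> K.X) \<and> ((x, y - 1) \<in> K.X) \<noteq> ((x, y + 1) \<in> K.X)"
        using K.corner_neighbours(2,3)[OF c] by blast
      show "(x + 1, y) \<notin> Z \<and> (x, y + 1) \<notin> Z"
        using K.corner_neighbours(4,5)[OF c] Z(1) by blast
    qed
  qed
  obtain \<alpha> where \<alpha>: "\<forall>i\<in>{1..4}. \<forall>j\<in>{1..4}. 2 * int (\<alpha> j) < len i"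
      "\<forall>i\<in>{1..4}. real (\<alpha> i) < 4 * \<zeta> / (\<epsilon> * real_of_int (len i)) + c * \<epsilon>"
      "\<forall>i\<in>{1..4}. 4 * \<zeta> / (\<epsilon> * real_of_int (len i)) - c * \<epsilon> < real (\<alpha> i) + 1"
      "\<forall>i\<in>{1..4}. int (\<alpha> i) \<le> ca"
      "T = {side_line i t | i t. i \<in> {1..4} \<and> 1 \<le> t \<and> t \<le> int (\<alpha> i)}"
    using shape[OF T] by blast
  interpret K: int_octagon "a1 + int (\<alpha> 2)" "b1 - int (\<alpha> 4)" "a2 + int (\<alpha> 1)" "b2 - int (\<alpha> 3)"
      "max 0 (s1 - int (\<alpha> 1) - int (\<alpha> 2))" "max 0 (s2 - int (\<alpha> 2) - int (\<alpha> 3))"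
      "max 0 (s3 - int (\<alpha> 3) - int (\<alpha> 4))" "max 0 (s4 - int (\<alpha> 4) - int (\<alpha> 1))"
    using shrink[of "\<lambda>i. int (\<alpha> i)"] \<alpha>(1) by simp
  have "sites \<epsilon> u 1 = K.X"
    using shrink_pts[of "\<lambda>i. int (\<alpha> i)"] unfolding J_eq \<alpha>(5) by simp
  then have J: "phase \<epsilon> u = emb \<epsilon> ` K.X" unfolding phase_emb by simp
  have "K.X \<subseteq> X" using \<open>sites \<epsilon> u 1 = K.X\<close> J_eq by blast
  then have sub: "emb \<epsilon> ` K.X \<subseteq> emb \<epsilon> ` X" by blast
  have "int (card (sites \<epsilon> w 0)) + 2 \<le> int (card K.corners)"
    using room' K.card_corners trimmed[OF \<alpha>(4)] by linarith
  then have many: "card (sites \<epsilon> w 0) + 2 \<le> card (corner_sites \<epsilon> (emb \<epsilon> ` K.X))"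
    using K.corner_sites_emb[OF eps] by linarith
  have diag: "diag_seg \<epsilon> (emb \<epsilon> ` K.X) i \<subseteq> diag_seg \<epsilon> (emb \<epsilon> ` X) i"
    if "i \<in> {1..4}" "0 < diag_len \<epsilon> (emb \<epsilon> ` K.X) i" for i
  proof -
    have pos: "0 < K.cut i" using that(2) eps unfolding K.diag_len_emb[OF eps that(1)] by (simp add: zero_less_mult_iff)
    show ?thesis
      using that(1)
    proof (cases rule: index_cases)
      case 1
      have "emb \<epsilon> (a1 + int (\<alpha> 2) + t, a2 + int (\<alpha> 1) + (s1 - int (\<alpha> 1) - int (\<alpha> 2)) - t) \<in> diag_seg \<epsilon> (emb \<epsilon> ` X) 1"
        if "0 \<le> t" "t \<le> s1 - int (\<alpha> 1) - int (\<alpha> 2)" for t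
        unfolding diag_seg_emb(1)[OF eps] using that by (intro CollectI exI[of _ "int (\<alpha> 2) + t"]) (auto simp: algebra_simps)
      then show ?thesis using pos unfolding 1 K.diag_seg_emb(1)[OF eps] K.cut_def by auto
    next
      case 2
      have "emb \<epsilon> (a1 + int (\<alpha> 2) + t, b2 - int (\<alpha> 3) - (s2 - int (\<alpha> 2) - int (\<alpha> 3)) + t) \<in> diag_seg \<epsilon> (emb \<epsilon> ` X) 2"
        if "0 \<le> t" "t \<le> s2 - int (\<alpha> 2) - int (\<alpha> 3)" for t
        unfolding diag_seg_emb(2)[OF eps] using that by (intro CollectI exI[of _ "int (\<alpha> 2) + t"]) (auto simp: algebra_simps)
      then show ?thesis using pos unfolding 2 K.diag_seg_emb(2)[OF eps] K.cut_def by auto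
    next
      case 3
      have "emb \<epsilon> (b1 - int (\<alpha> 4) - (s3 - int (\<alpha> 3) - int (\<alpha> 4)) + t, b2 - int (\<alpha> 3) - t) \<in> diag_seg \<epsilon> (emb \<epsilon> ` X) 3"
        if "0 \<le> t" "t \<le> s3 - int (\<alpha> 3) - int (\<alpha> 4)" for t
        unfolding diag_seg_emb(3)[OF eps] using that by (intro CollectI exI[of _ "int (\<alpha> 3) + t"]) (auto simp: algebra_simps)
      then show ?thesis using pos unfolding 3 K.diag_seg_emb(3)[OF eps] K.cut_def by auto
    next
      case 4
      have "emb \<epsilon> (b1 - int (\<alpha> 4) - (s4 - int (\<alpha> 4) - int (\<alpha> 1)) + t, a2 + int (\<alpha> 1) + t) \<in> diag_seg \<epsilon> (emb \<epsilon> ` X) 4"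
        if "0 \<le> t" "t \<le> s4 - int (\<alpha> 4) - int (\<alpha> 1)" for t
        unfolding diag_seg_emb(4)[OF eps] using that by (intro CollectI exI[of _ "int (\<alpha> 1) + t"]) (auto simp: algebra_simps)
      then show ?thesis using pos unfolding 4 K.diag_seg_emb(4)[OF eps] K.cut_def by auto
    qed
  qed
  have nodiag: "diag_len \<epsilon> (emb \<epsilon> ` K.X) i = 0" if "i \<in> {1..4}" "diag_len \<epsilon> (emb \<epsilon> ` X) i = 0" for i
  proof -
    have "cut i = 0" using that(2) eps unfolding diag_len_emb[OF eps that(1)] by simp
    then have "K.cut i = 0" using that(1) unfolding cut_def K.cut_def by (elim index_cases) auto
    then show ?thesis unfolding K.diag_len_emb[OF eps that(1)] by simp
  qed
  have moved: "if infdist (4 * \<zeta> / axis_len \<epsilon> (emb \<epsilon> ` X) i) (real ` {1..}) \<ge> c * \<epsilon>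
      then displacement \<epsilon> (emb \<epsilon> ` X) (emb \<epsilon> ` K.X) i = real_of_int \<lfloor>4 * \<zeta> / axis_len \<epsilon> (emb \<epsilon> ` X) i\<rfloor>
      else displacement \<epsilon> (emb \<epsilon> ` X) (emb \<epsilon> ` K.X) i \<in> {real_of_int (round (4 * \<zeta> / axis_len \<epsilon> (emb \<epsilon> ` X) i) - 1),
        real_of_int (round (4 * \<zeta> / axis_len \<epsilon> (emb \<epsilon> ` X) i))}"
    if i: "i \<in> {1..4}" for i
  proof -
    have moved_by: "displacement \<epsilon> (emb \<epsilon> ` X) (emb \<epsilon> ` K.X) i = real (\<alpha> i)"
      using displacement_shrink[where \<alpha>="\<lambda>i. int (\<alpha> i)", OF eps i K.int_octagon_axioms] by simp
    have "0 \<le> 4 * \<zeta> / (\<epsilon> * real_of_int (len i))"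
      using sides[OF i] b zeta by (intro divide_nonneg_nonneg) auto
    from almost_floor[OF \<alpha>(2)[rule_format, OF i] \<alpha>(3)[rule_format, OF i] small(3) this] show ?thesis
      unfolding axis_len_emb[OF eps i] moved_by .
  qed
  show ?thesis
    unfolding crystalline_step_def J
    by (intro conjI ballI impI K.discrete_octagon_emb[OF eps] sub many diag nodiag moved)
qed

end

lemma ratio_tendsto_zero_bound:
  fixes a d :: real
  assumes "0 < a"
  shows "\<forall>\<^sub>F \<epsilon> in at_right 0. d * \<epsilon> < a"
proof -
  have "((\<lambda>\<epsilon>::real. d * \<epsilon>) \<longlongrightarrow> d * 0) (at_right 0)" by (intro tendsto_intros)
  then show ?thesis using assms by (intro order_tendstoD(2)[of _ "d * 0"]) auto
qed

text \<open>The exponent \<open>\<gamma> - 2\<close> is negative.\<close>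

lemma surfactant_penalty_dominates:
  fixes \<gamma> \<zeta> d :: real
  assumes "\<gamma> < 2" "0 < \<zeta>"
  shows "\<forall>\<^sub>F \<epsilon> in at_right 0. d < \<epsilon> powr (\<gamma> - 2) / \<zeta>"
proof -
  have "((\<lambda>\<epsilon>::real. \<epsilon> powr (2 - \<gamma>)) \<longlongrightarrow> 0) (at_right 0)"
  proof (rule tendsto_zero_powrI[where b="2 - \<gamma>"])
    show "\<forall>\<^sub>F \<epsilon>::real in at_right 0. 0 \<le> \<epsilon>"
      using eventually_at_right_less[of "0::real"] by (rule eventually_mono) simp
  qed (use assms in \<open>auto intro!: tendsto_intros\<close>)
  then have "((\<lambda>\<epsilon>::real. (\<bar>d\<bar> + 1) * \<zeta> * \<epsilon> powr (2 - \<gamma>)) \<longlongrightarrow> (\<bar>d\<bar> + 1) * \<zeta> * 0) (at_right 0)"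
    by (intro tendsto_intros)
  then have "\<forall>\<^sub>F \<epsilon>::real in at_right 0. (\<bar>d\<bar> + 1) * \<zeta> * \<epsilon> powr (2 - \<gamma>) < 1"
    by (intro order_tendstoD(2)[of _ "(\<bar>d\<bar> + 1) * \<zeta> * 0"]) auto
  then show ?thesis using eventually_at_right_less[of 0]
  proof eventually_elim
    case (elim \<epsilon>)
    have "\<epsilon> powr (2 - \<gamma>) * \<epsilon> powr (\<gamma> - 2) = 1" using elim(2) by (simp flip: powr_add)
    then have "(\<bar>d\<bar> + 1) * \<zeta> = (\<bar>d\<bar> + 1) * \<zeta> * \<epsilon> powr (2 - \<gamma>) * \<epsilon> powr (\<gamma> - 2)"
      by (simp only: mult.assoc mult_1_right)
    also have "\<dots> < 1 * \<epsilon> powr (\<gamma> - 2)" using elim by (intro mult_strict_right_mono) auto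
    finally have "(\<bar>d\<bar> + 1) * \<zeta> < \<epsilon> powr (\<gamma> - 2)" by simp
    then have "\<bar>d\<bar> + 1 < \<epsilon> powr (\<gamma> - 2) / \<zeta>" using assms(2) by (simp add: pos_less_divide_eq)
    then show ?case by linarith
  qed
qed

lemma eventually_crystalline_step:
  fixes u u' :: "real \<Rightarrow> point \<Rightarrow> real" and t0 :: nat
  assumes c_def: "c = 8 * real (t0 + 1) ^ 2 / cbar" and t0: "1 \<le> t0" "16 * \<zeta> < real t0 * cbar"
    and k: "0 < k" "k < 1" and zeta: "0 < \<zeta>" and cbar: "0 < cbar" and gamma: "\<gamma> < 2"
    and step: "\<And>\<epsilon>. 0 < \<epsilon> \<Longrightarrow> cond_H Rbar cbar \<epsilon> (phase \<epsilon> (u \<epsilon>)) \<and> minimizer k (\<zeta> * \<epsilon>) \<gamma> \<epsilon> (u \<epsilon>) (u' \<epsilon>)"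
    and octagon: "\<forall>\<^sub>F \<epsilon> in at_right 0. discrete_octagon \<epsilon> (phase \<epsilon> (u \<epsilon>)) \<and>
       real (card (surf \<epsilon> (u \<epsilon>))) + 2 \<le> (\<Sum>i=1..4. diag_len \<epsilon> (phase \<epsilon> (u \<epsilon>)) i / (sqrt 2 * \<epsilon>)
         - 2 * real_of_int (c_alpha \<zeta> \<epsilon> (phase \<epsilon> (u \<epsilon>))))"
  shows "\<forall>\<^sub>F \<epsilon> in at_right 0. crystalline_step \<epsilon> \<zeta> c (card (surf \<epsilon> (u \<epsilon>))) (phase \<epsilon> (u \<epsilon>)) (phase \<epsilon> (u' \<epsilon>))"
  using octagon surfactant_penalty_dominates[OF gamma zeta, of "4 * k"] eventually_at_right_less[of "0::real"]
    ratio_tendsto_zero_bound[OF cbar, of "8 * real t0 ^ 2"]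
    ratio_tendsto_zero_bound[of "8 * \<zeta>" "6 * real t0 ^ 2", OF mult_pos_pos[OF _ zeta], simplified]
    ratio_tendsto_zero_bound[of "1/4" c, simplified] ratio_tendsto_zero_bound[OF cbar, of 4]
    ratio_tendsto_zero_bound[of "cbar\<^sup>2" "16 * \<zeta>", OF zero_less_power[OF cbar]]
proof eventually_elim
  case (elim \<epsilon>)
  note eps = \<open>0 < \<epsilon>\<close>
  have H: "cond_H Rbar cbar \<epsilon> (phase \<epsilon> (u \<epsilon>))" and min: "minimizer k (\<zeta> * \<epsilon>) \<gamma> \<epsilon> (u \<epsilon>) (u' \<epsilon>)"
    using step[OF eps] by blast+
  obtain x where "phase \<epsilon> (u \<epsilon>) \<subseteq> ball x Rbar" using H unfolding cond_H_def by blast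
  then have "finite (sites \<epsilon> (u \<epsilon>) 1)" unfolding phase_emb by (rule finite_grid_ball[OF eps])
  then have fin: "finite (phase \<epsilon> (u \<epsilon>))" unfolding phase_emb by simp
  have slices: "cbar / \<epsilon> \<le> real (card (slice (phase \<epsilon> (u \<epsilon>)) i))" if "i \<in> {1..4}" for i
  proof -
    have "(MIN i\<in>{1..4}. card (slice (phase \<epsilon> (u \<epsilon>)) i)) \<le> card (slice (phase \<epsilon> (u \<epsilon>)) i)"
      using that by (intro Min_le) auto
    then show ?thesis using H unfolding cond_H_def by linarith
  qed
  have "phase \<epsilon> (u \<epsilon>) \<noteq> {}"
  proof
    assume "phase \<epsilon> (u \<epsilon>) = {}"
    then have "slice (phase \<epsilon> (u \<epsilon>)) 1 = {}" by (simp add: slice_def extremal_def)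
    then show False using slices[of 1] divide_pos_pos[OF cbar eps] by simp
  qed
  then obtain a1 b1 a2 b2 s1 s2 s3 s4 where oct: "int_octagon a1 b1 a2 b2 s1 s2 s3 s4"
    and I: "phase \<epsilon> (u \<epsilon>) = emb \<epsilon> ` oct_pts a1 b1 a2 b2 s1 s2 s3 s4"
    using discrete_octagon_params[OF eps _ fin] elim(1) by blast
  interpret int_octagon a1 b1 a2 b2 s1 s2 s3 s4 by (rule oct)
  have "emb \<epsilon> ` sites \<epsilon> (u \<epsilon>) 1 = emb \<epsilon> ` X" using I unfolding phase_emb .
  then have sites: "sites \<epsilon> (u \<epsilon>) 1 = X" using eps inj_image_eq_iff[OF emb_inj[of \<epsilon>]] by simp
  have sides: "cbar \<le> \<epsilon> * real_of_int (len j)" if j: "j \<in> {1..4}" for j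
  proof -
    have "cbar / \<epsilon> \<le> real_of_int (len j)"
      using slices[OF j] card_slice_emb[OF eps j] unfolding I by (metis of_int_of_nat_eq)
    then show ?thesis using eps by (simp add: pos_divide_le_eq mult.commute)
  qed
  have "card (surf \<epsilon> (u \<epsilon>)) = card (sites \<epsilon> (u \<epsilon>) 0)" unfolding surf_emb by (rule card_emb[OF eps])
  then show "?case"
    using minimizer_is_shrunk_octagon[OF c_def eps zeta k sites min _ cbar sides t0] elim k(1)
    unfolding I by (simp del: One_nat_def)
qed

theorem proposition3p5:
  fixes k \<zeta> cbar :: real
  assumes "1/3 < k" and "k < 1" and "0 < \<zeta>" and "0 < cbar"
  shows "\<exists>c>0. \<forall>(\<gamma>::real) (lam::real) (\<mu>::real) (Rbar::real)
      (u :: real \<Rightarrow> point \<Rightarrow> real) (u' :: real \<Rightarrow> point \<Rightarrow> real).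
    0 < \<gamma> \<and> \<gamma> < 2 \<and> 0 < lam \<and> \<mu> < 1/4 \<and> 0 < Rbar \<and>
    (\<forall>\<epsilon>>0. u \<epsilon> \<in> admissible \<epsilon> \<and> cond_H Rbar cbar \<epsilon> (phase \<epsilon> (u \<epsilon>)) \<and>
       minimizer k (\<zeta> * \<epsilon>) \<gamma> \<epsilon> (u \<epsilon>) (u' \<epsilon>)) \<and>
    ((\<lambda>\<epsilon>. \<epsilon> * real (card (surf \<epsilon> (u \<epsilon>)))) \<longlongrightarrow> lam) (at_right 0) \<and>
    (\<forall>\<^sub>F \<epsilon> in at_right 0.
       real (card (outer_bd \<epsilon> (phase \<epsilon> (u \<epsilon>)))) - 8 * \<epsilon> powr (\<mu> - 1)
         > real (card (surf \<epsilon> (u \<epsilon>))) \<and>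
       discrete_octagon \<epsilon> (phase \<epsilon> (u \<epsilon>)) \<and>
       (\<Sum>i=1..4. diag_len \<epsilon> (phase \<epsilon> (u \<epsilon>)) i / (sqrt 2 * \<epsilon>)
                   - 2 * real_of_int (c_alpha \<zeta> \<epsilon> (phase \<epsilon> (u \<epsilon>))))
         \<ge> real (card (surf \<epsilon> (u \<epsilon>))) + 2)
    \<longrightarrow> (\<exists>\<epsilon>bar>0. \<forall>\<epsilon>. 0 < \<epsilon> \<and> \<epsilon> \<le> \<epsilon>bar \<longrightarrow>
       (let I = phase \<epsilon> (u \<epsilon>); J = phase \<epsilon> (u' \<epsilon>) in
        discrete_octagon \<epsilon> J \<and> J \<subseteq> I \<and>
        card (corner_sites \<epsilon> J) \<ge> card (surf \<epsilon> (u \<epsilon>)) + 2 \<and>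
        (\<forall>i\<in>{1..4}. diag_len \<epsilon> J i > 0 \<longrightarrow> diag_seg \<epsilon> J i \<subseteq> diag_seg \<epsilon> I i) \<and>
        (\<forall>i\<in>{1..4}. diag_len \<epsilon> I i = 0 \<longrightarrow> diag_len \<epsilon> J i = 0) \<and>
        (\<forall>i\<in>{1..4}. let x = 4 * \<zeta> / axis_len \<epsilon> I i in
           if infdist x (real ` {1..}) \<ge> c * \<epsilon>
           then displacement \<epsilon> I J i = real_of_int \<lfloor>x\<rfloor>
           else displacement \<epsilon> I J i \<in> {real_of_int (round x - 1), real_of_int (round x)})))"
proof -
  \<comment> \<open>this makes lines at positions beyond t0 too expensive to remove\<close>
  define t0 where "t0 = nat \<lceil>16 * \<zeta> / cbar\<rceil> + 1"
  define c where "c = 8 * real (t0 + 1) ^ 2 / cbar"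
  have "0 < c" using assms(4) by (simp add: c_def)
  have "16 * \<zeta> / cbar < real t0" unfolding t0_def by linarith
  then have "16 * \<zeta> < real t0 * cbar" using assms(4) by (simp add: pos_divide_less_eq)
  note eventually_step = eventually_crystalline_step[OF c_def _ this _ assms(2-4)]
  have small_scales: "\<exists>\<epsilon>bar>0. \<forall>\<epsilon>. 0 < \<epsilon> \<and> \<epsilon> \<le> \<epsilon>bar \<longrightarrow> P \<epsilon>" if P: "eventually P (at_right 0)" for P :: "real \<Rightarrow> bool"
  proof -
    obtain b where "0 < b" "\<And>\<epsilon>. 0 < \<epsilon> \<Longrightarrow> \<epsilon> < b \<Longrightarrow> P \<epsilon>" using P unfolding eventually_at_right_field by blast
    then show ?thesis by (intro exI[of _ "b / 2"]) auto
  qed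
  show ?thesis
    unfolding Let_def crystalline_step_def[symmetric]
  proof (rule exI[of _ c], rule conjI[OF \<open>0 < c\<close>], intro allI impI, elim conjE, rule small_scales, rule eventually_step)
    show "1 \<le> t0" by (simp add: t0_def)
    show "0 < k" using assms(1) by simp
  qed (assumption, blast, erule eventually_mono, blast)
qed

end
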